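(* Let $f\colon\mathbb R^n\times\mathbb R^d\to\mathbb R^n$ and $\varphi_1,\dots,\varphi_m\colon\mathbb R^n\times\mathbb R^d\to\mathbb R$, and let $C(p):=\{x\in\mathbb R^n:\varphi_i(x,p)\le0,\ i=1,\dots,m\}$. Let $(\bar x,\bar v,\bar p)\in\mathbb R^n\times\mathbb R^n\times\mathbb R^d$ satisfy $\bar x\in\breve S(\bar v,\bar p)$, where $\breve S(v,p):=\{x\in\mathbb R^n: v\in f(x,p)+N_{C(p)}(x)\}$. Suppose that the $\varphi_i$ are $\mathcal C^2$-smooth around $(\bar x,\bar p)$, that $f$ is differentiable with respect to $x$ at all points $(x,p)$ around $(\bar x,\bar p)$, that $\nabla_xf$ is continuous at $(\bar x,\bar p)$, and that there are a neighborhood $U_0\times P_0$ of $(\bar x,\bar p)$ and a constant $L_0>0$ with $\|f(x,p_1)-f(x,p_2)\|\le L_0\|p_1-p_2\|$ for all $x\in U_0$, $p_1,p_2\in P_0$. Then: (i) If both the partial MFCQ and the partial CRCQ are satisfied at $(\bar x,\bar p)$, then the validity of GSSOSC at $(\bar x,\bar p,\bar v)$ ensures that $\bar x$ is a Lipschitzian fully stable solution of the parametric variational condition $v\in f(x,p)+N_{C(p)}(x)$ corresponding to $(\bar v,\bar p)$. (ii) If the partial LICQ holds at $(\bar x,\bar p)$, then GSSOSC at $(\bar x,\bar p,\bar v)$ is necessary and sufficient for $\bar x$ to be a Lipschitzian fully stable solution of $v\in f(x,p)+N_{C(p)}(x)$ corresponding to $(\bar v,\bar p)$.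
   Context: $N_\Omega$ is the limiting normal cone: $\widehat N_\Omega(\bar z)=\{\zeta:\limsup_{z\to\bar z,\,z\in\Omega}\langle\zeta,z-\bar z\rangle/\|z-\bar z\|\le0\}$ and $N_\Omega(\bar z)$ is the set of limits $\lim\zeta_k$ with $\zeta_k\in\widehat N_\Omega(z_k)$, $z_k\in\Omega$, $z_k\to\bar z$ (empty if $\bar z\notin\Omega$). Notation. $I(\bar x,\bar p)=\{i:\varphi_i(\bar x,\bar p)=0\}$; $\varphi=(\varphi_1,\dots,\varphi_m)$; $L(x,p,\lambda)=f(x,p)+\sum_{i=1}^m\lambda_i\nabla_x\varphi_i(x,p)$; $\Lambda(\bar x,\bar p,\bar v)=\{\lambda\in\mathbb R^m_+:\bar v=L(\bar x,\bar p,\lambda),\ \langle\lambda,\varphi(\bar x,\bar p)\rangle=0\}$; $I_+(\bar x,\bar p,\lambda)=\{i\in I(\bar x,\bar p):\lambda_i>0\}$. Partial MFCQ at $(\bar x,\bar p)$: there is $d\in\mathbb R^n$ with $\langle\nabla_x\varphi_i(\bar x,\bar p),d\rangle<0$ for all $i\in I(\bar x,\bar p)$. Partial CRCQ at $(\bar x,\bar p)$: there is a neighborhood $W$ of $(\bar x,\bar p)$ such that for every $J\subset I(\bar x,\bar p)$ the family $\{\nabla_x\varphi_i(x,p):i\in J\}$ has the same rank for all $(x,p)\in W$. Partial LICQ at $(\bar x,\bar p)$: the gradients $\nabla_x\varphi_i(\bar x,\bar p)$, $i\in I(\bar x,\bar p)$, are linearly independent. GSSOSC (general strong second-order sufficient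 condition) at $(\bar x,\bar p,\bar v)$: for all $\lambda\in\Lambda(\bar x,\bar p,\bar v)$ one has $\langle u,\nabla_xL(\bar x,\bar p,\lambda)u\rangle>0$ whenever $u\ne0$ and $\langle\nabla_x\varphi_i(\bar x,\bar p),u\rangle=0$ for all $i\in I_+(\bar x,\bar p,\lambda)$. Lipschitzian full stability. $\bar x\in\breve S(\bar v,\bar p)$ is a Lipschitzian fully stable solution corresponding to $(\bar v,\bar p)$ if there are a neighborhood $V\times Q\times U$ of $(\bar v,\bar p,\bar x)$, constants $\kappa,\ell>0$, and a single-valued mapping $\vartheta\colon V\times Q\to U$ defined on all of $V\times Q$ with $\mathrm{gph}\,\vartheta=\mathrm{gph}\,\breve S\cap(V\times Q\times U)$ and $\|(v_1-v_2)-2\kappa[\vartheta(v_1,p_1)-\vartheta(v_2,p_2)]\|\le\|v_1-v_2\|+\ell\|p_1-p_2\|$ for all $(v_1,p_1),(v_2,p_2)\in V\times Q$. *)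

theory Defs
  imports "HOL-Analysis.Analysis"
begin

text \<open>The filter excludes the point \<open>z\<close> itself; at an isolated point of \<open>\<Omega>\<close> it is trivial, the
  upper limit is \<open>-\<infinity>\<close>, and the cone is the whole space.\<close>

definition regular_normal_cone :: "'a::euclidean_space set \<Rightarrow> 'a \<Rightarrow> 'a set" where
  "regular_normal_cone \<Omega> z =
     {\<zeta>. Limsup (at z within \<Omega>) (\<lambda>w. ereal (\<zeta> \<bullet> (w - z) / norm (w - z))) \<le> 0}"

definition limiting_normal_cone :: "'a::euclidean_space set \<Rightarrow> 'a \<Rightarrow> 'a set" where
  "limiting_normal_cone \<Omega> z =
     (if z \<in> \<Omega>
      then {\<zeta>. \<exists>zs \<zeta>s. (\<forall>k::nat. zs k \<in> \<Omega> \<and> \<zeta>s k \<in> regular_normal_cone \<Omega> (zs k)) \<and>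
                 zs \<longlonglongrightarrow> z \<and> \<zeta>s \<longlonglongrightarrow> \<zeta>}
      else {})"

definition C2_smooth_around :: "('a::real_normed_vector \<Rightarrow> 'b::real_normed_vector) \<Rightarrow> 'a \<Rightarrow> bool" where
  "C2_smooth_around g z \<longleftrightarrow>
     (\<exists>W (g' :: 'a \<Rightarrow> 'a \<Rightarrow>\<^sub>L 'b) (g'' :: 'a \<Rightarrow> 'a \<Rightarrow>\<^sub>L 'a \<Rightarrow>\<^sub>L 'b).
        open W \<and> z \<in> W \<and>
        (\<forall>w\<in>W. (g has_derivative blinfun_apply (g' w)) (at w)) \<and>
        (\<forall>w\<in>W. (g' has_derivative blinfun_apply (g'' w)) (at w)) \<and>
        continuous_on W g'')"

text \<open>Unspecified where \<open>\<lambda>y. g (y, p)\<close> is not differentiable at \<open>x\<close>.\<close>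

definition grad_x :: "('a::real_inner \<times> 'b \<Rightarrow> real) \<Rightarrow> 'a \<times> 'b \<Rightarrow> 'a" where
  "grad_x g = (\<lambda>(x, p). THE D. GDERIV (\<lambda>y. g (y, p)) x :> D)"

definition jacobian_x :: "((real^'n) \<times> 'b \<Rightarrow> real^'k) \<Rightarrow> (real^'n) \<times> 'b \<Rightarrow> real^'n^'k" where
  "jacobian_x g = (\<lambda>(x, p). jacobian (\<lambda>y. g (y, p)) (at x))"

definition feasible_set :: "('m \<Rightarrow> 'a \<times> 'b \<Rightarrow> real) \<Rightarrow> 'b \<Rightarrow> 'a set" where
  "feasible_set \<phi> p = {x. \<forall>i. \<phi> i (x, p) \<le> 0}"

definition solution_map ::
  "('a::euclidean_space \<times> 'b \<Rightarrow> 'a) \<Rightarrow> ('m \<Rightarrow> 'a \<times> 'b \<Rightarrow> real) \<Rightarrow> 'a \<Rightarrow> 'b \<Rightarrow> 'a set" where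
  "solution_map f \<phi> v p =
     {x. v \<in> (\<lambda>w. f (x, p) + w) ` limiting_normal_cone (feasible_set \<phi> p) x}"

definition active_set :: "('m \<Rightarrow> 'a \<times> 'b \<Rightarrow> real) \<Rightarrow> 'a \<times> 'b \<Rightarrow> 'm set" where
  "active_set \<phi> z = {i. \<phi> i z = 0}"

definition Lagr ::
  "('a::real_inner \<times> 'b \<Rightarrow> 'a) \<Rightarrow> ('m::finite \<Rightarrow> 'a \<times> 'b \<Rightarrow> real) \<Rightarrow> real^'m \<Rightarrow> 'a \<times> 'b \<Rightarrow> 'a" where
  "Lagr f \<phi> \<mu> z = f z + (\<Sum>i\<in>UNIV. (\<mu> $ i) *\<^sub>R grad_x (\<phi> i) z)"

definition multipliers ::
  "('a::real_inner \<times> 'b \<Rightarrow> 'a) \<Rightarrow> ('m::finite \<Rightarrow> 'a \<times> 'b \<Rightarrow> real) \<Rightarrow> 'a \<times> 'b \<Rightarrow> 'a \<Rightarrow> (real^'m) set" where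
  "multipliers f \<phi> z v =
     {\<mu>. (\<forall>i. \<mu> $ i \<ge> 0) \<and> v = Lagr f \<phi> \<mu> z \<and> \<mu> \<bullet> (\<chi> i. \<phi> i z) = 0}"

definition strongly_active_set ::
  "('m::finite \<Rightarrow> 'a \<times> 'b \<Rightarrow> real) \<Rightarrow> 'a \<times> 'b \<Rightarrow> real^'m \<Rightarrow> 'm set" where
  "strongly_active_set \<phi> z \<mu> = {i \<in> active_set \<phi> z. \<mu> $ i > 0}"

definition partial_MFCQ :: "('m \<Rightarrow> 'a::real_inner \<times> 'b \<Rightarrow> real) \<Rightarrow> 'a \<times> 'b \<Rightarrow> bool" where
  "partial_MFCQ \<phi> z \<longleftrightarrow> (\<exists>d. \<forall>i\<in>active_set \<phi> z. grad_x (\<phi> i) z \<bullet> d < 0)"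

text \<open>The rank of a family is the dimension of the span of its range.\<close>

definition partial_CRCQ ::
  "('m \<Rightarrow> 'a::euclidean_space \<times> 'b::topological_space \<Rightarrow> real) \<Rightarrow> 'a \<times> 'b \<Rightarrow> bool" where
  "partial_CRCQ \<phi> z \<longleftrightarrow>
     (\<exists>W. z \<in> interior W \<and>
        (\<forall>J \<subseteq> active_set \<phi> z. \<forall>w\<in>W. \<forall>w'\<in>W.
           dim ((\<lambda>i. grad_x (\<phi> i) w) ` J) = dim ((\<lambda>i. grad_x (\<phi> i) w') ` J)))"

text \<open>Injectivity is needed since independence of an indexed family excludes repeated members.\<close>

definition partial_LICQ :: "('m \<Rightarrow> 'a::real_inner \<times> 'b \<Rightarrow> real) \<Rightarrow> 'a \<times> 'b \<Rightarrow> bool" where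
  "partial_LICQ \<phi> z \<longleftrightarrow>
     inj_on (\<lambda>i. grad_x (\<phi> i) z) (active_set \<phi> z) \<and>
     independent ((\<lambda>i. grad_x (\<phi> i) z) ` active_set \<phi> z)"

definition GSSOSC ::
  "((real^'n) \<times> 'b \<Rightarrow> real^'n) \<Rightarrow> ('m::finite \<Rightarrow> (real^'n) \<times> 'b \<Rightarrow> real) \<Rightarrow>
     (real^'n) \<times> 'b \<Rightarrow> real^'n \<Rightarrow> bool" where
  "GSSOSC f \<phi> z v \<longleftrightarrow>
     (\<forall>\<mu>\<in>multipliers f \<phi> z v. \<forall>u.
        u \<noteq> 0 \<and> (\<forall>i\<in>strongly_active_set \<phi> z \<mu>. grad_x (\<phi> i) z \<bullet> u = 0) \<longrightarrow>
        u \<bullet> (jacobian_x (Lagr f \<phi> \<mu>) z *v u) > 0)"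

definition lipschitzian_fully_stable ::
  "('a::euclidean_space \<times> 'b::euclidean_space \<Rightarrow> 'a) \<Rightarrow> ('m \<Rightarrow> 'a \<times> 'b \<Rightarrow> real) \<Rightarrow>
     'a \<Rightarrow> 'a \<Rightarrow> 'b \<Rightarrow> bool" where
  "lipschitzian_fully_stable f \<phi> xb vb pb \<longleftrightarrow>
     xb \<in> solution_map f \<phi> vb pb \<and>
     (\<exists>V Q U \<kappa> l \<theta>.
        vb \<in> interior V \<and> pb \<in> interior Q \<and> xb \<in> interior U \<and> \<kappa> > 0 \<and> l > 0 \<and>
        \<theta> \<in> V \<times> Q \<rightarrow> U \<and>
        {(v, p, x). v \<in> V \<and> p \<in> Q \<and> x = \<theta> (v, p)} =
          {(v, p, x). x \<in> solution_map f \<phi> v p} \<inter> (V \<times> Q \<times> U) \<and>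
        (\<forall>v1\<in>V. \<forall>v2\<in>V. \<forall>p1\<in>Q. \<forall>p2\<in>Q.
           norm ((v1 - v2) - (2 * \<kappa>) *\<^sub>R (\<theta> (v1, p1) - \<theta> (v2, p2)))
             \<le> norm (v1 - v2) + l * norm (p1 - p2)))"

end

theory Submission
  imports Defs
begin

text \<open>Full stability with the estimate of the definition amounts to three local facts: solutions near
\<open>xb\<close> exist for all \<open>(v, p)\<close> near \<open>(vb, pb)\<close>; for fixed \<open>p\<close> the solution depends on \<open>v\<close> so that
\<open>\<kappa> |x1 - x2|\<^sup>2 \<le> \<langle>v1 - v2, x1 - x2\<rangle>\<close> (equivalent to
\<open>|(v1 - v2) - 2\<kappa> (x1 - x2)| \<le> |v1 - v2|\<close>); and it is Lipschitz in \<open>p\<close>. Once this strong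
monotonicity is known, uniqueness is immediate and the Lipschitz term for \<open>p\<close> is just added by the
triangle inequality.

Under the partial MFCQ, normals to \<open>C(p)\<close> near the base point are the combinations of active
gradients with nonnegative multipliers (\<open>limiting_normal_cone_iff\<close>), and the multipliers stay
bounded, so that limits of multipliers may be taken.

Strong monotonicity (\<open>strong_monotonicity\<close>) is proved by contradiction. A sequence of pairs of
solutions violating it yields two limiting multipliers \<open>\<mu>\<close> and \<open>\<nu>\<close>, possibly different, and a
limiting direction \<open>u\<close>. The second-order expansion of both constraint terms is governed by
the mean \<open>(\<mu> + \<nu>)/2\<close>, which is again a multiplier because these form a convex set, and
feasibility of each point for the constraints active at the other forces \<open>u\<close> to be orthogonal to all
gradients in the support of the mean. This contradicts the second-order condition at the mean.
Only the signs of those constraints that carry a positive multiplier enter.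

Existence (\<open>local_solvability\<close>) comes from nearest points. For large \<open>\<rho>\<close> the inclusion
\<open>b \<in> \<rho> x + N(x)\<close> is solved by the point of \<open>C(p)\<close> nearest to \<open>b / \<rho>\<close>, and its solution map has a
Lipschitz constant of order \<open>1/\<rho>\<close>. Adding \<open>f\<close> is then a small Lipschitz perturbation. The
resulting problem \<open>b \<in> f(x) + \<rho> x + N(x)\<close> is strongly monotone with modulus \<open>\<kappa> + \<rho>\<close>, so
subtracting \<open>\<rho> x\<close> is a perturbation with contraction factor \<open>\<rho>/(\<kappa> + \<rho>) < 1\<close>. Both steps are
instances of \<open>solvability_under_lipschitz_perturbation\<close>.

For the dependence on \<open>p\<close> (\<open>lipschitz_along_common_family\<close>), let two solutions for the same \<open>v\<close>
and different parameters have multipliers supported in a common family \<open>J\<close> with independent gradients.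
Moving the first point onto the manifold \<open>\<phi>\<^sub>J(\<cdot>, q) = 0\<close> costs \<open>O(|p - q|)\<close>; the moved point may be
infeasible for other constraints, but it can still be compared with the second solution, by the
sign remark above. On a segment of parameters the solutions using a given \<open>J\<close> form a closed piece. By
Caratheodory's theorem and the partial CRCQ finitely many pieces cover the segment, and a
function that is Lipschitz on each of finitely many closed pieces of an interval is Lipschitz.

Conversely (\<open>fully_stable_imp_second_order\<close>), under the partial LICQ every critical direction \<open>u\<close> is the
difference of the tangents of two feasible arcs on which the strongly active constraints stay active, so
both arcs solve the variational condition with the unchanged multiplier. Strong monotonicity along them
is, to second order, the inequality that the second-order condition asks for.\<close>

section \<open>Regular normals\<close>

lemma regular_normal_cone_iff:
  "\<zeta> \<in> regular_normal_cone \<Omega> z \<longleftrightarrow>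
     (\<forall>e>0. \<forall>\<^sub>F w in at z within \<Omega>. \<zeta> \<bullet> (w - z) \<le> e * norm (w - z))"
proof -
  have *: "\<zeta> \<in> regular_normal_cone \<Omega> z \<longleftrightarrow>
     (\<forall>y>0. \<forall>\<^sub>F w in at z within \<Omega>. ereal (\<zeta> \<bullet> (w - z) / norm (w - z)) < y)"
    by (simp add: regular_normal_cone_def Limsup_le_iff)
  show ?thesis
  proof
    assume L: "\<zeta> \<in> regular_normal_cone \<Omega> z"
    show "\<forall>e>0. \<forall>\<^sub>F w in at z within \<Omega>. \<zeta> \<bullet> (w - z) \<le> e * norm (w - z)"
    proof (intro allI impI)
      fix e :: real assume "e > 0"
      then have "\<forall>\<^sub>F w in at z within \<Omega>. ereal (\<zeta> \<bullet> (w - z) / norm (w - z)) < ereal e"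
        using L[unfolded *, rule_format, of "ereal e"] by simp
      moreover have "\<forall>\<^sub>F w in at z within \<Omega>. w \<noteq> z"
        by (simp add: eventually_at_filter)
      ultimately show "\<forall>\<^sub>F w in at z within \<Omega>. \<zeta> \<bullet> (w - z) \<le> e * norm (w - z)"
        by eventually_elim (simp add: divide_less_eq split: if_splits)
    qed
  next
    assume R: "\<forall>e>0. \<forall>\<^sub>F w in at z within \<Omega>. \<zeta> \<bullet> (w - z) \<le> e * norm (w - z)"
    show "\<zeta> \<in> regular_normal_cone \<Omega> z"
      unfolding *
    proof (intro allI impI)
      fix y :: ereal assume "y > 0"
      then obtain e where e: "0 < ereal e" "ereal e < y" using ereal_dense2 by blast
      then have "\<forall>\<^sub>F w in at z within \<Omega>. \<zeta> \<bullet> (w - z) \<le> e * norm (w - z)" using R by simp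
      moreover have "\<forall>\<^sub>F w in at z within \<Omega>. w \<noteq> z"
        by (simp add: eventually_at_filter)
      ultimately show "\<forall>\<^sub>F w in at z within \<Omega>. ereal (\<zeta> \<bullet> (w - z) / norm (w - z)) < y"
      proof eventually_elim
        case (elim w)
        then have "\<zeta> \<bullet> (w - z) / norm (w - z) \<le> e" by (simp add: divide_le_eq)
        then show ?case using e(2) by (meson ereal_less_eq(3) le_less_trans)
      qed
    qed
  qed
qed

section \<open>Linearly independent families\<close>

text \<open>Injectivity makes this independence of the indexed family: a repeated gradient counts as a dependence.\<close>

definition family_independent :: "('i \<Rightarrow> 'a::real_vector) \<Rightarrow> 'i set \<Rightarrow> bool" where
  "family_independent g J \<longleftrightarrow> inj_on g J \<and> independent (g ` J)"

lemma family_independent_iff_combination: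
  fixes g :: "'i::finite \<Rightarrow> 'a::real_vector"
  shows "family_independent g J \<longleftrightarrow> (\<forall>c. (\<Sum>i\<in>J. c i *\<^sub>R g i) = 0 \<longrightarrow> (\<forall>i\<in>J. c i = 0))"
proof
  assume L: "family_independent g J"
  show "\<forall>c. (\<Sum>i\<in>J. c i *\<^sub>R g i) = 0 \<longrightarrow> (\<forall>i\<in>J. c i = 0)"
  proof (intro allI impI ballI)
    fix c i assume c: "(\<Sum>i\<in>J. c i *\<^sub>R g i) = 0" and i: "i \<in> J"
    have inj: "inj_on g J" and ind: "independent (g ` J)"
      using L by (auto simp: family_independent_def)
    have "(\<Sum>v\<in>g ` J. c (inv_into J g v) *\<^sub>R v) = (\<Sum>i\<in>J. c i *\<^sub>R g i)"
      using inj by (simp add: sum.reindex)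
    then have "(\<Sum>v\<in>g ` J. c (inv_into J g v) *\<^sub>R v) = 0" using c by simp
    then have "c (inv_into J g (g i)) = 0"
      using independentD[OF ind, of "g ` J" "\<lambda>v. c (inv_into J g v)" "g i"] i by auto
    then show "c i = 0" using inj i by simp
  qed
next
  assume R: "\<forall>c. (\<Sum>i\<in>J. c i *\<^sub>R g i) = 0 \<longrightarrow> (\<forall>i\<in>J. c i = 0)"
  have inj: "inj_on g J"
  proof (rule inj_onI, rule ccontr)
    fix i j assume ij: "i \<in> J" "j \<in> J" "g i = g j" "i \<noteq> j"
    define c :: "'i \<Rightarrow> real" where "c = (\<lambda>k. if k = i then 1 else if k = j then -1 else 0)"
    have "(\<Sum>k\<in>J. c k *\<^sub>R g k) = (\<Sum>k\<in>{i,j}. c k *\<^sub>R g k)"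
      by (rule sum.mono_neutral_right) (use ij in \<open>auto simp: c_def\<close>)
    also have "\<dots> = 0" using ij by (simp add: c_def)
    finally have "c i = 0" using R ij by blast
    then show False by (simp add: c_def)
  qed
  moreover have "independent (g ` J)"
  proof (rule independent_if_scalars_zero)
    show "finite (g ` J)" by simp
    fix f x assume f: "(\<Sum>x\<in>g ` J. f x *\<^sub>R x) = 0" and x: "x \<in> g ` J"
    then have "(\<Sum>i\<in>J. f (g i) *\<^sub>R g i) = 0" using inj by (simp add: sum.reindex)
    then have "\<forall>i\<in>J. f (g i) = 0" using R[rule_format, of "\<lambda>i. f (g i)"] by blast
    then show "f x = 0" using x by blast
  qed
  ultimately show "family_independent g J" by (simp add: family_independent_def)
qed

text \<open>Extend \<open>g i \<mapsto> axis i 1\<close> to a linear map; its adjoint sends the unit vectors to a dual system.\<close>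

lemma family_independent_dual:
  fixes g :: "'i::finite \<Rightarrow> 'a::euclidean_space"
  assumes "family_independent g J"
  obtains e where "\<And>i j. i \<in> J \<Longrightarrow> j \<in> J \<Longrightarrow> g i \<bullet> e j = (if i = j then 1 else 0)"
proof -
  have inj: "inj_on g J" and ind: "independent (g ` J)"
    using assms by (auto simp: family_independent_def)
  obtain h :: "'a \<Rightarrow> real^'i" where h: "linear h" "\<forall>x\<in>g ` J. h x = axis (inv_into J g x) 1"
    using linear_independent_extend[OF ind, of "\<lambda>x. axis (inv_into J g x) (1::real)"] by auto
  show thesis
  proof (rule that[of "\<lambda>j. adjoint h (axis j 1)"])
    fix i j assume "i \<in> J" "j \<in> J"
    then have "h (g i) = axis i 1" using h(2) inj by simp
    then show "g i \<bullet> adjoint h (axis j 1) = (if i = j then 1 else 0)"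
      using adjoint_works[OF h(1), of "g i" "axis j 1"] by (simp add: inner_axis_axis)
  qed
qed

lemma family_independent_mono:
  "family_independent g J \<Longrightarrow> J' \<subseteq> J \<Longrightarrow> family_independent g J'"
  unfolding family_independent_def
  by (meson image_mono independent_mono inj_on_subset)

text \<open>For an independent family the rank equals the number of indices, the largest rank that a family over
\<open>J\<close> can have; a family of that rank is again independent. This is how constant rank transports
independence from a nearby point to the base point.\<close>

lemma family_independent_if_same_rank:
  fixes g g' :: "'i::finite \<Rightarrow> 'a::euclidean_space"
  assumes "family_independent g J" and "dim (g ` J) = dim (g' ` J)"
  shows "family_independent g' J"
proof -
  have "card (g' ` J) \<le> card J" by (simp add: card_image_le)
  moreover have "dim (g ` J) = card J"
    using assms(1) by (simp add: family_independent_def dim_eq_card_independent card_image)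
  moreover have "dim (g' ` J) \<le> card (g' ` J)" by (simp add: dim_le_card')
  ultimately have "card (g' ` J) = card J" "dim (g' ` J) = card (g' ` J)" using assms(2) by auto
  then show ?thesis
    unfolding family_independent_def
    using eq_card_imp_inj_on[of J g'] card_le_dim_spanning[of "g' ` J" "span (g' ` J)"] by (simp add: span_superset)
qed

text \<open>Among all representations with support inside that of \<open>a\<close>, one of smallest support has an independent
family, since a linear relation could be subtracted until another coefficient vanishes.\<close>

lemma conic_caratheodory:
  fixes g :: "'m::finite \<Rightarrow> 'a::real_vector"
  assumes "\<And>i. 0 \<le> a $ i"
  obtains b :: "real^'m" where "\<And>i. 0 \<le> b $ i" "\<And>i. a $ i = 0 \<Longrightarrow> b $ i = 0"
    "(\<Sum>i\<in>UNIV. (b $ i) *\<^sub>R g i) = (\<Sum>i\<in>UNIV. (a $ i) *\<^sub>R g i)"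
    "family_independent g {i. b $ i \<noteq> 0}"
proof -
  define P where "P b \<longleftrightarrow> (\<forall>i. 0 \<le> b $ i) \<and> (\<forall>i. a $ i = 0 \<longrightarrow> b $ i = 0) \<and>
     (\<Sum>i\<in>UNIV. (b $ i) *\<^sub>R g i) = (\<Sum>i\<in>UNIV. (a $ i) *\<^sub>R g i)" for b :: "real^'m"
  have "P a" using assms by (simp add: P_def)
  then obtain b where b: "P b"
    and min: "\<And>b'. P b' \<Longrightarrow> card {i. b $ i \<noteq> 0} \<le> card {i. b' $ i \<noteq> 0}"
    using ex_has_least_nat[of P a "\<lambda>b. card {i. b $ i \<noteq> 0}"] by auto
  have "family_independent g {i. b $ i \<noteq> 0}"
  proof (rule ccontr)
    let ?J = "{i. b $ i \<noteq> 0}"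
    assume "\<not> ?thesis"
    then obtain c0 i0 where c0: "(\<Sum>i\<in>?J. c0 i *\<^sub>R g i) = 0" "i0 \<in> ?J" "c0 i0 \<noteq> 0"
      unfolding family_independent_iff_combination by blast
    \<comment> \<open>Orient the relation so that some coefficient is positive.\<close>
    define c where "c i = (if i \<in> ?J then sgn (c0 i0) * c0 i else 0)" for i
    have c_sum: "(\<Sum>i\<in>UNIV. c i *\<^sub>R g i) = 0"
    proof -
      have "(\<Sum>i\<in>UNIV. c i *\<^sub>R g i) = (\<Sum>i\<in>?J. c i *\<^sub>R g i)"
        by (rule sum.mono_neutral_right) (auto simp: c_def)
      also have "\<dots> = (\<Sum>i\<in>?J. sgn (c0 i0) *\<^sub>R (c0 i *\<^sub>R g i))"
        by (rule sum.cong) (auto simp: c_def)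
      also have "\<dots> = 0" using c0(1) by (simp flip: scaleR_scaleR scaleR_right.sum)
      finally show ?thesis .
    qed
    have c_pos: "0 < c i0" using c0 by (auto simp: c_def sgn_if)
    define T where "T = {i. 0 < c i}"
    have T: "finite T" "T \<noteq> {}" using c_pos by (auto simp: T_def)
    \<comment> \<open>The largest multiple of the relation that can be subtracted with all coefficients nonnegative.\<close>
    define t where "t = Min ((\<lambda>i. b $ i / c i) ` T)"
    have "t \<in> (\<lambda>i. b $ i / c i) ` T" unfolding t_def using T by (intro Min_in) auto
    then obtain k where k: "k \<in> T" "t = b $ k / c k" by auto
    have t_le: "t \<le> b $ i / c i" if "i \<in> T" for i
      unfolding t_def using T that by simp
    have bpos: "0 \<le> b $ i" for i using b by (simp add: P_def)
    have t0: "0 \<le> t" using k bpos by (simp add: T_def)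
    define b' where "b' = (\<chi> i. b $ i - t * c i)"
    have b'nn: "0 \<le> b' $ i" for i
    proof (cases "0 < c i")
      case True
      then have "t \<le> b $ i / c i" using t_le by (simp add: T_def)
      then show ?thesis using True by (simp add: b'_def pos_le_divide_eq)
    next
      case False
      then have "t * c i \<le> 0" using t0 by (simp add: mult_nonneg_nonpos)
      then show ?thesis using bpos[of i] by (simp add: b'_def)
    qed
    have b'0: "b' $ i = 0" if "b $ i = 0" for i using that by (simp add: b'_def c_def)
    have "(\<Sum>i\<in>UNIV. (b' $ i) *\<^sub>R g i) =
        (\<Sum>i\<in>UNIV. (b $ i) *\<^sub>R g i) - t *\<^sub>R (\<Sum>i\<in>UNIV. c i *\<^sub>R g i)"
      by (simp add: b'_def scaleR_left_diff_distrib sum_subtractf scaleR_right.sum)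
    then have "P b'" using b b'nn b'0 c_sum by (simp add: P_def)
    moreover have "{i. b' $ i \<noteq> 0} \<subset> ?J"
    proof -
      have "c k \<noteq> 0" using k by (simp add: T_def)
      then have "b $ k \<noteq> 0" by (auto simp: c_def)
      moreover have "b' $ k = 0" using k by (simp add: b'_def T_def)
      ultimately show ?thesis using b'0 by blast
    qed
    then have "card {i. b' $ i \<noteq> 0} < card ?J" by (intro psubset_card_mono) auto
    ultimately show False using min by fastforce
  qed
  then show thesis using that b unfolding P_def by blast
qed

section \<open>Monotonicity, limits and perturbation\<close>

text \<open>The norm inequality in the definition of full stability, for equal parameters, is strong monotonicity.\<close>

lemma norm_diff_scaleR_le_iff:
  fixes w h :: "'a::real_inner"
  assumes "0 < \<kappa>"
  shows "norm (w - (2 * \<kappa>) *\<^sub>R h) \<le> norm w \<longleftrightarrow> \<kappa> * (norm h)\<^sup>2 \<le> w \<bullet> h"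
proof -
  have "(norm (w - (2 * \<kappa>) *\<^sub>R h))\<^sup>2 = (norm w)\<^sup>2 + 4 * \<kappa> * (\<kappa> * (norm h)\<^sup>2 - w \<bullet> h)"
    unfolding power2_norm_eq_inner
    by (simp add: inner_diff_left inner_diff_right inner_commute algebra_simps power2_eq_square)
  moreover have "norm (w - (2 * \<kappa>) *\<^sub>R h) \<le> norm w \<longleftrightarrow> (norm (w - (2 * \<kappa>) *\<^sub>R h))\<^sup>2 \<le> (norm w)\<^sup>2"
    by (simp add: abs_le_square_iff[symmetric])
  ultimately show ?thesis using assms by (simp add: mult_le_0_iff)
qed

lemma norm_le_if_inner_le:
  fixes w h :: "'a::real_inner"
  assumes "0 < \<kappa>" "\<kappa> * (norm h)\<^sup>2 \<le> w \<bullet> h"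
  shows "norm h \<le> norm w / \<kappa>"
proof (cases "h = 0")
  case False
  have "norm h * (\<kappa> * norm h) \<le> norm h * norm w"
    using assms(2) Cauchy_Schwarz_ineq2[of w h] by (simp add: power2_eq_square mult_ac)
  then have "\<kappa> * norm h \<le> norm w" using False by simp
  then show ?thesis using assms by (simp add: field_simps)
qed (use assms in simp)

lemma eventually_at_right_witness:
  fixes a :: real
  assumes "eventually P (at_right a)"
  obtains \<delta> where "a < \<delta>" "P \<delta>"
proof -
  have "\<exists>\<delta>. P \<delta> \<and> a < \<delta>"
    using assms eventually_at_right_less by (intro eventually_happens'[OF trivial_limit_at_right_real] eventually_conj)
  then show thesis using that by blast
qed

text \<open>Estimates valid on all sufficiently small balls hold along any families of points that converge to the centres.\<close>

lemma eventually_along_balls: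
  assumes ev: "\<forall>\<^sub>F \<delta> in at_right (0::real). \<forall>x\<in>ball a \<delta>. \<forall>y\<in>ball a \<delta>. \<forall>p\<in>ball b \<delta>. R x y p"
    and lim: "(X \<longlongrightarrow> a) F" "(Y \<longlongrightarrow> a) F" "(P \<longlongrightarrow> b) F"
  shows "\<forall>\<^sub>F k in F. R (X k) (Y k) (P k)"
proof -
  obtain \<delta> where \<delta>: "0 < \<delta>" "\<forall>x\<in>ball a \<delta>. \<forall>y\<in>ball a \<delta>. \<forall>p\<in>ball b \<delta>. R x y p"
    using ev by (rule eventually_at_right_witness)
  have "\<forall>\<^sub>F k in F. X k \<in> ball a \<delta>" "\<forall>\<^sub>F k in F. Y k \<in> ball a \<delta>" "\<forall>\<^sub>F k in F. P k \<in> ball b \<delta>"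
    using \<delta>(1) by (intro topological_tendstoD[OF lim(1)] topological_tendstoD[OF lim(2)]
        topological_tendstoD[OF lim(3)] open_ball, simp)+
  then show ?thesis by eventually_elim (use \<delta>(2) in blast)
qed

definition locally_solvable ::
  "('b::metric_space \<Rightarrow> 'a::real_normed_vector \<Rightarrow> 'a \<Rightarrow> bool) \<Rightarrow> 'b \<Rightarrow> 'a \<Rightarrow> 'a \<Rightarrow> bool" where
  "locally_solvable S pb b0 xb \<longleftrightarrow>
     (\<forall>\<epsilon>>0. \<exists>\<delta>>0. \<forall>p\<in>ball pb \<delta>. \<forall>b\<in>ball b0 \<delta>. \<exists>x\<in>ball xb \<epsilon>. S p x b)"

text \<open>Single-valuedness is included: equal data \<open>b1 = b2\<close> force \<open>x1 = x2\<close>.\<close>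

definition solutions_lipschitz ::
  "real \<Rightarrow> ('b::metric_space \<Rightarrow> 'a::real_normed_vector \<Rightarrow> 'a \<Rightarrow> bool) \<Rightarrow> 'b \<Rightarrow> 'a \<Rightarrow> 'a \<Rightarrow> bool" where
  "solutions_lipschitz c S pb b0 xb \<longleftrightarrow>
     (\<exists>\<epsilon>>0. \<forall>p\<in>ball pb \<epsilon>. \<forall>x1\<in>ball xb \<epsilon>. \<forall>x2\<in>ball xb \<epsilon>. \<forall>b1\<in>ball b0 \<epsilon>. \<forall>b2\<in>ball b0 \<epsilon>.
       S p x1 b1 \<longrightarrow> S p x2 b2 \<longrightarrow> norm (x1 - x2) \<le> c * norm (b1 - b2))"

text \<open>A solution for the data \<open>v - h p x\<close> is a fixed point of \<open>x \<mapsto> R\<^sub>p (v - h p x)\<close>, where \<open>R\<^sub>p\<close> is the local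
solution map of the unperturbed problem; the composition has Lipschitz constant \<open>c * L < 1\<close>, so
Banach's theorem applies on a small ball around \<open>xb\<close>.\<close>

lemma solvability_under_lipschitz_perturbation:
  fixes S :: "'b::metric_space \<Rightarrow> 'a::euclidean_space \<Rightarrow> 'a \<Rightarrow> bool"
  assumes solv: "locally_solvable S pb b0 xb"
    and lip: "solutions_lipschitz c S pb b0 xb"
    and g_lip: "\<exists>\<epsilon>>0. \<forall>p\<in>ball pb \<epsilon>. \<forall>x1\<in>ball xb \<epsilon>. \<forall>x2\<in>ball xb \<epsilon>.
       norm (h p x1 - h p x2) \<le> L * norm (x1 - x2)"
    and g_cont: "isCont (\<lambda>p. h p xb) pb"
    and c: "0 < c" "0 < L" "c * L < 1"
    and v0: "v0 = b0 + h pb xb"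
  shows "locally_solvable (\<lambda>p x v. S p x (v - h p x)) pb v0 xb"
  unfolding locally_solvable_def
proof (intro allI impI)
  fix \<epsilon> :: real assume \<epsilon>: "0 < \<epsilon>"
  have solv: "\<exists>\<delta>>0. \<forall>p\<in>ball pb \<delta>. \<forall>b\<in>ball b0 \<delta>. \<exists>x\<in>ball xb \<epsilon>. S p x b" if "0 < \<epsilon>" for \<epsilon>
    using solv that by (simp add: locally_solvable_def)
  obtain e1 where e1: "e1 > 0" "\<And>p x1 x2 b1 b2. p\<in>ball pb e1 \<Longrightarrow> x1\<in>ball xb e1 \<Longrightarrow> x2\<in>ball xb e1 \<Longrightarrow>
      b1\<in>ball b0 e1 \<Longrightarrow> b2\<in>ball b0 e1 \<Longrightarrow> S p x1 b1 \<Longrightarrow> S p x2 b2 \<Longrightarrow> norm (x1 - x2) \<le> c * norm (b1 - b2)"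
    using lip unfolding solutions_lipschitz_def by metis
  obtain e2 where e2: "e2 > 0" "\<And>p x1 x2. p\<in>ball pb e2 \<Longrightarrow> x1\<in>ball xb e2 \<Longrightarrow> x2\<in>ball xb e2 \<Longrightarrow>
       norm (h p x1 - h p x2) \<le> L * norm (x1 - x2)"
    using g_lip by metis
  obtain d1 where d1: "d1 > 0" "\<And>p b. p\<in>ball pb d1 \<Longrightarrow> b\<in>ball b0 d1 \<Longrightarrow> \<exists>x\<in>ball xb e1. S p x b"
    using solv[OF e1(1)] by metis
  define r where "r = min (min (\<epsilon>/2) (e1/2)) (min (e2/2) (min d1 e1 / (3 * L)))"
  have r: "0 < r" "r < \<epsilon>" "r < e1" "r < e2" "L * r \<le> min d1 e1 / 3"
  proof -
    show "0 < r" "r < \<epsilon>" "r < e1" "r < e2" using \<epsilon> e1 e2 d1 c by (auto simp: r_def)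
    have "r \<le> min d1 e1 / (3 * L)" by (simp add: r_def)
    then show "L * r \<le> min d1 e1 / 3" using c by (simp add: field_simps)
  qed
  \<comment> \<open>A contraction with factor \<open>c * L\<close> that moves the centre by less than \<open>s\<close> maps the ball of radius \<open>r\<close> into itself.\<close>
  define s where "s = (1 - c * L) * r"
  have s: "0 < s" using c r by (simp add: s_def)
  obtain d2 where d2: "d2 > 0" "\<And>p b. p\<in>ball pb d2 \<Longrightarrow> b\<in>ball b0 d2 \<Longrightarrow> \<exists>x\<in>ball xb (min s e1). S p x b"
    using solv[of "min s e1"] s e1(1) by (metis min_less_iff_conj)
  define m where "m = min d2 (min d1 e1)"
  have m: "m > 0" using d1 d2 e1 by (simp add: m_def)
  obtain d3 where d3: "d3 > 0" "\<And>p. p \<in> ball pb d3 \<Longrightarrow> norm (h p xb - h pb xb) < m / 3"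
  proof -
    have "m / 3 > 0" using m by simp
    then obtain d where "d > 0" "\<forall>p. dist p pb < d \<longrightarrow> dist (h p xb) (h pb xb) < m/3"
      using g_cont unfolding continuous_at_eps_delta by meson
    then show thesis using that[of d] by (auto simp: dist_norm dist_commute)
  qed
  define \<delta> where "\<delta> = min (min d3 (m / 3)) (min e2 m)"
  have \<delta>: "\<delta> > 0" using d3 m e2 by (simp add: \<delta>_def)
  show "\<exists>\<delta>>0. \<forall>p\<in>ball pb \<delta>. \<forall>v\<in>ball v0 \<delta>. \<exists>x\<in>ball xb \<epsilon>. S p x (v - h p x)"
  proof (intro exI conjI ballI)
    show "\<delta> > 0" by fact
    fix p v assume p: "p \<in> ball pb \<delta>" and v: "v \<in> ball v0 \<delta>"
    have pin: "p \<in> ball pb d1" "p \<in> ball pb d2" "p \<in> ball pb d3" "p \<in> ball pb e1" "p \<in> ball pb e2"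
      using p by (auto simp: \<delta>_def m_def)
    have near0: "norm (v - h p xb - b0) < 2 * m / 3"
    proof -
      have eq: "v - h p xb - b0 = (v - v0) - (h p xb - h pb xb)" by (simp add: v0)
      have "norm (v - h p xb - b0) \<le> norm (v - v0) + norm (h p xb - h pb xb)"
        unfolding eq by (rule norm_triangle_ineq4)
      moreover have "norm (v - v0) < m / 3" using v by (simp add: \<delta>_def dist_norm norm_minus_commute)
      ultimately show ?thesis using d3(2)[OF pin(3)] by linarith
    qed
    have near: "v - h p x \<in> ball b0 (min d1 e1)" if x: "x \<in> cball xb r" for x
    proof -
      have "x \<in> ball xb e2" "xb \<in> ball xb e2" using x r e2 by auto
      then have "norm (h p x - h p xb) \<le> L * norm (x - xb)" using e2(2) pin by blast
      also have "\<dots> \<le> L * r" using x c by (simp add: dist_norm norm_minus_commute)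
      finally have "norm (h p x - h p xb) \<le> min d1 e1 / 3" using r by simp
      moreover have "norm (v - h p x - b0) \<le> norm (v - h p xb - b0) + norm (h p x - h p xb)"
        using norm_triangle_ineq4[of "v - h p xb - b0" "h p x - h p xb"] by (simp add: algebra_simps)
      ultimately have "norm (v - h p x - b0) < 2 * m / 3 + min d1 e1 / 3"
        using near0 by linarith
      also have "\<dots> \<le> min d1 e1" using min.cobounded2[of d2 "min d1 e1"] unfolding m_def by argo
      finally show ?thesis by (simp add: dist_norm norm_minus_commute)
    qed
    define F where "F x = (SOME y. y \<in> ball xb e1 \<and> S p y (v - h p x))" for x
    have F: "F x \<in> ball xb e1 \<and> S p (F x) (v - h p x)" if "x \<in> cball xb r" for x
    proof -
      have "\<exists>y\<in>ball xb e1. S p y (v - h p x)" using d1(2)[of p] near[OF that] pin by auto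
      then show ?thesis unfolding F_def by (metis (mono_tags, lifting) someI_ex)
    qed
    have F_lip: "norm (F x - F y) \<le> c * L * norm (x - y)" if "x \<in> cball xb r" "y \<in> cball xb r" for x y
    proof -
      have "norm (F x - F y) \<le> c * norm ((v - h p x) - (v - h p y))"
        using e1(2)[of p "F x" "F y" "v - h p x" "v - h p y"] F near pin that by auto
      also have "(v - h p x) - (v - h p y) = h p y - h p x" by simp
      also have "norm (h p y - h p x) \<le> L * norm (y - x)" using e2(2) pin that r by auto
      finally show ?thesis using c by (simp add: norm_minus_commute)
    qed
    have xb_in: "xb \<in> cball xb r" using r by simp
    have F_xb: "norm (F xb - xb) < s"
    proof -
      have "v - h p xb \<in> ball b0 d2"
      proof -
        have "2 * m / 3 < d2" using m min.cobounded1[of d2 "min d1 e1"] unfolding m_def by argo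
        then show ?thesis using near0 by (simp add: dist_norm norm_minus_commute)
      qed
      then obtain y where y: "y \<in> ball xb (min s e1)" "S p y (v - h p xb)" using d2(2) pin by blast
      then have "norm (F xb - y) \<le> c * norm ((v - h p xb) - (v - h p xb))"
        using e1(2)[of p "F xb" y "v - h p xb" "v - h p xb"] F[OF xb_in] near[OF xb_in] pin by auto
      then have "F xb = y" by simp
      then show ?thesis using y by (simp add: dist_norm norm_minus_commute)
    qed
    have "\<exists>!x\<in>cball xb r. F x = x"
    proof (rule Banach_fix)
      show "complete (cball xb r)" "cball xb r \<noteq> {}" using xb_in by (auto simp: complete_eq_closed)
      show "0 \<le> c * L" "c * L < 1" using c by auto
      show "F ` cball xb r \<subseteq> cball xb r"
      proof
        fix y assume "y \<in> F ` cball xb r"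
        then obtain x where x: "x \<in> cball xb r" "y = F x" by auto
        have "norm (F x - xb) \<le> norm (F x - F xb) + norm (F xb - xb)"
          using norm_triangle_ineq[of "F x - F xb" "F xb - xb"] by simp
        also have "\<dots> \<le> c * L * r + s"
        proof -
          have "c * L * norm (x - xb) \<le> c * L * r"
            using x c by (intro mult_left_mono) (auto simp: dist_norm norm_minus_commute)
          then show ?thesis using F_lip[OF x(1) xb_in] F_xb by linarith
        qed
        also have "\<dots> = r" by (simp add: s_def algebra_simps)
        finally show "y \<in> cball xb r" using x by (simp add: dist_norm norm_minus_commute)
      qed
      show "dist (F x) (F y) \<le> c * L * dist x y" if "x \<in> cball xb r" "y \<in> cball xb r" for x y
        using F_lip that by (simp add: dist_norm)
    qed
    then obtain x where x: "x \<in> cball xb r" "F x = x" by blast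
    then have "S p x (v - h p x)" using F by metis
    then show "\<exists>x\<in>ball xb \<epsilon>. S p x (v - h p x)" using x r by auto
  qed
qed

section \<open>Strict differentiability\<close>

text \<open>Strict differentiability in the first variable at the base point, uniformly in the second one.\<close>

definition strict_partial_derivative ::
  "('a::real_normed_vector \<times> 'b::metric_space \<Rightarrow> 'c::real_normed_vector) \<Rightarrow> ('a \<Rightarrow> 'c) \<Rightarrow> 'a \<Rightarrow> 'b \<Rightarrow> bool" where
  "strict_partial_derivative F L xb pb \<longleftrightarrow>
     (\<forall>e>0. \<forall>\<^sub>F \<delta> in at_right 0. \<forall>x\<in>ball xb \<delta>. \<forall>x'\<in>ball xb \<delta>. \<forall>p\<in>ball pb \<delta>.
       norm (F (x, p) - F (x', p) - L (x - x')) \<le> e * norm (x - x'))"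

definition lipschitz_near ::
  "real \<Rightarrow> real \<Rightarrow> ('a::real_normed_vector \<times> 'b::real_normed_vector \<Rightarrow> 'c::real_normed_vector) \<Rightarrow> 'a \<Rightarrow> 'b \<Rightarrow> bool" where
  "lipschitz_near K r F xb pb \<longleftrightarrow> (\<forall>x\<in>ball xb r. \<forall>p\<in>ball pb r. \<forall>x'\<in>ball xb r. \<forall>p'\<in>ball pb r.
     norm (F (x, p) - F (x', p')) \<le> K * (norm (x - x') + norm (p - p')))"

lemma strict_partial_derivativeD:
  "strict_partial_derivative F L xb pb \<Longrightarrow> 0 < e \<Longrightarrow>
   \<forall>\<^sub>F \<delta> in at_right 0. \<forall>x\<in>ball xb \<delta>. \<forall>x'\<in>ball xb \<delta>. \<forall>p\<in>ball pb \<delta>.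
     norm (F (x, p) - F (x', p) - L (x - x')) \<le> e * norm (x - x')"
  by (simp add: strict_partial_derivative_def)

lemma strict_partial_derivative_imp_has_derivative:
  assumes "strict_partial_derivative F L xb pb" and L: "linear L"
  shows "((\<lambda>y. F (y, pb)) has_derivative L) (at (xb :: 'a::euclidean_space))"
  unfolding has_derivative_at_alt
proof (intro conjI allI impI)
  show "bounded_linear L" using L by (simp add: linear_conv_bounded_linear)
  fix e :: real assume "0 < e"
  from strict_partial_derivativeD[OF assms(1) this] obtain \<delta> where "0 < \<delta>"
    "\<forall>x\<in>ball xb \<delta>. \<forall>x'\<in>ball xb \<delta>. \<forall>p\<in>ball pb \<delta>. norm (F (x, p) - F (x', p) - L (x - x')) \<le> e * norm (x - x')"
    by (rule eventually_at_right_witness)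
  then show "\<exists>d>0. \<forall>y. norm (y - xb) < d \<longrightarrow> norm (F (y, pb) - F (xb, pb) - L (y - xb)) \<le> e * norm (y - xb)"
    by (intro exI[of _ \<delta>]) (auto simp: dist_norm norm_minus_commute)
qed

lemma lipschitz_nearD:
  "lipschitz_near K r F xb pb \<Longrightarrow> x \<in> ball xb r \<Longrightarrow> p \<in> ball pb r \<Longrightarrow> x' \<in> ball xb r \<Longrightarrow> p' \<in> ball pb r \<Longrightarrow>
   norm (F (x, p) - F (x', p')) \<le> K * (norm (x - x') + norm (p - p'))"
  by (simp add: lipschitz_near_def)

lemma lipschitz_near_mono:
  assumes "lipschitz_near K r F xb pb" "r' \<le> r" "K \<le> K'"
  shows "lipschitz_near K' r' F xb pb"
  unfolding lipschitz_near_def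
proof (intro ballI)
  fix x p x' p' assume "x \<in> ball xb r'" "p \<in> ball pb r'" "x' \<in> ball xb r'" "p' \<in> ball pb r'"
  then have "norm (F (x, p) - F (x', p')) \<le> K * (norm (x - x') + norm (p - p'))"
    using assms(2) by (intro lipschitz_nearD[OF assms(1)]) auto
  also have "\<dots> \<le> K' * (norm (x - x') + norm (p - p'))" using assms(3) by (intro mult_right_mono) auto
  finally show "norm (F (x, p) - F (x', p')) \<le> K' * (norm (x - x') + norm (p - p'))" .
qed

lemma tendsto_if_lipschitz_near:
  assumes lip: "lipschitz_near K r F xb pb"
    and X: "(X \<longlongrightarrow> x) net" and P: "(P \<longlongrightarrow> p) net" and xp: "x \<in> ball xb r" "p \<in> ball pb r"
  shows "((\<lambda>k. F (X k, P k)) \<longlongrightarrow> F (x, p)) net"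
proof (rule LIM_zero_cancel, rule Lim_null_comparison)
  have "\<forall>\<^sub>F k in net. X k \<in> ball xb r" "\<forall>\<^sub>F k in net. P k \<in> ball pb r"
    using xp by (intro topological_tendstoD[OF X] topological_tendstoD[OF P] open_ball, simp)+
  then show "\<forall>\<^sub>F k in net. norm (F (X k, P k) - F (x, p)) \<le> K * (norm (X k - x) + norm (P k - p))"
    by eventually_elim (rule lipschitz_nearD[OF lip _ _ xp])
  have "((\<lambda>k. K * (norm (X k - x) + norm (P k - p))) \<longlongrightarrow> K * (norm (x - x) + norm (p - p))) net"
    by (intro tendsto_intros X P)
  then show "((\<lambda>k. K * (norm (X k - x) + norm (P k - p))) \<longlongrightarrow> 0) net" by simp
qed

lemma GDERIV_unique: "GDERIV f x :> D \<Longrightarrow> GDERIV f x :> D' \<Longrightarrow> D = D'"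
  unfolding gderiv_def by (metis has_derivative_unique vector_eq_rdot inner_commute)

lemma grad_x_eq: "GDERIV (\<lambda>y. g (y, p)) x :> D \<Longrightarrow> grad_x g (x, p) = D"
  unfolding grad_x_def by (auto intro: GDERIV_unique)

text \<open>What the proofs use of a \<open>C\<^sup>2\<close> function: Lipschitz continuity of the function and of its partial gradient by
the mean value theorem on a compact ball, and strict differentiability of the partial gradient by continuity of
the second derivative.\<close>

lemma C2_smooth_around_gradient:
  fixes \<phi> :: "'a::euclidean_space \<times> 'b::euclidean_space \<Rightarrow> real"
  assumes "C2_smooth_around \<phi> (xb, pb)"
  obtains r K H where "0 < r" "0 < K" "linear H"
    "\<And>x p. x \<in> ball xb r \<Longrightarrow> p \<in> ball pb r \<Longrightarrow> GDERIV (\<lambda>y. \<phi> (y, p)) x :> grad_x \<phi> (x, p)"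
    "lipschitz_near K r \<phi> xb pb" "lipschitz_near K r (grad_x \<phi>) xb pb"
    "strict_partial_derivative (grad_x \<phi>) H xb pb"
proof -
  obtain W g' g'' where W: "open W" "(xb, pb) \<in> W"
    and g': "\<And>w. w\<in>W \<Longrightarrow> (\<phi> has_derivative blinfun_apply (g' w)) (at w)"
    and g'': "\<And>w. w\<in>W \<Longrightarrow> (g' has_derivative blinfun_apply (g'' w)) (at w)"
    and cont: "continuous_on W g''"
    using assms unfolding C2_smooth_around_def by metis
  obtain R where R: "R > 0" "cball (xb, pb) R \<subseteq> W"
    using W open_contains_cball by blast
  define C where "C = cball (xb, pb) R"
  have C: "convex C" "compact C" "C \<subseteq> W" "(xb, pb) \<in> C"
    using R by (auto simp: C_def)
  have "continuous_on W g'"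
    using g'' by (meson has_derivative_continuous continuous_at_imp_continuous_on)
  then have "bounded (g' ` C)" "bounded (g'' ` C)"
    using C cont by (auto intro!: compact_imp_bounded compact_continuous_image
        intro: continuous_on_subset)
  then obtain M1 M2 where M: "\<And>w. w \<in> C \<Longrightarrow> norm (g' w) \<le> M1" "\<And>w. w \<in> C \<Longrightarrow> norm (g'' w) \<le> M2"
    unfolding bounded_iff by blast
  have M_nn: "0 \<le> M1" "0 \<le> M2" using M C(4) norm_ge_zero order_trans by blast+
  have lip0: "norm (\<phi> w - \<phi> w') \<le> M1 * norm (w - w')" if "w \<in> C" "w' \<in> C" for w w'
    using C(1) _ _ that
  proof (rule differentiable_bound)
    show "(\<phi> has_derivative blinfun_apply (g' x)) (at x within C)" if "x \<in> C" for x
      using g' that C(3) has_derivative_at_withinI by blast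
    show "onorm (blinfun_apply (g' x)) \<le> M1" if "x \<in> C" for x
      using M(1)[OF that] by (simp add: norm_blinfun.rep_eq)
  qed
  have lip1: "norm (g' w - g' w') \<le> M2 * norm (w - w')" if "w \<in> C" "w' \<in> C" for w w'
    using C(1) _ _ that
  proof (rule differentiable_bound)
    show "(g' has_derivative blinfun_apply (g'' x)) (at x within C)" if "x \<in> C" for x
      using g'' that C(3) has_derivative_at_withinI by blast
    show "onorm (blinfun_apply (g'' x)) \<le> M2" if "x \<in> C" for x
      using M(2)[OF that] by (simp add: norm_blinfun.rep_eq)
  qed
  \<comment> \<open>The Riesz representative of the part of a functional that acts on the first factor.\<close>
  define \<Gamma> :: "(('a \<times> 'b) \<Rightarrow>\<^sub>L real) \<Rightarrow> 'a" where "\<Gamma> B = (\<Sum>b\<in>Basis. blinfun_apply B (b, 0) *\<^sub>R b)" for B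
  define N where "N = real DIM('a)"
  have N: "0 < N" by (simp add: N_def)
  have \<Gamma>_lin: "linear \<Gamma>"
    by (rule linearI) (simp_all add: \<Gamma>_def blinfun.bilinear_simps scaleR_add_left sum.distrib
        scaleR_right.sum)
  have \<Gamma>_norm: "norm (\<Gamma> B) \<le> N * norm B" for B
  proof -
    have "norm (\<Gamma> B) \<le> (\<Sum>b\<in>Basis. norm (blinfun_apply B (b, 0) *\<^sub>R (b::'a)))"
      unfolding \<Gamma>_def by (rule norm_sum)
    also have "\<dots> \<le> (\<Sum>b\<in>(Basis::'a set). norm B)"
    proof (rule sum_mono)
      fix b :: 'a assume "b \<in> Basis"
      then show "norm (blinfun_apply B (b, 0) *\<^sub>R b) \<le> norm B"
        using norm_blinfun[of B "(b, 0)"] by (simp add: norm_Pair)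
    qed
    finally show ?thesis by (simp add: N_def)
  qed
  have \<Gamma>_inner: "h \<bullet> \<Gamma> B = blinfun_apply B (h, 0)" for h B
  proof -
    have lin: "linear (\<lambda>y::'a. (y, 0::'b))" by (rule linearI) auto
    have sc: "blinfun_apply B (c *\<^sub>R b, 0) = c * blinfun_apply B (b, 0)" for c b
      using blinfun.scaleR_right[of B c "(b, 0)"] by simp
    have "blinfun_apply B (h, 0) = blinfun_apply B (\<Sum>b\<in>Basis. (h \<bullet> b) *\<^sub>R b, 0)" by (simp add: euclidean_representation)
    also have "(\<Sum>b\<in>Basis. (h \<bullet> b) *\<^sub>R b, 0::'b) = (\<Sum>b\<in>Basis. (h \<bullet> b) *\<^sub>R (b, 0))"
      using linear_sum[OF lin, of "\<lambda>b. (h \<bullet> b) *\<^sub>R b" Basis] by simp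
    finally show ?thesis
      by (simp add: \<Gamma>_def blinfun.sum_right sc inner_sum_right mult.commute)
  qed
  have C_I: "(x, p) \<in> C" if "x \<in> ball xb (R/2)" "p \<in> ball pb (R/2)" for x p
    using that norm_Pair_le[of "xb - x" "pb - p"] by (simp add: C_def dist_norm)
  have gd: "GDERIV (\<lambda>y. \<phi> (y, p)) x :> \<Gamma> (g' (x, p))" if "(x, p) \<in> C" for x p
  proof -
    have "((\<lambda>y. (y, p)) has_derivative (\<lambda>h. (h, 0))) (at x)"
      by (auto intro!: derivative_eq_intros)
    from has_derivative_compose[OF this, of \<phi> "g' (x, p)"] g' that C(3)
    show ?thesis by (auto simp: gderiv_def \<Gamma>_inner)
  qed
  have grad: "grad_x \<phi> w = \<Gamma> (g' w)" if "w \<in> C" for w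
    using gd[of "fst w" "snd w"] grad_x_eq that by (metis prod.collapse)
  define H where "H h = \<Gamma> (blinfun_apply (g'' (xb, pb)) (h, 0))" for h
  have H_lin: "linear H"
  proof (rule linearI)
    fix a b :: 'a and c :: real
    have "(a + b, 0::'b) = (a, 0) + (b, 0)" "(c *\<^sub>R a, 0::'b) = c *\<^sub>R (a, 0)" by simp_all
    then show "H (a + b) = H a + H b" "H (c *\<^sub>R a) = c *\<^sub>R H a"
      unfolding H_def by (simp_all only: blinfun.add_right blinfun.scaleR_right
          linear_add[OF \<Gamma>_lin] linear_scale[OF \<Gamma>_lin])
  qed
  define K where "K = M1 + N * M2 + 1"
  have K: "0 < K" "M1 \<le> K" "N * M2 \<le> K" using M_nn N mult_nonneg_nonneg[of N M2] unfolding K_def by linarith+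
  show thesis
  proof (rule that[of "R/2" K H])
    show "0 < R / 2" "0 < K" "linear H" using R K H_lin by auto
    show "GDERIV (\<lambda>y. \<phi> (y, p)) x :> grad_x \<phi> (x, p)"
      if "x \<in> ball xb (R/2)" "p \<in> ball pb (R/2)" for x p
      using gd grad C_I that by simp
    have "norm (\<phi> (x, p) - \<phi> (x', p')) \<le> K * (norm (x - x') + norm (p - p')) \<and>
        norm (grad_x \<phi> (x, p) - grad_x \<phi> (x', p')) \<le> K * (norm (x - x') + norm (p - p'))"
      if "x \<in> ball xb (R/2)" "p \<in> ball pb (R/2)" "x' \<in> ball xb (R/2)" "p' \<in> ball pb (R/2)" for x p x' p'
    proof
      have in_C: "(x, p) \<in> C" "(x', p') \<in> C" using that C_I by auto
      have nrm: "norm ((x, p) - (x', p')) \<le> norm (x - x') + norm (p - p')"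
        using norm_Pair_le[of "x - x'" "p - p'"] by simp
      have "norm (\<phi> (x, p) - \<phi> (x', p')) \<le> M1 * norm ((x, p) - (x', p'))" using lip0 in_C by blast
      also have "\<dots> \<le> K * (norm (x - x') + norm (p - p'))"
        using nrm K M_nn by (intro mult_mono) auto
      finally show "norm (\<phi> (x, p) - \<phi> (x', p')) \<le> K * (norm (x - x') + norm (p - p'))" .
      have "norm (grad_x \<phi> (x, p) - grad_x \<phi> (x', p')) = norm (\<Gamma> (g' (x, p) - g' (x', p')))"
        using in_C grad by (simp add: linear_diff[OF \<Gamma>_lin])
      also have "\<dots> \<le> N * norm (g' (x, p) - g' (x', p'))" by (rule \<Gamma>_norm)
      also have "\<dots> \<le> N * (M2 * norm ((x, p) - (x', p')))"
        using lip1[OF in_C] N by (intro mult_left_mono) auto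
      also have "\<dots> = (N * M2) * norm ((x, p) - (x', p'))" by simp
      also have "\<dots> \<le> K * (norm (x - x') + norm (p - p'))"
        using nrm K by (intro mult_mono) auto
      finally show "norm (grad_x \<phi> (x, p) - grad_x \<phi> (x', p')) \<le> K * (norm (x - x') + norm (p - p'))" .
    qed
    then show "lipschitz_near K (R/2) \<phi> xb pb" "lipschitz_near K (R/2) (grad_x \<phi>) xb pb"
      by (auto simp: lipschitz_near_def)
    show "strict_partial_derivative (grad_x \<phi>) H xb pb"
      unfolding strict_partial_derivative_def
    proof (intro allI impI)
      fix e :: real assume e: "0 < e"
      have "isCont g'' (xb, pb)" using cont W continuous_on_eq_continuous_at by blast
      moreover have "0 < e / N" using e N by simp
      ultimately obtain \<rho> where \<rho>: "\<rho> > 0" "\<And>w. dist w (xb, pb) < \<rho> \<Longrightarrow> dist (g'' w) (g'' (xb, pb)) < e / N"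
        unfolding continuous_at_eps_delta by meson
      define s where "s = min \<rho> R"
      have s: "s > 0" using \<rho> R by (simp add: s_def)
      define S where "S = ball (xb, pb) s"
      have S: "convex S" "S \<subseteq> C" "(xb, pb) \<in> S" using s by (auto simp: S_def C_def s_def)
      show "\<forall>\<^sub>F \<delta> in at_right 0. \<forall>x\<in>ball xb \<delta>. \<forall>x'\<in>ball xb \<delta>. \<forall>p\<in>ball pb \<delta>.
         norm (grad_x \<phi> (x, p) - grad_x \<phi> (x', p) - H (x - x')) \<le> e * norm (x - x')"
      proof (rule eventually_at_rightI[of 0 "s/2"], intro ballI)
        show "0 < s / 2" using s by simp
        fix \<delta> x x' p
        assume "\<delta> \<in> {0<..<s/2}" "x \<in> ball xb \<delta>" "x' \<in> ball xb \<delta>" "p \<in> ball pb \<delta>"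
        then have in_S: "(x, p) \<in> S" "(x', p) \<in> S"
          using norm_Pair_le[of "xb - x" "pb - p"] norm_Pair_le[of "xb - x'" "pb - p"]
          by (auto simp: S_def dist_norm)
        have "norm (g' (x, p) - g' (x', p) - blinfun_apply (g'' (xb, pb)) ((x, p) - (x', p))) \<le> norm ((x, p) - (x', p)) * (e / N)"
        proof (rule differentiable_bound_linearization[where S = S])
          fix t :: real assume "t \<in> {0..1}"
          then have "(1 - t) *\<^sub>R (x', p) + t *\<^sub>R (x, p) \<in> S"
            using S(1) in_S by (intro convexD) auto
          then show "(x', p) + t *\<^sub>R ((x, p) - (x', p)) \<in> S" by (simp add: algebra_simps)
        next
          fix w assume w: "w \<in> S"
          show "(g' has_derivative blinfun_apply (g'' w)) (at w within S)"
            using g'' w S C(3) has_derivative_at_withinI by blast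
          have "blinfun_apply (g'' w) - blinfun_apply (g'' (xb, pb)) = blinfun_apply (g'' w - g'' (xb, pb))"
            by (auto simp: blinfun.diff_left)
          moreover have "norm (g'' w - g'' (xb, pb)) \<le> e / N"
            using \<rho>(2)[of w] w by (simp add: S_def s_def dist_norm norm_minus_commute less_imp_le)
          ultimately show "onorm (blinfun_apply (g'' w) - blinfun_apply (g'' (xb, pb))) \<le> e / N"
            by (simp add: norm_blinfun.rep_eq)
        qed (use S in auto)
        then have *: "norm (g' (x, p) - g' (x', p) - blinfun_apply (g'' (xb, pb)) (x - x', 0)) \<le> norm (x - x') * (e / N)"
          by (simp add: norm_Pair)
        have "norm (grad_x \<phi> (x, p) - grad_x \<phi> (x', p) - H (x - x')) =
            norm (\<Gamma> (g' (x, p) - g' (x', p) - blinfun_apply (g'' (xb, pb)) (x - x', 0)))"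
          using subsetD[OF S(2) in_S(1)] subsetD[OF S(2) in_S(2)]
          by (simp add: grad linear_diff[OF \<Gamma>_lin] H_def)
        also have "\<dots> \<le> N * (norm (x - x') * (e / N))"
          using \<Gamma>_norm * N by (meson mult_left_mono less_imp_le order_trans)
        also have "\<dots> = e * norm (x - x')" using N by simp
        finally show "norm (grad_x \<phi> (x, p) - grad_x \<phi> (x', p) - H (x - x')) \<le> e * norm (x - x')" .
      qed
    qed
  qed
qed

text \<open>Differentiability near the base point together with continuity of the derivative at that single point suffices:
the mean value inequality is applied to \<open>f (\<cdot>, p)\<close> minus its linearization at the base point.\<close>

lemma jacobian_strict:
  fixes f :: "(real^'n) \<times> ('b::euclidean_space) \<Rightarrow> real^'n"
  assumes diff: "\<forall>\<^sub>F (x, p) in nhds (xb, pb). (\<lambda>y. f (y, p)) differentiable (at x)"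
    and cont: "isCont (jacobian_x f) (xb, pb)"
  shows "strict_partial_derivative f ((*v) (jacobian_x f (xb, pb))) xb pb"
  unfolding strict_partial_derivative_def
proof (intro allI impI)
  fix e :: real assume e: "0 < e"
  define N where "N = real CARD('n) * real CARD('n)"
  have N: "0 < N" by (simp add: N_def)
  obtain \<rho>1 where \<rho>1: "0 < \<rho>1" "\<And>x p. dist (x, p) (xb, pb) < \<rho>1 \<Longrightarrow> (\<lambda>y. f (y, p)) differentiable (at x)"
    using diff unfolding eventually_nhds_metric by auto
  have "0 < e / N" using e N by simp
  then obtain \<rho>2 where \<rho>2: "0 < \<rho>2" "\<And>z. dist z (xb, pb) < \<rho>2 \<Longrightarrow> dist (jacobian_x f z) (jacobian_x f (xb, pb)) < e / N"
    using cont unfolding continuous_at_eps_delta by meson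
  define \<rho> where "\<rho> = min \<rho>1 \<rho>2"
  have \<rho>: "0 < \<rho>" using \<rho>1 \<rho>2 by (simp add: \<rho>_def)
  show "\<forall>\<^sub>F \<delta> in at_right 0. \<forall>x\<in>ball xb \<delta>. \<forall>x'\<in>ball xb \<delta>. \<forall>p\<in>ball pb \<delta>.
     norm (f (x, p) - f (x', p) - jacobian_x f (xb, pb) *v (x - x')) \<le> e * norm (x - x')"
  proof (rule eventually_at_rightI[of 0 "\<rho>/2"], intro ballI)
    fix \<delta> x x' p assume \<delta>: "\<delta> \<in> {0<..<\<rho>/2}" and x: "x \<in> ball xb \<delta>" "x' \<in> ball xb \<delta>" and p: "p \<in> ball pb \<delta>"
    have close: "dist (y, p) (xb, pb) < \<rho>" if "y \<in> ball xb \<delta>" for y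
    proof -
      have "dist (y, p) (xb, pb) = norm (y - xb, p - pb)" by (simp add: dist_norm)
      also have "\<dots> \<le> norm (y - xb) + norm (p - pb)" by (rule norm_Pair_le)
      also have "\<dots> < \<rho>" using that p \<delta> by (simp add: dist_norm norm_minus_commute)
      finally show ?thesis .
    qed
      define g where "g y = f (y, p) - jacobian_x f (xb, pb) *v y" for y
      have "norm (g x - g x') \<le> e * norm (x - x')"
      proof (rule differentiable_bound[where S = "ball xb \<delta>" and f' = "\<lambda>y h. (jacobian_x f (y, p) - jacobian_x f (xb, pb)) *v h"])
        fix y assume y: "y \<in> ball xb \<delta>"
        have "(\<lambda>y. f (y, p)) differentiable (at y)" using \<rho>1(2) close[OF y] by (simp add: \<rho>_def)
        then have "((\<lambda>y. f (y, p)) has_derivative (\<lambda>h. jacobian_x f (y, p) *v h)) (at y)"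
          unfolding jacobian_works by (simp add: jacobian_x_def)
        then have "(g has_derivative (\<lambda>h. jacobian_x f (y, p) *v h - jacobian_x f (xb, pb) *v h)) (at y)"
          unfolding g_def by (intro has_derivative_diff bounded_linear_imp_has_derivative matrix_vector_mul_bounded_linear)
        then show "(g has_derivative (\<lambda>h. (jacobian_x f (y, p) - jacobian_x f (xb, pb)) *v h)) (at y within ball xb \<delta>)"
          by (simp add: matrix_vector_mult_diff_rdistrib has_derivative_at_withinI)
        have "dist (jacobian_x f (y, p)) (jacobian_x f (xb, pb)) < e / N" using \<rho>2(2) close[OF y] by (simp add: \<rho>_def)
        then have "norm (jacobian_x f (y, p) - jacobian_x f (xb, pb)) \<le> e / N" by (simp add: dist_norm)
        then have "\<bar>(jacobian_x f (y, p) - jacobian_x f (xb, pb)) $ i $ j\<bar> \<le> e / N" for i j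
          using component_le_norm_cart[of "(jacobian_x f (y, p) - jacobian_x f (xb, pb)) $ i" j]
            Finite_Cartesian_Product.norm_nth_le[of "jacobian_x f (y, p) - jacobian_x f (xb, pb)" i] by linarith
        then have "onorm ((*v) (jacobian_x f (y, p) - jacobian_x f (xb, pb))) \<le> N * (e / N)"
          unfolding N_def by (rule onorm_le_matrix_component)
        then show "onorm ((*v) (jacobian_x f (y, p) - jacobian_x f (xb, pb))) \<le> e" using N by simp
      qed (use x in auto)
      then show "norm (f (x, p) - f (x', p) - jacobian_x f (xb, pb) *v (x - x')) \<le> e * norm (x - x')"
        by (simp add: g_def matrix_vector_mult_diff_distrib algebra_simps)
  qed (use \<rho> in simp)
qed

lemma isCont_pair_ball:
  fixes g :: "'a::real_normed_vector \<times> 'b::real_normed_vector \<Rightarrow> 'c::topological_space"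
  assumes "isCont g (xb, pb)" "open S" "g (xb, pb) \<in> S"
  obtains \<rho> where "0 < \<rho>" "\<And>x p. x \<in> ball xb \<rho> \<Longrightarrow> p \<in> ball pb \<rho> \<Longrightarrow> g (x, p) \<in> S"
proof -
  have "\<forall>\<^sub>F z in nhds (xb, pb). g z \<in> S"
    using assms by (intro topological_tendstoD) (auto simp: isCont_def tendsto_at_iff_tendsto_nhds)
  then obtain \<rho> where \<rho>: "0 < \<rho>" "\<And>z. dist z (xb, pb) < \<rho> \<Longrightarrow> g z \<in> S"
    unfolding eventually_nhds_metric by blast
  show thesis
  proof (rule that[of "\<rho> / 2"])
    fix x p assume "x \<in> ball xb (\<rho> / 2)" "p \<in> ball pb (\<rho> / 2)"
    then have "norm (x - xb) + norm (p - pb) < \<rho>" by (simp add: dist_norm norm_minus_commute)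
    then have "dist (x, p) (xb, pb) < \<rho>" using norm_Pair_le[of "x - xb" "p - pb"] by (simp add: dist_norm)
    then show "g (x, p) \<in> S" by (rule \<rho>(2))
  qed (use \<rho> in simp)
qed

section \<open>Normal cones under the partial Mangasarian-Fromovitz condition\<close>

text \<open>All first-order facts hold on one pair of balls of radius \<open>r\<close>. The vector \<open>d\<close> realizes the partial MFCQ with a
margin \<open>\<eta>\<close> that persists on these balls, where moreover no constraint becomes active that is inactive at the
base point; \<open>H i\<close> is the partial Hessian of \<open>\<phi> i\<close> at the base point.\<close>

locale parametric_constraints =
  fixes \<phi> :: "'m::finite \<Rightarrow> 'a::euclidean_space \<times> 'b::euclidean_space \<Rightarrow> real"
    and G :: "'m \<Rightarrow> 'a \<times> 'b \<Rightarrow> 'a" and H :: "'m \<Rightarrow> 'a \<Rightarrow> 'a"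
    and xb :: 'a and pb :: 'b and r K :: real and d :: 'a and \<eta> :: real
  assumes r_pos: "0 < r" and K_pos: "0 < K" and \<eta>_pos: "0 < \<eta>"
    and gderiv: "\<And>i x p. x \<in> ball xb r \<Longrightarrow> p \<in> ball pb r \<Longrightarrow> GDERIV (\<lambda>y. \<phi> i (y, p)) x :> G i (x, p)"
    and \<phi>_lipschitz: "\<And>i. lipschitz_near K r (\<phi> i) xb pb"
    and G_lipschitz: "\<And>i. lipschitz_near K r (G i) xb pb"
    and H_linear: "\<And>i. linear (H i)"
    and G_strict: "\<And>i. strict_partial_derivative (G i) (H i) xb pb"
    and base_feasible: "\<And>i. \<phi> i (xb, pb) \<le> 0"
    and mfcq: "\<And>i x p. \<phi> i (xb, pb) = 0 \<Longrightarrow> x \<in> ball xb r \<Longrightarrow> p \<in> ball pb r \<Longrightarrow> G i (x, p) \<bullet> d \<le> - \<eta>"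
    and inactive: "\<And>i x p. \<phi> i (xb, pb) < 0 \<Longrightarrow> x \<in> ball xb r \<Longrightarrow> p \<in> ball pb r \<Longrightarrow> \<phi> i (x, p) < 0"
begin

abbreviation near :: "'a \<Rightarrow> 'b \<Rightarrow> bool" where
  "near x p \<equiv> x \<in> ball xb r \<and> p \<in> ball pb r"

definition feasible :: "'a \<Rightarrow> 'b \<Rightarrow> bool" where
  "feasible x p \<longleftrightarrow> (\<forall>i. \<phi> i (x, p) \<le> 0)"

definition normal_multiplier :: "'a \<Rightarrow> 'b \<Rightarrow> real^'m \<Rightarrow> 'a \<Rightarrow> bool" where
  "normal_multiplier x p \<mu> w \<longleftrightarrow>
     (\<forall>i. 0 \<le> \<mu> $ i) \<and> (\<forall>i. \<mu> $ i * \<phi> i (x, p) = 0) \<and> w = (\<Sum>i\<in>UNIV. (\<mu> $ i) *\<^sub>R G i (x, p))"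

lemma near_base: "near xb pb"
  using r_pos by simp

lemma eventually_ball_near: "\<forall>\<^sub>F \<delta> in at_right (0::real). \<delta> \<le> r"
  using r_pos by (intro eventually_at_rightI[of 0 r]) auto

lemma normal_multiplier_combination:
  assumes "normal_multiplier x p \<mu> w" "normal_multiplier x p \<mu>' w'" "0 \<le> s" "0 \<le> t"
  shows "normal_multiplier x p (s *\<^sub>R \<mu> + t *\<^sub>R \<mu>') (s *\<^sub>R w + t *\<^sub>R w')"
  using assms
  by (auto simp: normal_multiplier_def distrib_right scaleR_add_left sum.distrib scaleR_right.sum)
    (metis add_0 mult_zero_left mult_zero_right)

lemma normal_multiplier_inactive:
  assumes "normal_multiplier x p \<mu> w" "near x p" "\<phi> i (xb, pb) \<noteq> 0"
  shows "\<mu> $ i = 0"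
proof -
  have "\<phi> i (x, p) < 0" using inactive base_feasible[of i] assms by force
  then show ?thesis using assms(1) unfolding normal_multiplier_def by (metis less_irrefl mult_eq_0_iff)
qed

text \<open>Pair the normal \<open>w\<close> with \<open>- d\<close>: the \<open>i\<close>-th term of the sum is at least \<open>\<eta> * \<mu> $ i\<close>.\<close>

lemma normal_multiplier_bound:
  assumes m: "normal_multiplier x p \<mu> w" and n: "near x p"
  shows "(\<Sum>i\<in>UNIV. \<mu> $ i) \<le> norm w * norm d / \<eta>"
proof -
  have nn: "0 \<le> \<mu> $ i" for i using m by (simp add: normal_multiplier_def)
  have "\<mu> $ i * \<eta> \<le> - (\<mu> $ i * (G i (x, p) \<bullet> d))" for i
  proof (cases "\<phi> i (xb, pb) = 0")
    case True
    then have "\<eta> \<le> - (G i (x, p) \<bullet> d)" using mfcq n by fastforce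
    then have "\<mu> $ i * \<eta> \<le> \<mu> $ i * - (G i (x, p) \<bullet> d)" using nn mult_left_mono by blast
    then show ?thesis by simp
  next
    case False
    then show ?thesis using normal_multiplier_inactive[OF m n] by simp
  qed
  then have "(\<Sum>i\<in>UNIV. \<mu> $ i * \<eta>) \<le> (\<Sum>i\<in>UNIV. - (\<mu> $ i * (G i (x, p) \<bullet> d)))"
    by (intro sum_mono) auto
  also have "\<dots> = - (w \<bullet> d)"
    using m by (simp add: normal_multiplier_def inner_sum_left sum_negf)
  also have "\<dots> \<le> norm w * norm d" using Cauchy_Schwarz_ineq2[of w d] by linarith
  finally have "(\<Sum>i\<in>UNIV. \<mu> $ i) * \<eta> \<le> norm w * norm d" by (simp add: sum_distrib_right)
  then show ?thesis using \<eta>_pos by (simp add: field_simps)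
qed

lemma normal_multiplier_norm_bound:
  assumes m: "normal_multiplier x p \<mu> w" and n: "near x p"
  shows "norm \<mu> \<le> norm w * norm d / \<eta>"
proof -
  have "norm \<mu> \<le> (\<Sum>i\<in>UNIV. \<bar>\<mu> $ i\<bar>)" by (rule norm_le_l1_cart)
  also have "\<dots> = (\<Sum>i\<in>UNIV. \<mu> $ i)" using m by (simp add: normal_multiplier_def)
  finally show ?thesis using normal_multiplier_bound[OF m n] by simp
qed

lemmas \<phi>_lip = lipschitz_nearD[OF \<phi>_lipschitz, unfolded real_norm_def]

lemmas G_lip = lipschitz_nearD[OF G_lipschitz]

lemmas tendsto_\<phi> = tendsto_if_lipschitz_near[OF \<phi>_lipschitz]

lemmas tendsto_G = tendsto_if_lipschitz_near[OF G_lipschitz]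

text \<open>The bound on multipliers makes the normal cone mapping closed, uniformly in the parameter.\<close>

lemma normal_multiplier_closed:
  assumes m: "\<And>k. normal_multiplier (X k) (P k) (M k) (w k)" and n: "\<And>k. near (X k) (P k)"
    and lim: "X \<longlonglongrightarrow> x" "P \<longlonglongrightarrow> p" "w \<longlonglongrightarrow> w0" "near x p"
  obtains \<mu> s where "strict_mono (s::nat \<Rightarrow> nat)" "(M \<circ> s) \<longlonglongrightarrow> \<mu>" "normal_multiplier x p \<mu> w0"
proof -
  obtain B where B: "\<And>k. norm (w k) \<le> B"
    using convergent_imp_bounded[OF lim(3)] unfolding bounded_iff by blast
  have "norm (M k) \<le> B * norm d / \<eta>" for k
  proof -
    have "norm (M k) \<le> norm (w k) * norm d / \<eta>" using normal_multiplier_norm_bound m n by blast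
    also have "\<dots> \<le> B * norm d / \<eta>" using B \<eta>_pos by (intro divide_right_mono mult_right_mono) auto
    finally show ?thesis .
  qed
  then have "bounded (range M)" unfolding bounded_iff by blast
  then obtain \<mu> s where s: "strict_mono s" "(M \<circ> s) \<longlonglongrightarrow> \<mu>"
    using bounded_imp_convergent_subsequence by blast
  have X: "(\<lambda>k. X (s k)) \<longlonglongrightarrow> x" and P: "(\<lambda>k. P (s k)) \<longlonglongrightarrow> p" and w: "(\<lambda>k. w (s k)) \<longlonglongrightarrow> w0"
    using lim(1-3)[THEN LIMSEQ_subseq_LIMSEQ, OF s(1)] by (simp_all add: comp_def)
  have \<mu>: "(\<lambda>k. M (s k) $ i) \<longlonglongrightarrow> \<mu> $ i" for i
    using s(2) unfolding comp_def by (rule tendsto_vec_nth)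
  have \<phi>: "(\<lambda>k. \<phi> i (X (s k), P (s k))) \<longlonglongrightarrow> \<phi> i (x, p)" for i
    by (rule tendsto_\<phi>[OF X P conjunct1[OF lim(4)] conjunct2[OF lim(4)]])
  have G: "(\<lambda>k. G i (X (s k), P (s k))) \<longlonglongrightarrow> G i (x, p)" for i
    by (rule tendsto_G[OF X P conjunct1[OF lim(4)] conjunct2[OF lim(4)]])
  have "0 \<le> \<mu> $ i" for i
    using m by (intro LIMSEQ_le_const[OF \<mu>]) (auto simp: normal_multiplier_def)
  moreover have "\<mu> $ i * \<phi> i (x, p) = 0" for i
  proof -
    have "(\<lambda>k. M (s k) $ i * \<phi> i (X (s k), P (s k))) \<longlonglongrightarrow> \<mu> $ i * \<phi> i (x, p)"
      by (intro tendsto_intros \<mu> \<phi>)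
    moreover have "(\<lambda>k. M (s k) $ i * \<phi> i (X (s k), P (s k))) = (\<lambda>k. 0)"
      using m by (auto simp: normal_multiplier_def)
    ultimately show ?thesis using LIMSEQ_unique tendsto_const by metis
  qed
  moreover have "w0 = (\<Sum>i\<in>UNIV. (\<mu> $ i) *\<^sub>R G i (x, p))"
  proof -
    have "(\<lambda>k. \<Sum>i\<in>UNIV. (M (s k) $ i) *\<^sub>R G i (X (s k), P (s k))) \<longlonglongrightarrow> (\<Sum>i\<in>UNIV. (\<mu> $ i) *\<^sub>R G i (x, p))"
      by (intro tendsto_intros \<mu> G)
    moreover have "(\<lambda>k. \<Sum>i\<in>UNIV. (M (s k) $ i) *\<^sub>R G i (X (s k), P (s k))) = (\<lambda>k. w (s k))"
      using m by (auto simp: normal_multiplier_def)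
    ultimately show ?thesis using w LIMSEQ_unique by metis
  qed
  ultimately have "normal_multiplier x p \<mu> w0" by (simp add: normal_multiplier_def)
  then show thesis using that s by blast
qed

lemma first_order_expansion:
  assumes "x \<in> ball xb r" "x' \<in> ball xb r" "p \<in> ball pb r"
  shows "\<bar>\<phi> i (x', p) - \<phi> i (x, p) - G i (x, p) \<bullet> (x' - x)\<bar> \<le> K * (norm (x' - x))\<^sup>2"
proof -
  have seg: "x + t *\<^sub>R (x' - x) \<in> ball xb r" if "t \<in> {0..1}" for t
  proof -
    have "(1 - t) *\<^sub>R x + t *\<^sub>R x' \<in> ball xb r" using that assms by (intro convexD) auto
    then show ?thesis by (simp add: algebra_simps)
  qed
  define S where "S = (\<lambda>t. x + t *\<^sub>R (x' - x)) ` {0..1}"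
  have "norm (\<phi> i (x', p) - \<phi> i (x, p) - (\<lambda>h. h \<bullet> G i (x, p)) (x' - x)) \<le> norm (x' - x) * (K * norm (x' - x))"
  proof (rule differentiable_bound_linearization[where S = S and f' = "\<lambda>y h. h \<bullet> G i (y, p)" and ?x0.0 = x and f = "\<lambda>y. \<phi> i (y, p)"])
    show "x + t *\<^sub>R (x' - x) \<in> S" if "t \<in> {0..1}" for t using that by (auto simp: S_def)
    show "((\<lambda>y. \<phi> i (y, p)) has_derivative (\<lambda>h. h \<bullet> G i (y, p))) (at y within S)" if "y \<in> S" for y
      using gderiv[of y p i] seg that assms(3) unfolding S_def gderiv_def
      by (auto intro: has_derivative_at_withinI)
    show "x \<in> S" unfolding S_def by (rule image_eqI[of _ _ 0]) auto
    fix y assume "y \<in> S"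
    then obtain t where t: "t \<in> {0..1}" "y = x + t *\<^sub>R (x' - x)" by (auto simp: S_def)
    have "norm (G i (y, p) - G i (x, p)) \<le> K * (norm (y - x) + norm (p - p))"
      using seg t assms by (intro G_lip) auto
    also have "\<dots> \<le> K * norm (x' - x)" using t K_pos by (simp add: mult_left_le_one_le)
    finally have *: "norm (G i (y, p) - G i (x, p)) \<le> K * norm (x' - x)" .
    show "onorm ((\<lambda>h. h \<bullet> G i (y, p)) - (\<lambda>h. h \<bullet> G i (x, p))) \<le> K * norm (x' - x)"
    proof (rule onorm_le)
      fix h
      have "norm (((\<lambda>h. h \<bullet> G i (y, p)) - (\<lambda>h. h \<bullet> G i (x, p))) h) = \<bar>h \<bullet> (G i (y, p) - G i (x, p))\<bar>"
        by (simp add: inner_diff_right)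
      also have "\<dots> \<le> norm h * norm (G i (y, p) - G i (x, p))" by (rule Cauchy_Schwarz_ineq2)
      also have "\<dots> \<le> norm h * (K * norm (x' - x))" using * by (intro mult_left_mono) auto
      finally show "norm (((\<lambda>h. h \<bullet> G i (y, p)) - (\<lambda>h. h \<bullet> G i (x, p))) h) \<le> K * norm (x' - x) * norm h"
        by (simp add: mult.commute)
    qed
  qed
  then show ?thesis by (simp add: inner_commute power2_eq_square mult_ac)
qed

lemma strict_first_order_expansion:
  assumes "0 < e"
  shows "\<forall>\<^sub>F \<delta> in at_right 0. \<forall>x\<in>ball xb \<delta>. \<forall>x'\<in>ball xb \<delta>. \<forall>p\<in>ball pb \<delta>.
     \<bar>\<phi> i (x', p) - \<phi> i (x, p) - G i (xb, pb) \<bullet> (x' - x)\<bar> \<le> e * norm (x' - x)"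
proof (rule eventually_at_rightI[of 0 "min r (e / (4 * K))"], intro ballI)
  show "0 < min r (e / (4 * K))" using r_pos K_pos assms by simp
  fix \<delta> x x' p
  assume \<delta>: "\<delta> \<in> {0<..<min r (e / (4 * K))}" and x: "x \<in> ball xb \<delta>" "x' \<in> ball xb \<delta>" "p \<in> ball pb \<delta>"
  then have n: "x \<in> ball xb r" "x' \<in> ball xb r" "p \<in> ball pb r" by auto
  have K\<delta>: "4 * (K * \<delta>) \<le> e" using \<delta> K_pos by (simp add: field_simps)
  have "\<bar>(G i (x, p) - G i (xb, pb)) \<bullet> (x' - x)\<bar> \<le> norm (G i (x, p) - G i (xb, pb)) * norm (x' - x)"
    by (rule Cauchy_Schwarz_ineq2)
  also have "\<dots> \<le> (K * (norm (x - xb) + norm (p - pb))) * norm (x' - x)"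
    using G_lip[OF n(1,3), of xb pb] r_pos by (intro mult_right_mono) auto
  also have "\<dots> \<le> (K * (\<delta> + \<delta>)) * norm (x' - x)"
    using x K_pos by (intro mult_right_mono mult_left_mono add_mono) (auto simp: dist_norm norm_minus_commute)
  finally have 1: "\<bar>(G i (x, p) - G i (xb, pb)) \<bullet> (x' - x)\<bar> \<le> 2 * (K * \<delta>) * norm (x' - x)"
    by (simp add: algebra_simps)
  have "norm (x' - x) \<le> \<delta> + \<delta>"
    using x dist_triangle2[of x' x xb] by (simp add: dist_norm norm_minus_commute)
  then have "K * (norm (x' - x))\<^sup>2 \<le> K * ((\<delta> + \<delta>) * norm (x' - x))"
    unfolding power2_eq_square using K_pos by (intro mult_left_mono mult_right_mono) auto
  then have "\<bar>\<phi> i (x', p) - \<phi> i (x, p) - G i (x, p) \<bullet> (x' - x)\<bar> \<le> 2 * (K * \<delta>) * norm (x' - x)"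
    using first_order_expansion[OF n, of i] by (simp add: algebra_simps)
  then have "\<bar>\<phi> i (x', p) - \<phi> i (x, p) - G i (xb, pb) \<bullet> (x' - x)\<bar> \<le> 4 * (K * \<delta>) * norm (x' - x)"
    using 1 by (simp add: inner_diff_left)
  also have "\<dots> \<le> e * norm (x' - x)" using K\<delta> by (intro mult_right_mono) auto
  finally show "\<bar>\<phi> i (x', p) - \<phi> i (x, p) - G i (xb, pb) \<bullet> (x' - x)\<bar> \<le> e * norm (x' - x)" .
qed

lemma second_order_expansion:
  assumes "0 < e"
  shows "\<forall>\<^sub>F \<delta> in at_right 0. \<forall>x\<in>ball xb \<delta>. \<forall>x'\<in>ball xb \<delta>. \<forall>p\<in>ball pb \<delta>.
     \<bar>\<phi> i (x', p) - \<phi> i (x, p) - G i (x, p) \<bullet> (x' - x) - (x' - x) \<bullet> H i (x' - x) / 2\<bar> \<le> e * (norm (x' - x))\<^sup>2"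
  using strict_partial_derivativeD[OF G_strict assms, of i] eventually_ball_near
proof eventually_elim
  case (elim \<delta>)
  show ?case
  proof (intro ballI)
    fix x x' p assume x: "x \<in> ball xb \<delta>" "x' \<in> ball xb \<delta>" "p \<in> ball pb \<delta>"
    define h where "h = x' - x"
    have seg: "x + t *\<^sub>R h \<in> ball xb \<delta>" if "t \<in> {0..1}" for t
    proof -
      have "(1 - t) *\<^sub>R x + t *\<^sub>R x' \<in> ball xb \<delta>" using that x by (intro convexD) auto
      then show ?thesis by (simp add: algebra_simps h_def)
    qed
    define q where "q t = \<phi> i (x + t *\<^sub>R h, p) - t * (G i (x, p) \<bullet> h) - t\<^sup>2 * (h \<bullet> H i h) / 2" for t
    define q' where "q' t = G i (x + t *\<^sub>R h, p) \<bullet> h - G i (x, p) \<bullet> h - t * (h \<bullet> H i h)" for t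
    have "norm (q 1 - q 0) \<le> e * (norm h)\<^sup>2 * norm (1 - (0::real))"
    proof (rule differentiable_bound[where S = "{0..1}" and f' = "\<lambda>t s. q' t * s"])
      fix t :: real assume t: "t \<in> {0..1}"
      have "x + t *\<^sub>R h \<in> ball xb r" "p \<in> ball pb r" using seg[OF t] elim(2) x by auto
      then have "((\<lambda>y. \<phi> i (y, p)) has_derivative (\<lambda>k. k \<bullet> G i (x + t *\<^sub>R h, p))) (at (x + t *\<^sub>R h))"
        using gderiv by (simp add: gderiv_def)
      moreover have "((\<lambda>t. x + t *\<^sub>R h) has_derivative (\<lambda>s. s *\<^sub>R h)) (at t)"
        by (auto intro!: derivative_eq_intros)
      ultimately have "((\<lambda>t. \<phi> i (x + t *\<^sub>R h, p)) has_derivative (\<lambda>s. (s *\<^sub>R h) \<bullet> G i (x + t *\<^sub>R h, p))) (at t)"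
        using has_derivative_compose[of "\<lambda>t. x + t *\<^sub>R h" _ t UNIV "\<lambda>y. \<phi> i (y, p)"] by blast
      then have "(q has_derivative (\<lambda>s. q' t * s)) (at t)"
        unfolding q_def q'_def
        by (auto intro!: derivative_eq_intros simp: algebra_simps inner_commute)
      then show "(q has_derivative (\<lambda>s. q' t * s)) (at t within {0..1})"
        by (rule has_derivative_at_withinI)
      have "norm (G i (x + t *\<^sub>R h, p) - G i (x, p) - H i ((x + t *\<^sub>R h) - x)) \<le> e * norm ((x + t *\<^sub>R h) - x)"
        using elim(1) seg[OF t] x by blast
      then have "norm (G i (x + t *\<^sub>R h, p) - G i (x, p) - t *\<^sub>R H i h) \<le> e * (t * norm h)"
        using t by (simp add: linear_scale[OF H_linear])
      also have "\<dots> \<le> e * norm h" using t assms by (simp add: mult_left_le_one_le)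
      finally have *: "norm (G i (x + t *\<^sub>R h, p) - G i (x, p) - t *\<^sub>R H i h) \<le> e * norm h" .
      have "\<bar>q' t\<bar> = \<bar>(G i (x + t *\<^sub>R h, p) - G i (x, p) - t *\<^sub>R H i h) \<bullet> h\<bar>"
        by (simp add: q'_def inner_diff_left inner_diff_right inner_commute)
      also have "\<dots> \<le> norm (G i (x + t *\<^sub>R h, p) - G i (x, p) - t *\<^sub>R H i h) * norm h"
        by (rule Cauchy_Schwarz_ineq2)
      also have "\<dots> \<le> (e * norm h) * norm h" using * by (intro mult_right_mono) auto
      finally have "\<bar>q' t\<bar> \<le> e * (norm h)\<^sup>2" by (simp add: power2_eq_square)
      then show "onorm ((*) (q' t)) \<le> e * (norm h)\<^sup>2"
        by (intro onorm_le) (auto simp: abs_mult intro: mult_right_mono)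
    qed auto
    then show "\<bar>\<phi> i (x', p) - \<phi> i (x, p) - G i (x, p) \<bullet> (x' - x) - (x' - x) \<bullet> H i (x' - x) / 2\<bar> \<le> e * (norm (x' - x))\<^sup>2"
      by (simp add: q_def h_def)
  qed
qed

text \<open>The first-order expansion at \<open>x\<close> bounds \<open>\<langle>w, y - x\<rangle>\<close> by the values \<open>\<phi> i (y, p)\<close>, which are nonpositive where the
multiplier is positive, plus a quadratic error. The point \<open>y\<close> may violate the remaining constraints.\<close>

lemma normal_hypomonotone:
  assumes m: "normal_multiplier x p \<mu> w" and n: "x \<in> ball xb r" "y \<in> ball xb r" "p \<in> ball pb r"
    and y: "\<And>i. \<mu> $ i > 0 \<Longrightarrow> \<phi> i (y, p) \<le> 0"
  shows "w \<bullet> (y - x) \<le> K * (\<Sum>i\<in>UNIV. \<mu> $ i) * (norm (y - x))\<^sup>2"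
proof -
  have "\<mu> $ i * (G i (x, p) \<bullet> (y - x)) \<le> \<mu> $ i * (K * (norm (y - x))\<^sup>2)" for i
  proof (cases "\<mu> $ i = 0")
    case False
    then have pos: "\<mu> $ i > 0" using m by (simp add: normal_multiplier_def less_le)
    then have "\<phi> i (x, p) = 0" using m unfolding normal_multiplier_def by (metis less_irrefl mult_eq_0_iff)
    then have "G i (x, p) \<bullet> (y - x) \<le> K * (norm (y - x))\<^sup>2"
      using first_order_expansion[OF n, of i] y[OF pos] by linarith
    then show ?thesis using pos by simp
  qed simp
  then have "(\<Sum>i\<in>UNIV. \<mu> $ i * (G i (x, p) \<bullet> (y - x))) \<le> (\<Sum>i\<in>UNIV. \<mu> $ i * (K * (norm (y - x))\<^sup>2))"
    by (intro sum_mono) auto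
  then show ?thesis
    using m by (simp add: normal_multiplier_def inner_sum_left sum_distrib_right sum_distrib_left mult_ac)
qed

lemma normal_multiplier_imp_regular_normal:
  assumes m: "normal_multiplier x p \<mu> w" and n: "near x p"
  shows "w \<in> regular_normal_cone (feasible_set \<phi> p) x"
  unfolding regular_normal_cone_iff
proof (intro allI impI)
  fix e :: real assume e: "0 < e"
  define S where "S = (\<Sum>i\<in>UNIV. \<mu> $ i)"
  have "((\<lambda>y. K * S * norm (y - x)) \<longlongrightarrow> K * S * norm (x - x)) (at x within feasible_set \<phi> p)"
    by (intro tendsto_intros)
  then have 1: "\<forall>\<^sub>F y in at x within feasible_set \<phi> p. K * S * norm (y - x) < e"
    by (rule order_tendstoD) (use e in simp)
  have 2: "\<forall>\<^sub>F y in at x within feasible_set \<phi> p. y \<in> ball xb r"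
    using n by (intro topological_tendstoD[OF tendsto_ident_at]) auto
  have 3: "\<forall>\<^sub>F y in at x within feasible_set \<phi> p. y \<in> feasible_set \<phi> p"
    by (simp add: eventually_at_filter)
  show "\<forall>\<^sub>F y in at x within feasible_set \<phi> p. w \<bullet> (y - x) \<le> e * norm (y - x)"
    using 1 2 3
  proof eventually_elim
    case (elim y)
    have "w \<bullet> (y - x) \<le> K * S * (norm (y - x))\<^sup>2"
      unfolding S_def by (rule normal_hypomonotone[OF m]) (use elim n in \<open>auto simp: feasible_set_def\<close>)
    also have "\<dots> = (K * S * norm (y - x)) * norm (y - x)" by (simp add: power2_eq_square)
    also have "\<dots> \<le> e * norm (y - x)" using elim by (intro mult_right_mono) auto
    finally show ?case .
  qed
qed

lemma inward_direction_feasible: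
  assumes n: "near x p" and feas: "\<And>i. \<phi> i (x, p) \<le> 0"
    and dir: "\<And>i. \<phi> i (x, p) = 0 \<Longrightarrow> G i (x, p) \<bullet> v < 0"
  shows "\<forall>\<^sub>F t in at_right 0. \<forall>i. \<phi> i (x + t *\<^sub>R v, p) < 0"
proof (rule eventually_all_finite)
  fix i
  have lim: "((\<lambda>t. x + t *\<^sub>R v) \<longlongrightarrow> x) (at_right 0)"
    by (auto intro!: tendsto_eq_intros)
  then have "\<forall>\<^sub>F t in at_right 0. x + t *\<^sub>R v \<in> ball xb r"
    using n by (intro topological_tendstoD) auto
  then have ev: "\<forall>\<^sub>F t in at_right 0. near (x + t *\<^sub>R v) p" using n by simp
  show "\<forall>\<^sub>F t in at_right 0. \<phi> i (x + t *\<^sub>R v, p) < 0"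
  proof (cases "\<phi> i (x, p) = 0")
    case False
    then have "\<phi> i (x, p) < 0" using feas[of i] by simp
    then show ?thesis
      using order_tendstoD(2)[OF tendsto_\<phi>[OF lim tendsto_const]] n by blast
  next
    case True
    have "((\<lambda>t. G i (x, p) \<bullet> v + K * t * (norm v)\<^sup>2) \<longlongrightarrow> G i (x, p) \<bullet> v + K * 0 * (norm v)\<^sup>2) (at_right 0)"
      by (intro tendsto_intros)
    then have "\<forall>\<^sub>F t in at_right 0. G i (x, p) \<bullet> v + K * t * (norm v)\<^sup>2 < 0"
      by (rule order_tendstoD) (use dir[OF True] in simp)
    moreover have "\<forall>\<^sub>F t in at_right (0::real). 0 < t" by (rule eventually_at_right_less)
    ultimately show ?thesis using ev
    proof eventually_elim
      case (elim t)
      have "\<phi> i (x + t *\<^sub>R v, p) - G i (x, p) \<bullet> (t *\<^sub>R v) \<le> K * (norm (t *\<^sub>R v))\<^sup>2"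
        using first_order_expansion[of x "x + t *\<^sub>R v" p i] elim(3) n True by simp
      then have "\<phi> i (x + t *\<^sub>R v, p) \<le> t * (G i (x, p) \<bullet> v + K * t * (norm v)\<^sup>2)"
        by (simp add: power2_eq_square algebra_simps)
      also have "\<dots> < 0" using elim by (simp add: mult_pos_neg)
      finally show ?case .
    qed
  qed
qed

lemma regular_normal_inward_direction:
  assumes \<zeta>: "\<zeta> \<in> regular_normal_cone (feasible_set \<phi> p) x"
    and n: "near x p" and feas: "\<And>i. \<phi> i (x, p) \<le> 0"
    and dir: "\<And>i. \<phi> i (x, p) = 0 \<Longrightarrow> G i (x, p) \<bullet> v < 0"
  shows "\<zeta> \<bullet> v \<le> 0"
proof (cases "v = 0")
  case False
  have "\<zeta> \<bullet> v \<le> e * norm v" if e: "0 < e" for e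
  proof -
    have pos: "\<forall>\<^sub>F t in at_right (0::real). 0 < t" by (rule eventually_at_right_less)
    have "\<forall>\<^sub>F t in at_right 0. \<forall>i. \<phi> i (x + t *\<^sub>R v, p) < 0"
      by (rule inward_direction_feasible[OF n feas]) (use dir in auto)
    then have "\<forall>\<^sub>F t in at_right 0. x + t *\<^sub>R v \<in> feasible_set \<phi> p \<and> x + t *\<^sub>R v \<noteq> x"
      using pos
      by eventually_elim (auto simp: feasible_set_def False less_imp_le)
    then have "filterlim (\<lambda>t. x + t *\<^sub>R v) (at x within feasible_set \<phi> p) (at_right 0)"
      unfolding filterlim_at by (auto intro!: tendsto_eq_intros)
    moreover have "\<forall>\<^sub>F w in at x within feasible_set \<phi> p. \<zeta> \<bullet> (w - x) \<le> e * norm (w - x)"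
      using \<zeta> e by (simp add: regular_normal_cone_iff)
    ultimately have "\<forall>\<^sub>F t in at_right 0. \<zeta> \<bullet> (x + t *\<^sub>R v - x) \<le> e * norm (x + t *\<^sub>R v - x)"
      unfolding filterlim_iff by blast
    then have "\<forall>\<^sub>F t in at_right (0::real). \<zeta> \<bullet> v \<le> e * norm v"
      using pos by eventually_elim (auto simp: mult.left_commute)
    then show ?thesis by (simp add: eventually_const)
  qed
  moreover have "norm v > 0" using False by simp
  ultimately have "\<zeta> \<bullet> v \<le> 0 + e" if "e > 0" for e
    using that by (metis add_0 divide_pos_pos nonzero_eq_divide_eq less_irrefl)
  then show ?thesis by (rule field_le_epsilon)
qed simp

text \<open>Farkas' lemma for the active gradients: the cone that they generate is closed because multipliers are bounded.
A vector outside it is separated by some \<open>a\<close>, and \<open>- a\<close>, tilted by \<open>d\<close>, is an inward direction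
with which no regular normal can make an acute angle.\<close>

lemma regular_normal_imp_normal_multiplier:
  assumes \<zeta>: "\<zeta> \<in> regular_normal_cone (feasible_set \<phi> p) x"
    and n: "near x p" and feas: "\<And>i. \<phi> i (x, p) \<le> 0"
  shows "\<exists>\<mu>. normal_multiplier x p \<mu> \<zeta>"
proof (rule ccontr)
  define N where "N = {w. \<exists>\<mu>. normal_multiplier x p \<mu> w}"
  assume "\<nexists>\<mu>. normal_multiplier x p \<mu> \<zeta>"
  then have "\<zeta> \<notin> N" by (simp add: N_def)
  moreover have "convex N"
  proof (rule convexI)
    fix w w' and s t :: real
    assume w: "w \<in> N" "w' \<in> N" and st: "0 \<le> s" "0 \<le> t" "s + t = 1"
    then obtain \<mu> \<mu>' where "normal_multiplier x p \<mu> w" "normal_multiplier x p \<mu>' w'"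
      by (auto simp: N_def)
    then have "normal_multiplier x p (s *\<^sub>R \<mu> + t *\<^sub>R \<mu>') (s *\<^sub>R w + t *\<^sub>R w')"
      using st(1,2) by (rule normal_multiplier_combination)
    then show "s *\<^sub>R w + t *\<^sub>R w' \<in> N" by (auto simp: N_def)
  qed
  moreover have "closed N"
    unfolding closed_sequential_limits
  proof (intro allI impI, elim conjE)
    fix w l assume "\<forall>k. w k \<in> N" and w: "w \<longlonglongrightarrow> l"
    then obtain M where M: "\<And>k. normal_multiplier x p (M k) (w k)" unfolding N_def by simp metis
    show "l \<in> N"
      by (rule normal_multiplier_closed[of "\<lambda>_. x" "\<lambda>_. p" M w x p l]) (use M w n in \<open>auto simp: N_def\<close>)
  qed
  ultimately obtain a b where ab: "a \<bullet> \<zeta> < b" "\<And>w. w \<in> N \<Longrightarrow> b < a \<bullet> w"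
    using separating_hyperplane_closed_point by metis
  have "0 \<in> N" unfolding N_def normal_multiplier_def by (auto intro!: exI[of _ 0])
  then have b: "b < 0" using ab(2) by force
  have aG: "0 \<le> a \<bullet> G i (x, p)" if i: "\<phi> i (x, p) = 0" for i
  proof (rule ccontr)
    assume neg: "\<not> ?thesis"
    \<comment> \<open>This multiple of \<open>G i (x, p)\<close> lies in the cone and on the separating hyperplane.\<close>
    define c where "c = b / (a \<bullet> G i (x, p))"
    have "c \<ge> 0" using neg b by (simp add: c_def divide_nonpos_neg)
    have "(\<Sum>j\<in>UNIV. (axis i c $ j) *\<^sub>R G j (x, p)) = (\<Sum>j\<in>UNIV. if j = i then c *\<^sub>R G j (x, p) else 0)"
      by (rule sum.cong) (auto simp: axis_def)
    then have "normal_multiplier x p (axis i c) (c *\<^sub>R G i (x, p))"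
      using i \<open>c \<ge> 0\<close> by (auto simp: normal_multiplier_def axis_def)
    then have "c *\<^sub>R G i (x, p) \<in> N" by (auto simp: N_def)
    then have "b < a \<bullet> (c *\<^sub>R G i (x, p))" by (rule ab(2))
    moreover have "a \<bullet> (c *\<^sub>R G i (x, p)) = b" using neg by (simp add: c_def)
    ultimately show False by simp
  qed
  \<comment> \<open>Tilting \<open>- a\<close> by a small multiple of \<open>d\<close> makes it strictly inward and keeps it
     on the wrong side of \<open>\<zeta>\<close>.\<close>
  define s where "s = - b / (\<bar>\<zeta> \<bullet> d\<bar> + 1)"
  have s: "0 < s" using b by (simp add: s_def divide_neg_pos)
  have "\<zeta> \<bullet> (- a + s *\<^sub>R d) \<le> 0"
  proof (rule regular_normal_inward_direction[OF \<zeta> n feas])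
    fix i assume i: "\<phi> i (x, p) = 0"
    then have "\<phi> i (xb, pb) = 0" using inactive[of i x p] n base_feasible[of i] by force
    then have "G i (x, p) \<bullet> d \<le> - \<eta>" using mfcq n by blast
    then have "s * (G i (x, p) \<bullet> d) < 0" using s \<eta>_pos by (simp add: mult_pos_neg)
    then show "G i (x, p) \<bullet> (- a + s *\<^sub>R d) < 0"
      using aG[OF i] by (simp add: inner_add_right inner_diff_right inner_commute)
  qed
  moreover have "s * (\<bar>\<zeta> \<bullet> d\<bar> + 1) = - b"
  proof -
    have "\<bar>\<zeta> \<bullet> d\<bar> + 1 \<noteq> 0" by linarith
    then show ?thesis by (simp add: s_def)
  qed
  then have "s * \<bar>\<zeta> \<bullet> d\<bar> < - b" using s by (simp add: algebra_simps)
  moreover have "s * - (\<zeta> \<bullet> d) \<le> s * \<bar>\<zeta> \<bullet> d\<bar>" using s by (intro mult_left_mono) auto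
  ultimately show False using ab(1) by (simp add: inner_add_right inner_diff_right inner_commute)
qed

text \<open>Regular normals at nearby points have multipliers, and these pass to the limit; conversely every such
combination is already a regular normal.\<close>

proposition limiting_normal_cone_iff:
  assumes n: "near x p"
  shows "w \<in> limiting_normal_cone (feasible_set \<phi> p) x \<longleftrightarrow>
    (\<forall>i. \<phi> i (x, p) \<le> 0) \<and> (\<exists>\<mu>. normal_multiplier x p \<mu> w)"
proof
  assume L: "w \<in> limiting_normal_cone (feasible_set \<phi> p) x"
  then have "x \<in> feasible_set \<phi> p" by (auto simp: limiting_normal_cone_def split: if_splits)
  moreover from this L obtain Z W where Z: "\<And>k. Z k \<in> feasible_set \<phi> p"
    "\<And>k. W k \<in> regular_normal_cone (feasible_set \<phi> p) (Z k)" and lim: "Z \<longlonglongrightarrow> x" "W \<longlonglongrightarrow> w"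
    unfolding limiting_normal_cone_def by auto
  have "\<forall>\<^sub>F k in sequentially. Z k \<in> ball xb r" using lim(1) n by (intro topological_tendstoD) auto
  then obtain k0 where k0: "\<And>k. k \<ge> k0 \<Longrightarrow> Z k \<in> ball xb r" by (auto simp: eventually_sequentially)
  have "\<exists>\<mu>. normal_multiplier (Z (k + k0)) p \<mu> (W (k + k0))" for k
    using Z k0 n by (intro regular_normal_imp_normal_multiplier) (auto simp: feasible_set_def)
  then obtain M where "\<And>k. normal_multiplier (Z (k + k0)) p (M k) (W (k + k0))" by metis
  then have "\<exists>\<mu>. normal_multiplier x p \<mu> w"
    by (rule normal_multiplier_closed[of "\<lambda>k. Z (k + k0)" "\<lambda>_. p" M "\<lambda>k. W (k + k0)" x p w])
      (use k0 n lim[THEN LIMSEQ_ignore_initial_segment] in auto)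
  ultimately show "(\<forall>i. \<phi> i (x, p) \<le> 0) \<and> (\<exists>\<mu>. normal_multiplier x p \<mu> w)"
    by (simp add: feasible_set_def)
next
  assume R: "(\<forall>i. \<phi> i (x, p) \<le> 0) \<and> (\<exists>\<mu>. normal_multiplier x p \<mu> w)"
  then have "w \<in> regular_normal_cone (feasible_set \<phi> p) x"
    using normal_multiplier_imp_regular_normal n by blast
  then have "\<exists>zs \<zeta>s. (\<forall>k::nat. zs k \<in> feasible_set \<phi> p \<and> \<zeta>s k \<in> regular_normal_cone (feasible_set \<phi> p) (zs k)) \<and>
                 zs \<longlonglongrightarrow> x \<and> \<zeta>s \<longlonglongrightarrow> w"
    using R by (intro exI[of _ "\<lambda>_. x"] exI[of _ "\<lambda>_. w"]) (auto simp: feasible_set_def)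
  then show "w \<in> limiting_normal_cone (feasible_set \<phi> p) x"
    using R by (simp add: limiting_normal_cone_def feasible_set_def)
qed

end

section \<open>The second-order condition and strong monotonicity\<close>

text \<open>\<open>A\<close> is the partial derivative of \<open>f\<close> at the base point. The constant \<open>K\<close> serves the constraints and \<open>f\<close> alike.\<close>

locale parametric_variational = parametric_constraints \<phi> G H xb pb r K d \<eta>
  for \<phi> :: "'m::finite \<Rightarrow> 'a::euclidean_space \<times> 'b::euclidean_space \<Rightarrow> real"
    and G H xb pb r K d \<eta> +
  fixes f :: "'a \<times> 'b \<Rightarrow> 'a" and A :: "'a \<Rightarrow> 'a" and vb :: 'a
  assumes f_lipschitz: "lipschitz_near K r f xb pb"
    and A_linear: "linear A"
    and f_strict: "strict_partial_derivative f A xb pb"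
    and base_solution: "\<exists>\<mu>. normal_multiplier xb pb \<mu> (vb - f (xb, pb))"
begin

definition multiplier :: "'a \<Rightarrow> 'b \<Rightarrow> 'a \<Rightarrow> real^'m \<Rightarrow> bool" where
  "multiplier x p v \<mu> \<longleftrightarrow> normal_multiplier x p \<mu> (v - f (x, p))"

text \<open>The quadratic form of the partial derivative of the Lagrangian at the base point.\<close>

definition curvature :: "real^'m \<Rightarrow> 'a \<Rightarrow> real" where
  "curvature \<mu> u = u \<bullet> A u + (\<Sum>i\<in>UNIV. \<mu> $ i * (u \<bullet> H i u))"

definition strong_second_order :: bool where
  "strong_second_order \<longleftrightarrow> (\<forall>\<mu>. multiplier xb pb vb \<mu> \<longrightarrow>
     (\<forall>u. u \<noteq> 0 \<and> (\<forall>i. 0 < \<mu> $ i \<longrightarrow> G i (xb, pb) \<bullet> u = 0) \<longrightarrow> 0 < curvature \<mu> u))"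

lemma curvature_scaleR: "curvature \<mu> (s *\<^sub>R u) = s\<^sup>2 * curvature \<mu> u"
proof -
  have "(s *\<^sub>R u) \<bullet> L (s *\<^sub>R u) = s\<^sup>2 * (u \<bullet> L u)" if "linear L" for L
    by (simp add: linear_scale[OF that] power2_eq_square)
  note scale = this[OF A_linear] this[OF H_linear]
  show ?thesis
    unfolding curvature_def scale by (simp add: distrib_left sum_distrib_left mult.left_commute)
qed

lemma tendsto_curvature:
  assumes "(M \<longlongrightarrow> \<mu>) F" "(U \<longlongrightarrow> u) F"
  shows "((\<lambda>k. curvature (M k) (U k)) \<longlongrightarrow> curvature \<mu> u) F"
proof -
  have lin: "((\<lambda>k. L (U k)) \<longlongrightarrow> L u) F" if "linear L" for L :: "'a \<Rightarrow> 'a"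
    using linear_continuous_at[of L u] that assms(2) by (simp add: linear_conv_bounded_linear isCont_tendsto_compose)
  show ?thesis
    unfolding curvature_def by (intro tendsto_intros assms lin A_linear H_linear)
qed

text \<open>The complementarity defect of a multiplier at a point where it need not be a multiplier.\<close>

definition slack :: "real^'m \<Rightarrow> 'a \<Rightarrow> 'b \<Rightarrow> real" where
  "slack \<mu> x p = (\<Sum>i\<in>UNIV. - (\<mu> $ i * \<phi> i (x, p)))"

lemma multiplier_nonneg: "multiplier x p v \<mu> \<Longrightarrow> 0 \<le> \<mu> $ i"
  by (simp add: multiplier_def normal_multiplier_def)

lemma multiplier_complementary: "multiplier x p v \<mu> \<Longrightarrow> \<mu> $ i * \<phi> i (x, p) = 0"
  by (simp add: multiplier_def normal_multiplier_def)

lemma multiplier_sum: "multiplier x p v \<mu> \<Longrightarrow> v = f (x, p) + (\<Sum>i\<in>UNIV. \<mu> $ i *\<^sub>R G i (x, p))"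
  by (simp add: multiplier_def normal_multiplier_def algebra_simps)

lemmas f_lip = lipschitz_nearD[OF f_lipschitz]

lemmas tendsto_f = tendsto_if_lipschitz_near[OF f_lipschitz]

lemma multiplier_closed:
  assumes m: "\<And>k. multiplier (X k) (P k) (V k) (M k)" and n: "\<And>k. near (X k) (P k)"
    and lim: "X \<longlonglongrightarrow> x" "P \<longlonglongrightarrow> p" "V \<longlonglongrightarrow> v" "near x p"
  obtains \<mu> s where "strict_mono (s::nat \<Rightarrow> nat)" "(M \<circ> s) \<longlonglongrightarrow> \<mu>" "multiplier x p v \<mu>"
proof -
  have "(\<lambda>k. V k - f (X k, P k)) \<longlonglongrightarrow> v - f (x, p)"
    using lim by (intro tendsto_diff tendsto_f) auto
  with normal_multiplier_closed[OF m[unfolded multiplier_def] n lim(1,2) _ lim(4)] that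
  show thesis unfolding multiplier_def by blast
qed

definition multiplier_radius :: real where
  "multiplier_radius = (norm (vb - f (xb, pb)) + r + K * (r + r)) * norm d / \<eta>"

lemma multiplier_bound:
  assumes m: "multiplier x p v \<mu>" and n: "near x p" and v: "norm (v - vb) \<le> r"
  shows "(\<Sum>i\<in>UNIV. \<mu> $ i) \<le> multiplier_radius" "norm \<mu> \<le> multiplier_radius"
proof -
  have "norm (f (xb, pb) - f (x, p)) \<le> K * (norm (xb - x) + norm (pb - p))"
    using n r_pos by (intro f_lip) auto
  also have "\<dots> \<le> K * (r + r)"
    using n K_pos by (intro mult_left_mono add_mono) (auto simp: dist_norm)
  finally have "norm (f (xb, pb) - f (x, p)) \<le> K * (r + r)" .
  moreover have eq: "v - f (x, p) = (vb - f (xb, pb)) + (v - vb) + (f (xb, pb) - f (x, p))" by simp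
  have "norm (v - f (x, p)) \<le> norm (vb - f (xb, pb)) + norm (v - vb) + norm (f (xb, pb) - f (x, p))"
    unfolding eq by (meson add_mono norm_triangle_ineq norm_triangle_mono order_refl)
  ultimately have "norm (v - f (x, p)) \<le> norm (vb - f (xb, pb)) + r + K * (r + r)" using v by simp
  then have "norm (v - f (x, p)) * norm d / \<eta> \<le> multiplier_radius"
    unfolding multiplier_radius_def using \<eta>_pos by (intro divide_right_mono mult_right_mono) auto
  then show "(\<Sum>i\<in>UNIV. \<mu> $ i) \<le> multiplier_radius" "norm \<mu> \<le> multiplier_radius"
    using normal_multiplier_bound[OF m[unfolded multiplier_def] n]
      normal_multiplier_norm_bound[OF m[unfolded multiplier_def] n] by linarith+
qed

lemma multiplier_limit:
  assumes "\<And>k. multiplier (X k) (P k) (V k) (M k)" "\<And>k. near (X k) (P k)"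
    and "X \<longlonglongrightarrow> x" "P \<longlonglongrightarrow> p" "V \<longlonglongrightarrow> v" "M \<longlonglongrightarrow> \<mu>" "near x p"
  shows "multiplier x p v \<mu>"
proof -
  obtain \<mu>' s where "strict_mono (s::nat \<Rightarrow> nat)" "(M \<circ> s) \<longlonglongrightarrow> \<mu>'" "multiplier x p v \<mu>'"
    using multiplier_closed assms by metis
  moreover from this have "\<mu>' = \<mu>" using assms(6) LIMSEQ_subseq_LIMSEQ LIMSEQ_unique by blast
  ultimately show ?thesis by simp
qed

text \<open>Expand each active constraint to second order, from \<open>x1\<close> for the multiplier \<open>\<mu>1\<close> and from \<open>x2\<close> for \<open>\<mu>2\<close>. Each
expansion contributes half of the Hessian term, hence the mean multiplier, and the value of the
constraint at the other point, hence the slack.\<close>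

lemma quadratic_lower_bound:
  assumes "0 < e"
  shows "\<forall>\<^sub>F \<delta> in at_right 0. \<forall>x1\<in>ball xb \<delta>. \<forall>x2\<in>ball xb \<delta>. \<forall>p\<in>ball pb \<delta>. \<forall>v1 v2 \<mu>1 \<mu>2.
    multiplier x1 p v1 \<mu>1 \<longrightarrow> multiplier x2 p v2 \<mu>2 \<longrightarrow>
    curvature ((1/2) *\<^sub>R (\<mu>1 + \<mu>2)) (x1 - x2) - e * (1 + (\<Sum>i\<in>UNIV. \<mu>1 $ i + \<mu>2 $ i)) * (norm (x1 - x2))\<^sup>2
      + slack \<mu>1 x2 p + slack \<mu>2 x1 p \<le> (v1 - v2) \<bullet> (x1 - x2)"
proof -
  have "\<forall>\<^sub>F \<delta> in at_right 0. \<forall>i. \<forall>x\<in>ball xb \<delta>. \<forall>x'\<in>ball xb \<delta>. \<forall>p\<in>ball pb \<delta>.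
     \<bar>\<phi> i (x', p) - \<phi> i (x, p) - G i (x, p) \<bullet> (x' - x) - (x' - x) \<bullet> H i (x' - x) / 2\<bar> \<le> e * (norm (x' - x))\<^sup>2"
    by (intro eventually_all_finite second_order_expansion assms)
  with strict_partial_derivativeD[OF f_strict assms] show ?thesis
  proof eventually_elim
    case (elim \<delta>)
    show ?case
    proof (intro ballI allI impI)
      fix x1 x2 p v1 v2 \<mu>1 \<mu>2
      assume x: "x1 \<in> ball xb \<delta>" "x2 \<in> ball xb \<delta>" "p \<in> ball pb \<delta>"
        and m1: "multiplier x1 p v1 \<mu>1" and m2: "multiplier x2 p v2 \<mu>2"
      define h where "h = x1 - x2"
      define q where "q = e * (norm h)\<^sup>2"
      have h': "x2 - x1 = - h" by (simp add: h_def)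
      have "\<bar>(f (x1, p) - f (x2, p) - A h) \<bullet> h\<bar> \<le> norm (f (x1, p) - f (x2, p) - A h) * norm h"
        by (rule Cauchy_Schwarz_ineq2)
      also have "\<dots> \<le> (e * norm h) * norm h"
        using elim(1) x by (intro mult_right_mono) (auto simp: h_def)
      finally have F: "h \<bullet> A h - q \<le> (f (x1, p) - f (x2, p)) \<bullet> h"
        by (simp add: q_def power2_eq_square inner_diff_left inner_diff_right inner_commute)
      have 1: "\<mu>1 $ i * (h \<bullet> H i h / 2 - q) - \<mu>1 $ i * \<phi> i (x2, p) \<le> \<mu>1 $ i * (G i (x1, p) \<bullet> h)" for i
      proof -
        have "\<bar>\<phi> i (x2, p) - \<phi> i (x1, p) - G i (x1, p) \<bullet> (x2 - x1) - (x2 - x1) \<bullet> H i (x2 - x1) / 2\<bar>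
            \<le> e * (norm (x2 - x1))\<^sup>2"
          using elim(2) x by blast
        then have "\<phi> i (x1, p) - \<phi> i (x2, p) + h \<bullet> H i h / 2 - q \<le> G i (x1, p) \<bullet> h"
          unfolding h' linear_neg[OF H_linear] by (simp add: q_def)
        then have "\<mu>1 $ i * (\<phi> i (x1, p) - \<phi> i (x2, p) + h \<bullet> H i h / 2 - q) \<le> \<mu>1 $ i * (G i (x1, p) \<bullet> h)"
          using multiplier_nonneg[OF m1] mult_left_mono by blast
        then show ?thesis using multiplier_complementary[OF m1, of i] by (simp add: algebra_simps)
      qed
      have 2: "\<mu>2 $ i * (h \<bullet> H i h / 2 - q) - \<mu>2 $ i * \<phi> i (x1, p) \<le> - (\<mu>2 $ i * (G i (x2, p) \<bullet> h))" for i
      proof -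
        have "\<bar>\<phi> i (x1, p) - \<phi> i (x2, p) - G i (x2, p) \<bullet> h - h \<bullet> H i h / 2\<bar> \<le> q"
          using elim(2) x unfolding h_def q_def by blast
        then have "h \<bullet> H i h / 2 - q - \<phi> i (x1, p) + \<phi> i (x2, p) \<le> - (G i (x2, p) \<bullet> h)" by linarith
        then have "\<mu>2 $ i * (h \<bullet> H i h / 2 - q - \<phi> i (x1, p) + \<phi> i (x2, p)) \<le> \<mu>2 $ i * - (G i (x2, p) \<bullet> h)"
          using multiplier_nonneg[OF m2] mult_left_mono by blast
        then show ?thesis using multiplier_complementary[OF m2, of i] by (simp add: algebra_simps)
      qed
      have "(v1 - v2) \<bullet> h = (f (x1, p) - f (x2, p)) \<bullet> h +
          (\<Sum>i\<in>UNIV. \<mu>1 $ i * (G i (x1, p) \<bullet> h) - \<mu>2 $ i * (G i (x2, p) \<bullet> h))"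
        unfolding multiplier_sum[OF m1] multiplier_sum[OF m2]
        by (simp add: inner_diff_left inner_add_left inner_sum_left sum_subtractf)
      also have "\<dots> \<ge> (h \<bullet> A h - q) + (\<Sum>i\<in>UNIV. (\<mu>1 $ i * (h \<bullet> H i h / 2 - q) - \<mu>1 $ i * \<phi> i (x2, p))
          + (\<mu>2 $ i * (h \<bullet> H i h / 2 - q) - \<mu>2 $ i * \<phi> i (x1, p)))"
        using F add_mono[OF 1 2] by (intro add_mono sum_mono) (auto simp: algebra_simps)
      also have "(\<Sum>i\<in>UNIV. (\<mu>1 $ i * (h \<bullet> H i h / 2 - q) - \<mu>1 $ i * \<phi> i (x2, p))
          + (\<mu>2 $ i * (h \<bullet> H i h / 2 - q) - \<mu>2 $ i * \<phi> i (x1, p))) =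
        (\<Sum>i\<in>UNIV. ((1/2) *\<^sub>R (\<mu>1 + \<mu>2)) $ i * (h \<bullet> H i h)) - q * (\<Sum>i\<in>UNIV. \<mu>1 $ i + \<mu>2 $ i)
        + (slack \<mu>1 x2 p + slack \<mu>2 x1 p)"
        unfolding slack_def
        unfolding sum_distrib_left sum_subtractf[symmetric] sum.distrib[symmetric]
        by (rule sum.cong) (auto simp: field_simps)
      finally show "curvature ((1/2) *\<^sub>R (\<mu>1 + \<mu>2)) (x1 - x2)
          - e * (1 + (\<Sum>i\<in>UNIV. \<mu>1 $ i + \<mu>2 $ i)) * (norm (x1 - x2))\<^sup>2
          + slack \<mu>1 x2 p + slack \<mu>2 x1 p \<le> (v1 - v2) \<bullet> (x1 - x2)"
        unfolding curvature_def
        unfolding h_def[symmetric] by (simp add: q_def algebra_simps)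
    qed
  qed
qed

text \<open>The core of strong monotonicity. Divide the quadratic lower bound by \<open>|X k - Y k|\<^sup>2\<close>: since the slack is
nonnegative, the curvature of the mean multiplier at the limit direction \<open>u\<close> is at most \<open>0\<close>, and the slack is
\<open>O(|X k - Y k|\<^sup>2)\<close>. A constraint with positive limiting multiplier vanishes at one of the two points and
is therefore of second order at the other, which makes \<open>u\<close> orthogonal to its gradient.\<close>

lemma no_degenerate_sequence:
  assumes sosc: strong_second_order
    and lim: "X \<longlonglongrightarrow> xb" "Y \<longlonglongrightarrow> xb" "P \<longlonglongrightarrow> pb" "V \<longlonglongrightarrow> vb" "W \<longlonglongrightarrow> vb" "M \<longlonglongrightarrow> \<mu>" "N \<longlonglongrightarrow> \<nu>"
    and near: "\<And>k. near (X k) (P k)" "\<And>k. near (Y k) (P k)"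
    and m: "\<And>k. multiplier (X k) (P k) (V k) (M k)" "\<And>k. multiplier (Y k) (P k) (W k) (N k)"
    and feas: "\<And>k i. 0 < M k $ i \<Longrightarrow> \<phi> i (Y k, P k) \<le> 0" "\<And>k i. 0 < N k $ i \<Longrightarrow> \<phi> i (X k, P k) \<le> 0"
    and neq: "\<And>k. X k \<noteq> Y k"
    and u: "(\<lambda>k. (X k - Y k) /\<^sub>R norm (X k - Y k)) \<longlonglongrightarrow> u"
    and c: "\<And>k. (V k - W k) \<bullet> (X k - Y k) \<le> c k * (norm (X k - Y k))\<^sup>2" "c \<longlonglongrightarrow> 0"
  shows False
proof -
  define n where "n k = norm (X k - Y k)" for k
  define U where "U k = (X k - Y k) /\<^sub>R n k" for k
  have n: "0 < n k" for k using neq by (simp add: n_def)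
  have h: "X k - Y k = n k *\<^sub>R U k" for k using n[of k] by (simp add: U_def)
  have U: "U \<longlonglongrightarrow> u" using u unfolding U_def[abs_def] n_def .
  have n0: "n \<longlonglongrightarrow> 0" unfolding n_def[abs_def] using tendsto_norm[OF tendsto_diff[OF lim(1,2)]] by simp
  have "norm (U k) = 1" for k using n[of k] by (simp add: U_def n_def)
  then have "norm u = 1" using tendsto_norm[OF U] by (simp add: LIMSEQ_const_iff)
  then have u_nz: "u \<noteq> 0" by auto
  have M: "(\<lambda>k. M k $ i) \<longlonglongrightarrow> \<mu> $ i" and N: "(\<lambda>k. N k $ i) \<longlonglongrightarrow> \<nu> $ i" for i
    using lim by (auto intro: tendsto_vec_nth)
  have \<mu>: "multiplier xb pb vb \<mu>" and \<nu>: "multiplier xb pb vb \<nu>"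
    using multiplier_limit m near lim near_base by metis+
  \<comment> \<open>The mean of the two limits is the multiplier at which the second-order condition is applied.\<close>
  define \<xi> where "\<xi> = (1/2) *\<^sub>R \<mu> + (1/2) *\<^sub>R \<nu>"
  have \<xi>: "multiplier xb pb vb \<xi>"
    using normal_multiplier_combination[OF \<mu>[unfolded multiplier_def] \<nu>[unfolded multiplier_def], of "1/2" "1/2"]
    by (simp add: multiplier_def \<xi>_def flip: scaleR_left_distrib)
  define Q where "Q k = curvature ((1/2) *\<^sub>R (M k + N k)) (U k)" for k
  define T where "T k = 1 + (\<Sum>i\<in>UNIV. M k $ i + N k $ i)" for k
  define S where "S k = slack (M k) (Y k) (P k) + slack (N k) (X k) (P k)" for k
  have terms: "0 \<le> - (M k $ i * \<phi> i (Y k, P k))" "0 \<le> - (N k $ i * \<phi> i (X k, P k))" for k i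
    using feas[where k=k and i=i] multiplier_nonneg[OF m(1), of k i] multiplier_nonneg[OF m(2), of k i]
    by (cases "M k $ i = 0"; cases "N k $ i = 0"; simp add: mult_nonneg_nonpos)+
  have slack_nn: "0 \<le> slack (M k) (Y k) (P k)" "0 \<le> slack (N k) (X k) (P k)" for k
    unfolding slack_def using terms by (auto intro: sum_nonneg)
  then have S_nn: "0 \<le> S k" for k by (simp add: S_def)
  have S_ge: "- (M k $ i * \<phi> i (Y k, P k)) \<le> S k" "- (N k $ i * \<phi> i (X k, P k)) \<le> S k" for k i
  proof -
    have "- (M k $ i * \<phi> i (Y k, P k)) \<le> slack (M k) (Y k) (P k)"
      "- (N k $ i * \<phi> i (X k, P k)) \<le> slack (N k) (X k) (P k)"
      unfolding slack_def using terms
      by (intro member_le_sum[of i UNIV "\<lambda>i. - (M k $ i * \<phi> i (Y k, P k))"]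
          member_le_sum[of i UNIV "\<lambda>i. - (N k $ i * \<phi> i (X k, P k))"]; simp)+
    then show "- (M k $ i * \<phi> i (Y k, P k)) \<le> S k" "- (N k $ i * \<phi> i (X k, P k)) \<le> S k"
      using slack_nn[of k] by (simp_all add: S_def)
  qed
  have main: "\<forall>\<^sub>F k in sequentially. Q k - e * T k + S k / (n k)\<^sup>2 \<le> c k" if e: "0 < e" for e
    using eventually_along_balls[OF quadratic_lower_bound[OF e] lim(1-3)]
  proof eventually_elim
    case (elim k)
    have "curvature ((1/2) *\<^sub>R (M k + N k)) (X k - Y k) - e * T k * (norm (X k - Y k))\<^sup>2 + S k
        \<le> (V k - W k) \<bullet> (X k - Y k)"
      using elim[rule_format, OF m] by (simp add: T_def S_def add.assoc)
    also have "\<dots> \<le> c k * (norm (X k - Y k))\<^sup>2" by (rule c(1))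
    finally have "S k \<le> (c k - (Q k - e * T k)) * (n k)\<^sup>2"
      unfolding n_def[symmetric] unfolding h curvature_scaleR Q_def by (simp add: algebra_simps)
    then have "S k / (n k)\<^sup>2 \<le> c k - (Q k - e * T k)" using n[of k] by (simp add: pos_divide_le_eq)
    then show ?case by linarith
  qed
  define q where "q = curvature \<xi> u"
  have Q: "Q \<longlonglongrightarrow> q"
  proof -
    have "(\<lambda>k. (1/2) *\<^sub>R (M k + N k)) \<longlonglongrightarrow> (1/2) *\<^sub>R (\<mu> + \<nu>)" by (intro tendsto_intros lim)
    then show ?thesis
      unfolding Q_def[abs_def] q_def \<xi>_def scaleR_add_right[symmetric] by (rule tendsto_curvature[OF _ U])
  qed
  define t where "t = 1 + (\<Sum>i\<in>UNIV. \<mu> $ i + \<nu> $ i)"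
  have T: "T \<longlonglongrightarrow> t" unfolding T_def[abs_def] t_def by (intro tendsto_intros M N)
  have "q \<le> 0"
  proof -
    have "q \<le> e * t" if e: "0 < e" for e
    proof (rule tendsto_le[OF sequentially_bot])
      show "(\<lambda>k. c k + e * T k) \<longlonglongrightarrow> e * t" using tendsto_add[OF c(2) tendsto_mult_left[OF T, of e]] by simp
      show "Q \<longlonglongrightarrow> q" by fact
      show "\<forall>\<^sub>F k in sequentially. Q k \<le> c k + e * T k"
        using main[OF e]
      proof eventually_elim
        case (elim k)
        have "0 \<le> S k / (n k)\<^sup>2" using S_nn by simp
        then show ?case using elim by linarith
      qed
    qed
    moreover have "0 < t"
      using multiplier_nonneg[OF \<mu>] multiplier_nonneg[OF \<nu>]
      unfolding t_def by (intro add_pos_nonneg sum_nonneg add_nonneg_nonneg) auto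
    ultimately have "q \<le> 0 + e" if "0 < e" for e
      using that by (metis add_0 divide_pos_pos nonzero_eq_divide_eq less_irrefl)
    then show ?thesis by (rule field_le_epsilon)
  qed
  define C where "C = 0 - q + t + 1"
  have S_le: "\<forall>\<^sub>F k in sequentially. S k \<le> C * (n k)\<^sup>2"
  proof -
    have "(\<lambda>k. c k - Q k + T k) \<longlonglongrightarrow> 0 - q + t" by (intro tendsto_intros c Q T)
    then have "\<forall>\<^sub>F k in sequentially. c k - Q k + T k < C" by (rule order_tendstoD) (simp add: C_def)
    with main[OF zero_less_one] show ?thesis
    proof eventually_elim
      case (elim k)
      then have "S k / (n k)\<^sup>2 \<le> C" by linarith
      then show ?case using n[of k] by (simp add: field_simps)
    qed
  qed
  have orth: "G i (xb, pb) \<bullet> u = 0"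
    if ev: "\<forall>\<^sub>F k in sequentially. \<bar>\<phi> i (X k, P k) - \<phi> i (Y k, P k)\<bar> \<le> C' * (n k)\<^sup>2" for i C'
  proof -
    have "\<bar>G i (xb, pb) \<bullet> u\<bar> \<le> 0 + e" if e: "0 < e" for e
    proof (rule tendsto_le[OF sequentially_bot])
      show "(\<lambda>k. C' * n k + e) \<longlonglongrightarrow> 0 + e" using tendsto_add[OF tendsto_mult_left[OF n0, of C'] tendsto_const] by simp
      show "(\<lambda>k. \<bar>G i (xb, pb) \<bullet> U k\<bar>) \<longlonglongrightarrow> \<bar>G i (xb, pb) \<bullet> u\<bar>" by (intro tendsto_intros U)
      show "\<forall>\<^sub>F k in sequentially. \<bar>G i (xb, pb) \<bullet> U k\<bar> \<le> C' * n k + e"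
        using ev eventually_along_balls[OF strict_first_order_expansion[OF e, of i] lim(2,1,3)]
      proof eventually_elim
        case (elim k)
        then have "\<bar>\<phi> i (X k, P k) - \<phi> i (Y k, P k) - G i (xb, pb) \<bullet> (X k - Y k)\<bar> \<le> e * n k"
          by (simp add: n_def)
        then have "\<bar>G i (xb, pb) \<bullet> (X k - Y k)\<bar> \<le> C' * (n k)\<^sup>2 + e * n k" using elim by linarith
        then have "n k * \<bar>G i (xb, pb) \<bullet> U k\<bar> \<le> n k * (C' * n k + e)"
          unfolding h using n[of k] by (simp add: abs_mult power2_eq_square algebra_simps)
        then show ?case using n[of k] by simp
      qed
    qed
    then have "\<bar>G i (xb, pb) \<bullet> u\<bar> \<le> 0" by (rule field_le_epsilon)
    then show ?thesis by simp
  qed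
  \<comment> \<open>\<open>Z\<close> stands for the \<open>i\<close>-th component of either multiplier sequence.\<close>
  have vanish: "G i (xb, pb) \<bullet> u = 0"
    if Z: "Z \<longlonglongrightarrow> a" "0 < a" and Z_pos: "\<And>k. 0 < Z k \<Longrightarrow> Z k * \<bar>\<phi> i (X k, P k) - \<phi> i (Y k, P k)\<bar> \<le> S k" for i Z a
  proof -
    have "\<forall>\<^sub>F k in sequentially. a / 2 < Z k" using Z by (intro order_tendstoD[OF Z(1)]) simp
    then have "\<forall>\<^sub>F k in sequentially. \<bar>\<phi> i (X k, P k) - \<phi> i (Y k, P k)\<bar> \<le> (2 * C / a) * (n k)\<^sup>2"
      using S_le
    proof eventually_elim
      case (elim k)
      have "a / 2 * \<bar>\<phi> i (X k, P k) - \<phi> i (Y k, P k)\<bar> \<le> Z k * \<bar>\<phi> i (X k, P k) - \<phi> i (Y k, P k)\<bar>"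
        using elim by (intro mult_right_mono) auto
      also have "\<dots> \<le> C * (n k)\<^sup>2" using Z_pos[of k] elim Z(2) by auto
      finally show ?case using Z(2) by (simp add: field_simps)
    qed
    then show ?thesis by (rule orth)
  qed
  have "G i (xb, pb) \<bullet> u = 0" if "0 < \<xi> $ i" for i
  proof -
    have "0 < \<mu> $ i \<or> 0 < \<nu> $ i" using that by (auto simp: \<xi>_def)
    then show ?thesis
    proof
      assume "0 < \<mu> $ i"
      then show ?thesis
      proof (rule vanish[OF M])
        fix k assume "0 < M k $ i"
        then show "M k $ i * \<bar>\<phi> i (X k, P k) - \<phi> i (Y k, P k)\<bar> \<le> S k"
          using multiplier_complementary[OF m(1), of k i] feas(1)[of k i] S_ge(1)[of k i] by auto
      qed
    next
      assume "0 < \<nu> $ i"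
      then show ?thesis
      proof (rule vanish[OF N])
        fix k assume "0 < N k $ i"
        then show "N k $ i * \<bar>\<phi> i (X k, P k) - \<phi> i (Y k, P k)\<bar> \<le> S k"
          using multiplier_complementary[OF m(2), of k i] feas(2)[of k i] S_ge(2)[of k i] by auto
      qed
    qed
  qed
  then have "0 < q" using sosc \<xi> u_nz unfolding strong_second_order_def q_def by blast
  then show False using \<open>q \<le> 0\<close> by simp
qed

text \<open>The points need not be solutions: the Lipschitz estimate in the parameter compares a solution with a point that may
violate the constraints without positive multiplier.\<close>

definition monotone_with :: "real \<Rightarrow> real \<Rightarrow> bool" where
  "monotone_with \<kappa> \<delta> \<longleftrightarrow> (\<forall>p\<in>ball pb \<delta>. \<forall>x1\<in>ball xb \<delta>. \<forall>x2\<in>ball xb \<delta>. \<forall>v1\<in>ball vb \<delta>. \<forall>v2\<in>ball vb \<delta>.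
     \<forall>\<mu>1 \<mu>2. multiplier x1 p v1 \<mu>1 \<longrightarrow> multiplier x2 p v2 \<mu>2 \<longrightarrow>
       (\<forall>i. 0 < \<mu>1 $ i \<longrightarrow> \<phi> i (x2, p) \<le> 0) \<longrightarrow> (\<forall>i. 0 < \<mu>2 $ i \<longrightarrow> \<phi> i (x1, p) \<le> 0) \<longrightarrow>
       \<kappa> * (norm (x1 - x2))\<^sup>2 \<le> (v1 - v2) \<bullet> (x1 - x2))"

proposition strong_monotonicity:
  assumes strong_second_order
  shows "\<exists>\<kappa> \<delta>. 0 < \<kappa> \<and> 0 < \<delta> \<and> monotone_with \<kappa> \<delta>"
proof (rule ccontr)
  assume "\<not> ?thesis"
  then have neg: "\<not> monotone_with (1 / Suc k) (min r (1 / Suc k))" for k :: nat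
    using r_pos by (metis divide_pos_pos min_less_iff_conj of_nat_0_less_iff zero_less_Suc zero_less_one)
  define B where "B k = min r (1 / real (Suc k))" for k
  have "\<forall>k. \<exists>P X Y V W M N. P \<in> ball pb (B k) \<and> X \<in> ball xb (B k) \<and> Y \<in> ball xb (B k) \<and>
     V \<in> ball vb (B k) \<and> W \<in> ball vb (B k) \<and> multiplier X P V M \<and> multiplier Y P W N \<and>
     (\<forall>i. 0 < M $ i \<longrightarrow> \<phi> i (Y, P) \<le> 0) \<and> (\<forall>i. 0 < N $ i \<longrightarrow> \<phi> i (X, P) \<le> 0) \<and>
     (V - W) \<bullet> (X - Y) < 1 / Suc k * (norm (X - Y))\<^sup>2"
    using neg unfolding monotone_with_def B_def not_le[symmetric] by blast
  then obtain P X Y V W M N where seq: "\<And>k. P k \<in> ball pb (B k)" "\<And>k. X k \<in> ball xb (B k)"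
      "\<And>k. Y k \<in> ball xb (B k)" "\<And>k. V k \<in> ball vb (B k)" "\<And>k. W k \<in> ball vb (B k)"
    and m: "\<And>k. multiplier (X k) (P k) (V k) (M k)" "\<And>k. multiplier (Y k) (P k) (W k) (N k)"
    and feas: "\<And>k i. 0 < M k $ i \<Longrightarrow> \<phi> i (Y k, P k) \<le> 0" "\<And>k i. 0 < N k $ i \<Longrightarrow> \<phi> i (X k, P k) \<le> 0"
    and bad: "\<And>k. (V k - W k) \<bullet> (X k - Y k) < 1 / Suc k * (norm (X k - Y k))\<^sup>2"
    by metis
  have B0: "B \<longlonglongrightarrow> 0"
  proof (rule tendsto_sandwich[OF _ _ tendsto_const LIMSEQ_inverse_real_of_nat])
    show "\<forall>\<^sub>F k in sequentially. 0 \<le> B k" using r_pos by (simp add: B_def)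
    show "\<forall>\<^sub>F k in sequentially. B k \<le> inverse (real (Suc k))" by (simp add: B_def inverse_eq_divide)
  qed
  have lim0: "Z \<longlonglongrightarrow> z" if "\<And>k. Z k \<in> ball z (B k)" for Z and z :: "'x::metric_space"
    using that by (intro metric_tendsto_imp_tendsto[OF B0]) (auto simp: dist_commute dist_real_def less_imp_le eventually_sequentially intro!: order_trans[OF less_imp_le abs_ge_self])
  have near: "near (X k) (P k)" "near (Y k) (P k)" for k
    using seq[of k] by (auto simp: B_def)
  have neq: "X k \<noteq> Y k" for k using bad[of k] by auto
  define U where "U k = (X k - Y k) /\<^sub>R norm (X k - Y k)" for k
  have nU: "norm (U k) = 1" for k using neq by (simp add: U_def)
  have bounded_mult: "bounded (range Z)" if "\<And>k. near (F k) (P k)" "\<And>k. multiplier (F k) (P k) (v k) (Z k)"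
    "\<And>k. v k \<in> ball vb (B k)" for F v Z
  proof -
    have "norm (v k - vb) \<le> r" for k using that(3)[of k] by (simp add: B_def dist_norm norm_minus_commute)
    then show ?thesis unfolding bounded_iff using multiplier_bound(2)[OF that(2,1)] by blast
  qed
  have bM: "bounded (range M)" by (rule bounded_mult[OF near(1) m(1) seq(4)])
  have bN: "bounded (range N)" by (rule bounded_mult[OF near(2) m(2) seq(5)])
  have bU: "bounded (range U)" unfolding bounded_iff using nU by (auto intro!: exI[of _ 1])
  have "bounded (range (\<lambda>k. (M k, N k, U k)))"
    by (rule bounded_subset[OF bounded_Times[OF bM bounded_Times[OF bN bU]]]) auto
  then obtain l s where s: "strict_mono s" "((\<lambda>k. (M k, N k, U k)) \<circ> s) \<longlonglongrightarrow> l"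
    using bounded_imp_convergent_subsequence by blast
  have l: "(\<lambda>k. M (s k)) \<longlonglongrightarrow> fst l" "(\<lambda>k. N (s k)) \<longlonglongrightarrow> fst (snd l)" "(\<lambda>k. U (s k)) \<longlonglongrightarrow> snd (snd l)"
    using tendsto_fst[OF s(2)] tendsto_fst[OF tendsto_snd[OF s(2)]] tendsto_snd[OF tendsto_snd[OF s(2)]]
    by (simp_all add: comp_def)
  have sub: "(\<lambda>k. Z (s k)) \<longlonglongrightarrow> z" if "Z \<longlonglongrightarrow> z" for Z and z :: "'x::topological_space"
    using LIMSEQ_subseq_LIMSEQ[OF that s(1)] by (simp add: comp_def)
  show False
  proof (rule no_degenerate_sequence[OF assms, of "\<lambda>k. X (s k)" "\<lambda>k. Y (s k)" "\<lambda>k. P (s k)"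
        "\<lambda>k. V (s k)" "\<lambda>k. W (s k)" "\<lambda>k. M (s k)" _ "\<lambda>k. N (s k)" _ _ "\<lambda>k. inverse (real (Suc (s k)))"])
    show "(\<lambda>k. X (s k)) \<longlonglongrightarrow> xb" "(\<lambda>k. Y (s k)) \<longlonglongrightarrow> xb" "(\<lambda>k. P (s k)) \<longlonglongrightarrow> pb"
      "(\<lambda>k. V (s k)) \<longlonglongrightarrow> vb" "(\<lambda>k. W (s k)) \<longlonglongrightarrow> vb"
      by (rule sub, rule lim0, rule seq)+
    show "(\<lambda>k. inverse (real (Suc (s k)))) \<longlonglongrightarrow> 0" by (rule sub[OF LIMSEQ_inverse_real_of_nat])
    show "(\<lambda>k. (X (s k) - Y (s k)) /\<^sub>R norm (X (s k) - Y (s k))) \<longlonglongrightarrow> snd (snd l)"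
      using l(3) by (simp add: U_def)
    show "(V (s k) - W (s k)) \<bullet> (X (s k) - Y (s k)) \<le> inverse (real (Suc (s k))) * (norm (X (s k) - Y (s k)))\<^sup>2" for k
      using bad[of "s k"] by (simp add: inverse_eq_divide)
  qed (use l near m feas neq in auto)
qed

end

section \<open>Correction onto active constraints and proximal points\<close>

context parametric_constraints
begin

text \<open>A Newton iteration with the derivative frozen at the base point. With vectors \<open>e j\<close> dual to the gradients, the map
\<open>y \<mapsto> y - \<phi>\<^sub>J (x + \<Sum>\<^sub>j y\<^sub>j e\<^sub>j, p)\<close> has Lipschitz constant \<open>1/2\<close> by strict
differentiability, and its fixed point is of the size of the residual at \<open>0\<close>.\<close>

lemma correction_to_active_manifold:
  assumes J: "family_independent (\<lambda>i. G i (xb, pb)) J" "\<And>i. i \<in> J \<Longrightarrow> \<phi> i (xb, pb) = 0"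
  shows "\<exists>c>0. \<forall>\<^sub>F \<delta> in at_right 0. \<forall>x\<in>ball xb \<delta>. \<forall>p\<in>ball pb \<delta>.
    \<exists>x'. (\<forall>i\<in>J. \<phi> i (x', p) = 0) \<and> norm (x' - x) \<le> c * (\<Sum>i\<in>J. \<bar>\<phi> i (x, p)\<bar>)"
proof -
  obtain e where e: "\<And>i j. i \<in> J \<Longrightarrow> j \<in> J \<Longrightarrow> G i (xb, pb) \<bullet> e j = (if i = j then 1 else 0)"
    using family_independent_dual[OF J(1)] by blast
  define E where "E y = (\<Sum>j\<in>J. (y $ j) *\<^sub>R e j)" for y :: "real^'m"
  have E_lin: "linear E"
    by (rule linearI) (simp_all add: E_def scaleR_add_left sum.distrib scaleR_right.sum)
  define B where "B = (\<Sum>j\<in>J. norm (e j)) + 1"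
  have B: "1 \<le> B" by (simp add: B_def sum_nonneg)
  have E_norm: "norm (E y) \<le> B * norm y" for y
  proof -
    have "norm (E y) \<le> (\<Sum>j\<in>J. norm ((y $ j) *\<^sub>R e j))" unfolding E_def by (rule norm_sum)
    also have "\<dots> \<le> (\<Sum>j\<in>J. norm (e j) * norm y)"
      by (rule sum_mono) (metis component_le_norm_cart mult.commute mult_left_mono norm_ge_zero norm_scaleR)
    also have "\<dots> \<le> B * norm y" by (simp add: B_def sum_distrib_right distrib_right)
    finally show ?thesis .
  qed
  have GE: "G j (xb, pb) \<bullet> E y = y $ j" if "j \<in> J" for j y
  proof -
    have "G j (xb, pb) \<bullet> E y = (\<Sum>k\<in>J. if j = k then y $ k else 0)"
      unfolding E_def inner_sum_right using e that by (intro sum.cong) auto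
    then show ?thesis using that by simp
  qed
  define m where "m = real CARD('m)"
  have m: "1 \<le> m" by (simp add: m_def Suc_leI)
  define \<epsilon> where "\<epsilon> = 1 / (2 * m * B)"
  have \<epsilon>: "0 < \<epsilon>" "m * (\<epsilon> * B) = 1/2" using m B by (auto simp: \<epsilon>_def)
  have "\<forall>\<^sub>F \<delta> in at_right 0. \<forall>i. \<forall>x\<in>ball xb \<delta>. \<forall>x'\<in>ball xb \<delta>. \<forall>p\<in>ball pb \<delta>.
     \<bar>\<phi> i (x', p) - \<phi> i (x, p) - G i (xb, pb) \<bullet> (x' - x)\<bar> \<le> \<epsilon> * norm (x' - x)"
    by (intro eventually_all_finite strict_first_order_expansion \<epsilon>)
  then obtain \<delta>0 where \<delta>0: "0 < \<delta>0" "\<And>i x x' p. x\<in>ball xb \<delta>0 \<Longrightarrow> x'\<in>ball xb \<delta>0 \<Longrightarrow> p\<in>ball pb \<delta>0 \<Longrightarrow>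
     \<bar>\<phi> i (x', p) - \<phi> i (x, p) - G i (xb, pb) \<bullet> (x' - x)\<bar> \<le> \<epsilon> * norm (x' - x)"
    by (rule eventually_at_right_witness) blast
  define \<delta>1 where "\<delta>1 = min (min r (\<delta>0 / 2)) (\<delta>0 / (8 * B * m * K))"
  have \<delta>1: "0 < \<delta>1" using \<delta>0 r_pos B m K_pos by (simp add: \<delta>1_def)
  show ?thesis
  proof (intro exI[of _ "2 * B"] conjI eventually_at_rightI[of 0 \<delta>1] ballI)
    show "0 < 2 * B" "0 < \<delta>1" using B \<delta>1 by auto
    fix \<delta> x p assume \<delta>: "\<delta> \<in> {0<..<\<delta>1}" and x: "x \<in> ball xb \<delta>" and p: "p \<in> ball pb \<delta>"
    have \<delta>': "\<delta> < r" "\<delta> < \<delta>0 / 2" "8 * B * m * K * \<delta> < \<delta>0"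
      using \<delta> B m K_pos by (auto simp: \<delta>1_def field_simps)
    define R where "R = (\<Sum>i\<in>J. \<bar>\<phi> i (x, p)\<bar>)"
    have "R \<le> (\<Sum>i\<in>J. K * (\<delta> + \<delta>))"
      unfolding R_def
    proof (rule sum_mono)
      fix i assume "i \<in> J"
      then have "\<bar>\<phi> i (x, p)\<bar> = \<bar>\<phi> i (x, p) - \<phi> i (xb, pb)\<bar>" using J by simp
      also have "\<dots> \<le> K * (norm (x - xb) + norm (p - pb))"
        using \<phi>_lip[of x p xb pb i] x p \<delta>'(1) r_pos by auto
      also have "\<dots> \<le> K * (\<delta> + \<delta>)"
        using x p K_pos by (intro mult_left_mono add_mono) (auto simp: dist_norm norm_minus_commute)
      finally show "\<bar>\<phi> i (x, p)\<bar> \<le> K * (\<delta> + \<delta>)" .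
    qed
    also have "\<dots> = real (card J) * (K * (\<delta> + \<delta>))" by simp
    also have "\<dots> \<le> m * (K * (\<delta> + \<delta>))"
      using K_pos \<delta> unfolding m_def by (intro mult_right_mono) (auto intro: card_mono)
    finally have "R \<le> 2 * (m * K * \<delta>)" by (simp add: algebra_simps)
    then have "2 * B * R \<le> 2 * B * (2 * (m * K * \<delta>))" using B by (intro mult_left_mono) auto
    then have BR: "2 * B * R < \<delta>0 / 2" using \<delta>'(3) by (simp add: algebra_simps)
    have R0: "0 \<le> R" by (simp add: R_def sum_nonneg)
    have E_2R: "norm (E y) \<le> 2 * B * R" if "y \<in> cball 0 (2 * R)" for y
    proof -
      have "B * norm y \<le> B * (2 * R)" using that B by (intro mult_left_mono) auto
      then show ?thesis using E_norm[of y] by simp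
    qed
    have in_ball: "x + E y \<in> ball xb \<delta>0" if y: "y \<in> cball 0 (2 * R)" for y
    proof -
      have "norm (E y) < \<delta>0 / 2" using E_2R[OF y] BR by linarith
      moreover have "norm (x - xb) < \<delta>0 / 2" using x \<delta>'(2) by (simp add: dist_norm norm_minus_commute)
      ultimately have "norm ((x - xb) + E y) < \<delta>0" using norm_triangle_ineq[of "x - xb" "E y"] by linarith
      then show ?thesis by (simp add: dist_norm norm_minus_commute algebra_simps)
    qed
    have p0: "p \<in> ball pb \<delta>0" using p \<delta>'(2) \<delta>0 by auto
    define F where "F y = (\<chi> j. if j \<in> J then y $ j - \<phi> j (x + E y, p) else 0)" for y :: "real^'m"
    have F_lip: "norm (F y - F y') \<le> 1/2 * norm (y - y')"
      if y: "y \<in> cball 0 (2 * R)" "y' \<in> cball 0 (2 * R)" for y y'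
    proof -
      have comp: "\<bar>(F y - F y') $ j\<bar> \<le> \<epsilon> * (B * norm (y - y'))" for j
      proof (cases "j \<in> J")
        case True
        have eq: "(x + E y) - (x + E y') = E (y - y')" by (simp add: linear_diff[OF E_lin])
        have "\<bar>\<phi> j (x + E y, p) - \<phi> j (x + E y', p) - G j (xb, pb) \<bullet> ((x + E y) - (x + E y'))\<bar>
            \<le> \<epsilon> * norm ((x + E y) - (x + E y'))"
          using \<delta>0(2) in_ball y p0 by blast
        then have "\<bar>(F y - F y') $ j\<bar> \<le> \<epsilon> * norm (E (y - y'))"
          unfolding eq GE[OF True] using True by (simp add: F_def)
        also have "\<dots> \<le> \<epsilon> * (B * norm (y - y'))" using E_norm \<epsilon> by (intro mult_left_mono) auto
        finally show ?thesis .
      qed (use \<epsilon> B in \<open>simp add: F_def\<close>)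
      have "norm (F y - F y') \<le> (\<Sum>j\<in>UNIV. \<bar>(F y - F y') $ j\<bar>)" by (rule norm_le_l1_cart)
      also have "\<dots> \<le> (\<Sum>j\<in>(UNIV::'m set). \<epsilon> * (B * norm (y - y')))" by (rule sum_mono) (rule comp)
      also have "\<dots> = (m * (\<epsilon> * B)) * norm (y - y')" by (simp add: m_def)
      finally show ?thesis unfolding \<epsilon>(2) .
    qed
    have F0: "norm (F 0) \<le> R"
    proof -
      have "norm (F 0) \<le> (\<Sum>j\<in>UNIV. \<bar>F 0 $ j\<bar>)" by (rule norm_le_l1_cart)
      also have "\<dots> = (\<Sum>j\<in>J. \<bar>F 0 $ j\<bar>)" by (rule sum.mono_neutral_right) (auto simp: F_def)
      also have "\<dots> = R" unfolding R_def by (rule sum.cong) (auto simp: F_def E_def)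
      finally show ?thesis .
    qed
    have "\<exists>!y\<in>cball 0 (2 * R). F y = y"
    proof (rule Banach_fix)
      show "complete (cball (0::real^'m) (2 * R))" "cball (0::real^'m) (2 * R) \<noteq> {}"
        using R0 by (auto simp: complete_eq_closed)
      show "0 \<le> (1/2::real)" "(1/2::real) < 1" by auto
      show "F ` cball 0 (2 * R) \<subseteq> cball 0 (2 * R)"
      proof (intro image_subsetI)
        fix y :: "real^'m" assume y: "y \<in> cball 0 (2 * R)"
        have "norm (F y) \<le> norm (F 0) + norm (F y - F 0)" by (rule norm_triangle_sub)
        also have "\<dots> \<le> R + 1/2 * norm y" using F0 F_lip[OF y, of 0] R0 by simp
        also have "\<dots> \<le> 2 * R" using y by simp
        finally show "F y \<in> cball 0 (2 * R)" by simp
      qed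
      show "dist (F y) (F y') \<le> 1/2 * dist y y'" if "y \<in> cball 0 (2 * R)" "y' \<in> cball 0 (2 * R)" for y y'
        using F_lip[OF that] by (simp add: dist_norm)
    qed
    then obtain y where y: "y \<in> cball 0 (2 * R)" "F y = y" by blast
    have "\<phi> j (x + E y, p) = 0" if "j \<in> J" for j
      using arg_cong[OF y(2), of "\<lambda>z. z $ j"] that by (simp add: F_def)
    moreover have "norm (x + E y - x) \<le> 2 * B * R"
      using E_2R[OF y(1)] by simp
    ultimately show "\<exists>x'. (\<forall>i\<in>J. \<phi> i (x', p) = 0) \<and> norm (x' - x) \<le> 2 * B * (\<Sum>i\<in>J. \<bar>\<phi> i (x, p)\<bar>)"
      unfolding R_def by blast
  qed
qed

text \<open>\<open>b \<in> \<rho> x + N(x)\<close>, the optimality condition for \<open>x\<close> to be the point of the feasible set nearest to \<open>b / \<rho>\<close>.\<close>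

definition proximal_solution :: "real \<Rightarrow> 'b \<Rightarrow> 'a \<Rightarrow> 'a \<Rightarrow> bool" where
  "proximal_solution \<rho> p x b \<longleftrightarrow> feasible x p \<and> (\<exists>\<mu>. normal_multiplier x p \<mu> (b - \<rho> *\<^sub>R x))"

text \<open>For large \<open>\<rho>\<close> the curvature of the constraints is dominated, so \<open>xb\<close> is the strict local projection of
\<open>a0 = xb + w / \<rho>\<close>. Nearest points in a small ball, for nearby data, then avoid its boundary, and their
residual is a regular normal.\<close>

lemma proximal_solvability:
  assumes nb: "normal_multiplier xb pb \<mu> w" and \<rho>: "4 * K * (\<Sum>i\<in>UNIV. \<mu> $ i) + 1 \<le> \<rho>"
  shows "locally_solvable (proximal_solution \<rho>) pb (w + \<rho> *\<^sub>R xb) xb"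
  unfolding locally_solvable_def
proof (intro allI impI)
  fix \<epsilon> :: real assume \<epsilon>: "0 < \<epsilon>"
  have \<mu>_nn: "0 \<le> \<mu> $ i" for i using nb by (simp add: normal_multiplier_def)
  have "0 \<le> 4 * K * (\<Sum>i\<in>UNIV. \<mu> $ i)" using K_pos \<mu>_nn by (intro mult_nonneg_nonneg sum_nonneg) auto
  then have \<rho>1: "1 \<le> \<rho>" using \<rho> by linarith
  define \<epsilon>' where "\<epsilon>' = min \<epsilon> r / 2"
  have \<epsilon>': "0 < \<epsilon>'" "\<epsilon>' < \<epsilon>" "\<epsilon>' < r" using \<epsilon> r_pos by (auto simp: \<epsilon>'_def)
  define a0 where "a0 = xb + w /\<^sub>R \<rho>"
  define D where "D = norm (xb - a0)"
  \<comment> \<open>For nearby parameters, feasible points at distance \<open>\<epsilon>'\<close> from \<open>xb\<close> are farther from \<open>a0\<close> than \<open>xb\<close>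
     by at least this much.\<close>
  define gap where "gap = sqrt (D\<^sup>2 + \<epsilon>'\<^sup>2 / 4) - D"
  have D: "0 \<le> D" by (simp add: D_def)
  have gap: "0 < gap"
  proof -
    have "sqrt (D\<^sup>2) < sqrt (D\<^sup>2 + \<epsilon>'\<^sup>2 / 4)" using \<epsilon>' by (intro real_sqrt_less_mono) simp
    then show ?thesis using D by (simp add: gap_def)
  qed
  have far: "D + gap \<le> norm (x - a0)"
    if x: "norm (x - xb) = \<epsilon>'" and f: "feasible x p" and p: "p \<in> ball pb r" "norm (p - pb) \<le> \<epsilon>'\<^sup>2 / 2" for x p
  proof -
    have xr: "x \<in> ball xb r" using x \<epsilon>' by (simp add: dist_norm norm_minus_commute)
    have "\<mu> $ i * (G i (xb, pb) \<bullet> (x - xb)) \<le> \<mu> $ i * (K * (norm (p - pb) + \<epsilon>'\<^sup>2))" for i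
    proof (cases "\<mu> $ i = 0")
      case False
      then have "\<phi> i (xb, pb) = 0" using nb by (auto simp: normal_multiplier_def)
      then have "G i (xb, pb) \<bullet> (x - xb) \<le> \<phi> i (x, pb) + K * \<epsilon>'\<^sup>2"
        using first_order_expansion[of xb x pb i] xr r_pos x by simp
      moreover have "\<phi> i (x, pb) \<le> \<phi> i (x, p) + K * norm (p - pb)"
        using \<phi>_lip[of x p x pb i] xr p r_pos by simp
      moreover have "\<phi> i (x, p) \<le> 0" using f by (simp add: feasible_def)
      ultimately have "G i (xb, pb) \<bullet> (x - xb) \<le> K * (norm (p - pb) + \<epsilon>'\<^sup>2)" by (simp add: algebra_simps)
      then show ?thesis using \<mu>_nn by (intro mult_left_mono)
    qed simp
    then have "(\<Sum>i\<in>UNIV. \<mu> $ i * (G i (xb, pb) \<bullet> (x - xb))) \<le> (\<Sum>i\<in>UNIV. \<mu> $ i * (K * (norm (p - pb) + \<epsilon>'\<^sup>2)))"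
      by (intro sum_mono) auto
    then have "w \<bullet> (x - xb) \<le> (K * (\<Sum>i\<in>UNIV. \<mu> $ i)) * (norm (p - pb) + \<epsilon>'\<^sup>2)"
      using nb by (simp add: normal_multiplier_def inner_sum_left sum_distrib_right sum_distrib_left mult_ac)
    also have "\<dots> \<le> (\<rho> / 4) * (norm (p - pb) + \<epsilon>'\<^sup>2)" using \<rho> by (intro mult_right_mono) auto
    also have "\<dots> \<le> (\<rho> / 4) * (3/2 * \<epsilon>'\<^sup>2)" using p \<rho>1 by (intro mult_left_mono) auto
    finally have w: "w \<bullet> (x - xb) \<le> \<rho> * (3/8 * \<epsilon>'\<^sup>2)" by simp
    have w': "(w /\<^sub>R \<rho>) \<bullet> (x - xb) \<le> 3/8 * \<epsilon>'\<^sup>2"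
    proof -
      have "w \<bullet> (x - xb) / \<rho> \<le> 3/8 * \<epsilon>'\<^sup>2" using w \<rho>1 by (simp add: pos_divide_le_eq mult.commute)
      then show ?thesis by (simp add: field_simps)
    qed
    have square: "(norm (y - z))\<^sup>2 = (norm y)\<^sup>2 - 2 * (z \<bullet> y) + (norm z)\<^sup>2" for y z :: 'a
      by (simp add: power2_norm_eq_inner inner_diff_left inner_diff_right inner_commute)
    have "(norm (x - a0))\<^sup>2 = (norm ((x - xb) - w /\<^sub>R \<rho>))\<^sup>2" by (simp add: a0_def algebra_simps)
    also have "\<dots> = (norm (x - xb))\<^sup>2 - 2 * ((w /\<^sub>R \<rho>) \<bullet> (x - xb)) + (norm (w /\<^sub>R \<rho>))\<^sup>2"
      by (rule square)
    also have "norm (w /\<^sub>R \<rho>) = D" by (simp add: D_def a0_def)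
    finally have "D\<^sup>2 + \<epsilon>'\<^sup>2 / 4 \<le> (norm (x - a0))\<^sup>2" using w' x by simp
    then have "sqrt (D\<^sup>2 + \<epsilon>'\<^sup>2 / 4) \<le> norm (x - a0)" by (rule real_le_lsqrt[OF norm_ge_zero])
    then show ?thesis by (simp add: gap_def)
  qed
  have "\<forall>\<^sub>F t in at_right 0. \<forall>i. \<phi> i (xb + t *\<^sub>R d, pb) < 0"
  proof (rule inward_direction_feasible[OF near_base base_feasible])
    fix i assume "\<phi> i (xb, pb) = 0"
    then show "G i (xb, pb) \<bullet> d < 0" using mfcq[of i xb pb] r_pos \<eta>_pos by simp
  qed
  moreover have "\<forall>\<^sub>F t in at_right 0. norm (t *\<^sub>R d) < min (gap / 3) \<epsilon>'"
  proof (rule order_tendstoD)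
    show "((\<lambda>t. norm (t *\<^sub>R d)) \<longlongrightarrow> 0) (at_right 0)" by (auto intro!: tendsto_eq_intros)
  qed (use gap \<epsilon>' in simp)
  ultimately have "\<forall>\<^sub>F t in at_right 0. (\<forall>i. \<phi> i (xb + t *\<^sub>R d, pb) < 0) \<and> norm (t *\<^sub>R d) < min (gap / 3) \<epsilon>'"
    by (rule eventually_conj)
  then obtain t where t: "\<And>i. \<phi> i (xb + t *\<^sub>R d, pb) < 0" "norm (t *\<^sub>R d) < min (gap / 3) \<epsilon>'"
    by (rule eventually_at_right_witness) blast
  \<comment> \<open>A competitor close to \<open>xb\<close> that is feasible for all nearby parameters, as it is strictly feasible for \<open>pb\<close>.\<close>
  define y where "y = xb + t *\<^sub>R d"
  have y: "norm (y - xb) < gap / 3" "norm (y - xb) < \<epsilon>'" using t(2) by (auto simp: y_def)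
  have yr: "y \<in> ball xb r" using y \<epsilon>' by (simp add: dist_norm norm_minus_commute)
  have "\<forall>\<^sub>F p in nhds pb. \<forall>i. \<phi> i (y, p) < 0"
  proof (rule eventually_all_finite)
    fix i
    have "((\<lambda>p. \<phi> i (y, p)) \<longlongrightarrow> \<phi> i (y, pb)) (nhds pb)"
      using yr r_pos by (intro tendsto_\<phi> tendsto_const filterlim_ident) auto
    then show "\<forall>\<^sub>F p in nhds pb. \<phi> i (y, p) < 0" using t(1) by (intro order_tendstoD) (auto simp: y_def)
  qed
  then obtain \<delta>0 where \<delta>0: "0 < \<delta>0" "\<And>p i. dist p pb < \<delta>0 \<Longrightarrow> \<phi> i (y, p) < 0"
    unfolding eventually_nhds_metric by blast
  define \<delta> where "\<delta> = min (min \<delta>0 r) (min (\<epsilon>'\<^sup>2 / 2) (gap / 3))"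
  show "\<exists>\<delta>>0. \<forall>p\<in>ball pb \<delta>. \<forall>b\<in>ball (w + \<rho> *\<^sub>R xb) \<delta>. \<exists>x\<in>ball xb \<epsilon>. proximal_solution \<rho> p x b"
  proof (intro exI[of _ \<delta>] conjI ballI)
    show "0 < \<delta>" using \<delta>0 r_pos \<epsilon>' gap by (simp add: \<delta>_def)
    fix p b assume p: "p \<in> ball pb \<delta>" and b: "b \<in> ball (w + \<rho> *\<^sub>R xb) \<delta>"
    have p': "p \<in> ball pb r" "norm (p - pb) \<le> \<epsilon>'\<^sup>2 / 2" "dist p pb < \<delta>0"
      using p by (auto simp: \<delta>_def dist_norm norm_minus_commute)
    define a where "a = b /\<^sub>R \<rho>"
    have a: "norm (a - a0) < gap / 3"
    proof -
      have "a - a0 = (b - (w + \<rho> *\<^sub>R xb)) /\<^sub>R \<rho>" using \<rho>1 by (simp add: a_def a0_def algebra_simps)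
      then have "norm (a - a0) = norm (b - (w + \<rho> *\<^sub>R xb)) / \<rho>" using \<rho>1 by (simp add: divide_inverse mult.commute)
      also have "\<dots> \<le> norm (b - (w + \<rho> *\<^sub>R xb)) / 1" using \<rho>1 by (intro divide_left_mono) auto
      also have "\<dots> < gap / 3" using b by (simp add: \<delta>_def dist_norm norm_minus_commute)
      finally show ?thesis .
    qed
    define S where "S = {x \<in> cball xb \<epsilon>'. \<forall>i. \<phi> i (x, p) \<le> 0}"
    have "closed S"
    proof -
      have "continuous_on (cball xb \<epsilon>') (\<lambda>x. \<phi> i (x, p))" for i
        unfolding continuous_on_def
      proof
        fix x assume "x \<in> cball xb \<epsilon>'"
        then show "((\<lambda>x. \<phi> i (x, p)) \<longlongrightarrow> \<phi> i (x, p)) (at x within cball xb \<epsilon>')"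
          using \<epsilon>' p' by (intro tendsto_\<phi> tendsto_ident_at tendsto_const) auto
      qed
      then have "closed (cball xb \<epsilon>' \<inter> (\<lambda>x. \<phi> i (x, p)) -` {..0})" for i
        by (intro continuous_closed_preimage) auto
      then have "closed (\<Inter>i. cball xb \<epsilon>' \<inter> (\<lambda>x. \<phi> i (x, p)) -` {..0})" by (intro closed_INT) auto
      also have "(\<Inter>i. cball xb \<epsilon>' \<inter> (\<lambda>x. \<phi> i (x, p)) -` {..0}) = S" by (auto simp: S_def)
      finally show ?thesis .
    qed
    moreover have yS: "y \<in> S"
      using y \<delta>0(2) p'(3) by (auto simp: S_def dist_norm norm_minus_commute less_imp_le)
    ultimately obtain x where x: "x \<in> S" "\<And>z. z \<in> S \<Longrightarrow> dist a x \<le> dist a z"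
      using distance_attains_inf[of S a] by blast
    have feas: "feasible x p" using x(1) by (simp add: S_def feasible_def)
    have "norm (x - xb) \<noteq> \<epsilon>'"
    proof
      assume "norm (x - xb) = \<epsilon>'"
      then have "D + gap \<le> norm (x - a0)" using far feas p' by blast
      also have "\<dots> \<le> norm (x - a) + norm (a - a0)" using norm_triangle_ineq[of "x - a" "a - a0"] by simp
      also have "norm (x - a) \<le> norm (y - a)" using x(2)[OF yS] by (simp add: dist_norm norm_minus_commute)
      also have "norm (y - a) \<le> norm (y - xb) + norm (xb - a0) + norm (a - a0)"
        using norm_triangle_ineq[of "y - xb" "xb - a0"] norm_triangle_ineq4[of "y - a0" "a - a0"] by simp
      finally show False using a y(1) by (simp add: D_def)
    qed
    then have x_in: "norm (x - xb) < \<epsilon>'" using x(1) by (simp add: S_def dist_norm norm_minus_commute)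
    have "b - \<rho> *\<^sub>R x \<in> regular_normal_cone (feasible_set \<phi> p) x"
      unfolding regular_normal_cone_iff
    proof (intro allI impI)
      fix e :: real assume e: "0 < e"
      have "((\<lambda>z. \<rho> * norm (z - x)) \<longlongrightarrow> \<rho> * norm (x - x)) (at x within feasible_set \<phi> p)"
        by (intro tendsto_intros)
      then have 1: "\<forall>\<^sub>F z in at x within feasible_set \<phi> p. \<rho> * norm (z - x) < e"
        by (rule order_tendstoD) (use e in simp)
      have 2: "\<forall>\<^sub>F z in at x within feasible_set \<phi> p. z \<in> ball xb \<epsilon>'"
        using x_in by (intro topological_tendstoD[OF tendsto_ident_at]) (auto simp: dist_norm norm_minus_commute)
      have 3: "\<forall>\<^sub>F z in at x within feasible_set \<phi> p. z \<in> feasible_set \<phi> p"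
        by (simp add: eventually_at_filter)
      show "\<forall>\<^sub>F z in at x within feasible_set \<phi> p. (b - \<rho> *\<^sub>R x) \<bullet> (z - x) \<le> e * norm (z - x)"
        using 1 2 3
      proof eventually_elim
        case (elim z)
        then have "z \<in> S" by (auto simp: S_def feasible_set_def)
        then have "norm (a - x) \<le> norm (a - z)" using x(2) by (simp add: dist_norm)
        then have "(norm (a - x))\<^sup>2 \<le> (norm (a - z))\<^sup>2" by (simp add: power_mono)
        also have "(norm (a - z))\<^sup>2 = (norm ((a - x) - (z - x)))\<^sup>2" by simp
        also have "\<dots> = (norm (a - x))\<^sup>2 - 2 * ((a - x) \<bullet> (z - x)) + (norm (z - x))\<^sup>2"
          unfolding power2_norm_eq_inner by (simp add: inner_diff_left inner_diff_right inner_commute)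
        finally have "2 * ((a - x) \<bullet> (z - x)) \<le> (norm (z - x))\<^sup>2" by linarith
        moreover have "0 \<le> (norm (z - x))\<^sup>2" by simp
        ultimately have "(a - x) \<bullet> (z - x) \<le> (norm (z - x))\<^sup>2" by linarith
        then have "\<rho> * ((a - x) \<bullet> (z - x)) \<le> \<rho> * (norm (z - x))\<^sup>2" using \<rho>1 by (intro mult_left_mono) auto
        moreover have "b - \<rho> *\<^sub>R x = \<rho> *\<^sub>R (a - x)" using \<rho>1 by (simp add: a_def algebra_simps)
        ultimately have "(b - \<rho> *\<^sub>R x) \<bullet> (z - x) \<le> (\<rho> * norm (z - x)) * norm (z - x)"
          by (simp add: power2_eq_square mult.assoc)
        also have "\<dots> \<le> e * norm (z - x)" using elim by (intro mult_right_mono) auto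
        finally show ?case .
      qed
    qed
    then have "\<exists>\<mu>. normal_multiplier x p \<mu> (b - \<rho> *\<^sub>R x)"
      by (rule regular_normal_imp_normal_multiplier)
        (use x_in \<epsilon>' p' feas in \<open>auto simp: feasible_def dist_norm norm_minus_commute\<close>)
    then show "\<exists>x\<in>ball xb \<epsilon>. proximal_solution \<rho> p x b"
      unfolding proximal_solution_def using feas x_in \<epsilon>' by (intro bexI[of _ x]) (auto simp: dist_norm norm_minus_commute)
  qed
qed

end

section \<open>Existence and dependence on the parameter\<close>

context parametric_variational
begin

lemma monotone_withD:
  assumes "monotone_with \<kappa> \<delta>" "p \<in> ball pb \<delta>" "x1 \<in> ball xb \<delta>" "x2 \<in> ball xb \<delta>" "v1 \<in> ball vb \<delta>" "v2 \<in> ball vb \<delta>"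
    "multiplier x1 p v1 \<mu>1" "multiplier x2 p v2 \<mu>2"
    "\<And>i. 0 < \<mu>1 $ i \<Longrightarrow> \<phi> i (x2, p) \<le> 0" "\<And>i. 0 < \<mu>2 $ i \<Longrightarrow> \<phi> i (x1, p) \<le> 0"
  shows "\<kappa> * (norm (x1 - x2))\<^sup>2 \<le> (v1 - v2) \<bullet> (x1 - x2)"
  using assms unfolding monotone_with_def by blast

lemma solution_iff:
  assumes "near x p"
  shows "x \<in> solution_map f \<phi> v p \<longleftrightarrow> feasible x p \<and> (\<exists>\<mu>. multiplier x p v \<mu>)"
proof -
  have "x \<in> solution_map f \<phi> v p \<longleftrightarrow> v - f (x, p) \<in> limiting_normal_cone (feasible_set \<phi> p) x"
    by (force simp: solution_map_def image_iff algebra_simps)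
  then show ?thesis using limiting_normal_cone_iff[OF assms] by (simp add: feasible_def multiplier_def)
qed

text \<open>The normals are hypomonotone with constant \<open>M\<close>, so adding \<open>\<rho> x\<close> leaves the modulus \<open>\<rho> - M\<close>. The constant \<open>M\<close>
does not depend on \<open>\<rho>\<close>, which lets \<open>\<rho>\<close> be chosen afterwards.\<close>

lemma proximal_solution_lipschitz:
  assumes M: "M = 2 * K * ((norm w + 1) * norm d / \<eta>)" and \<rho>: "M < \<rho>"
  shows "solutions_lipschitz (1 / (\<rho> - M)) (proximal_solution \<rho>) pb (w + \<rho> *\<^sub>R xb) xb"
proof -
  have "0 \<le> M" unfolding M using K_pos \<eta>_pos by simp
  then have \<rho>0: "0 < \<rho>" using \<rho> by simp
  define \<epsilon> where "\<epsilon> = min r (1 / (1 + \<rho>))"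
  show ?thesis
    unfolding solutions_lipschitz_def
  proof (intro exI[of _ \<epsilon>] conjI ballI impI)
    show "0 < \<epsilon>" using r_pos \<rho>0 by (simp add: \<epsilon>_def)
    fix p x1 x2 b1 b2
    assume p: "p \<in> ball pb \<epsilon>" and x: "x1 \<in> ball xb \<epsilon>" "x2 \<in> ball xb \<epsilon>"
      and b: "b1 \<in> ball (w + \<rho> *\<^sub>R xb) \<epsilon>" "b2 \<in> ball (w + \<rho> *\<^sub>R xb) \<epsilon>"
      and s: "proximal_solution \<rho> p x1 b1" "proximal_solution \<rho> p x2 b2"
    have n: "near x1 p" "near x2 p" using p x by (auto simp: \<epsilon>_def)
    obtain \<mu>1 \<mu>2 where \<mu>: "normal_multiplier x1 p \<mu>1 (b1 - \<rho> *\<^sub>R x1)" "normal_multiplier x2 p \<mu>2 (b2 - \<rho> *\<^sub>R x2)"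
      and feas: "feasible x1 p" "feasible x2 p"
      using s by (auto simp: proximal_solution_def)
    have bound: "K * (\<Sum>i\<in>UNIV. \<mu> $ i) \<le> M / 2"
      if "normal_multiplier x p \<mu> (b - \<rho> *\<^sub>R x)" "near x p" "x \<in> ball xb \<epsilon>" "b \<in> ball (w + \<rho> *\<^sub>R xb) \<epsilon>" for x b \<mu>
    proof -
      have eq: "b - \<rho> *\<^sub>R x = (w + (b - (w + \<rho> *\<^sub>R xb))) - \<rho> *\<^sub>R (x - xb)" by (simp add: algebra_simps)
      have "norm (b - \<rho> *\<^sub>R x) \<le> norm (w + (b - (w + \<rho> *\<^sub>R xb))) + norm (\<rho> *\<^sub>R (x - xb))"
        unfolding eq by (rule norm_triangle_ineq4)
      also have "norm (w + (b - (w + \<rho> *\<^sub>R xb))) \<le> norm w + norm (b - (w + \<rho> *\<^sub>R xb))"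
        by (rule norm_triangle_ineq)
      also have "norm (b - (w + \<rho> *\<^sub>R xb)) \<le> \<epsilon>" using that(4) by (simp add: dist_norm norm_minus_commute)
      also have "norm (\<rho> *\<^sub>R (x - xb)) \<le> \<rho> * \<epsilon>"
        using that(3) \<rho>0 by (simp add: dist_norm norm_minus_commute)
      finally have "norm (b - \<rho> *\<^sub>R x) \<le> norm w + (1 + \<rho>) * \<epsilon>" by (simp add: algebra_simps)
      moreover have "(1 + \<rho>) * \<epsilon> \<le> (1 + \<rho>) * (1 / (1 + \<rho>))"
        using \<rho>0 by (intro mult_left_mono) (auto simp: \<epsilon>_def)
      ultimately have "norm (b - \<rho> *\<^sub>R x) \<le> norm w + 1" using \<rho>0 by simp
      then have "norm (b - \<rho> *\<^sub>R x) * norm d / \<eta> \<le> (norm w + 1) * norm d / \<eta>"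
        using \<eta>_pos by (intro divide_right_mono mult_right_mono) auto
      then have "(\<Sum>i\<in>UNIV. \<mu> $ i) \<le> (norm w + 1) * norm d / \<eta>"
        using normal_multiplier_bound[OF that(1,2)] by linarith
      then have "K * (\<Sum>i\<in>UNIV. \<mu> $ i) \<le> K * ((norm w + 1) * norm d / \<eta>)"
        using K_pos by (intro mult_left_mono) auto
      then show ?thesis by (simp add: M)
    qed
    define h where "h = x1 - x2"
    have "(b1 - \<rho> *\<^sub>R x1) \<bullet> (x2 - x1) \<le> K * (\<Sum>i\<in>UNIV. \<mu>1 $ i) * (norm (x2 - x1))\<^sup>2"
      by (rule normal_hypomonotone[OF \<mu>(1)]) (use n feas in \<open>auto simp: feasible_def\<close>)
    also have "\<dots> \<le> (M / 2) * (norm (x2 - x1))\<^sup>2"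
      using bound[OF \<mu>(1) n(1) x(1) b(1)] by (intro mult_right_mono) auto
    finally have 1: "- ((b1 - \<rho> *\<^sub>R x1) \<bullet> h) \<le> (M / 2) * (norm h)\<^sup>2"
      by (simp add: h_def norm_minus_commute inner_diff_right)
    have "(b2 - \<rho> *\<^sub>R x2) \<bullet> (x1 - x2) \<le> K * (\<Sum>i\<in>UNIV. \<mu>2 $ i) * (norm (x1 - x2))\<^sup>2"
      by (rule normal_hypomonotone[OF \<mu>(2)]) (use n feas in \<open>auto simp: feasible_def\<close>)
    also have "\<dots> \<le> (M / 2) * (norm (x1 - x2))\<^sup>2"
      using bound[OF \<mu>(2) n(2) x(2) b(2)] by (intro mult_right_mono) auto
    finally have 2: "(b2 - \<rho> *\<^sub>R x2) \<bullet> h \<le> (M / 2) * (norm h)\<^sup>2" by (simp add: h_def)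
    have "(b1 - b2) \<bullet> h = (b1 - \<rho> *\<^sub>R x1) \<bullet> h - (b2 - \<rho> *\<^sub>R x2) \<bullet> h + \<rho> * (norm h)\<^sup>2"
      unfolding power2_norm_eq_inner h_def by (simp add: inner_diff_left algebra_simps)
    then have "(\<rho> - M) * (norm h)\<^sup>2 \<le> (b1 - b2) \<bullet> h" using 1 2 by (simp add: algebra_simps)
    then have "norm h \<le> norm (b1 - b2) / (\<rho> - M)" using \<rho> by (intro norm_le_if_inner_le) auto
    then show "norm (x1 - x2) \<le> 1 / (\<rho> - M) * norm (b1 - b2)" by (simp add: h_def)
  qed
qed

lemma f_perturbation_data:
  "\<exists>\<epsilon>>0. \<forall>p\<in>ball pb \<epsilon>. \<forall>x1\<in>ball xb \<epsilon>. \<forall>x2\<in>ball xb \<epsilon>. norm (f (x1, p) - f (x2, p)) \<le> K * norm (x1 - x2)"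
  "isCont (\<lambda>p. f (xb, p)) pb"
proof -
  show "\<exists>\<epsilon>>0. \<forall>p\<in>ball pb \<epsilon>. \<forall>x1\<in>ball xb \<epsilon>. \<forall>x2\<in>ball xb \<epsilon>. norm (f (x1, p) - f (x2, p)) \<le> K * norm (x1 - x2)"
  proof (intro exI[of _ r] conjI ballI)
    show "norm (f (x1, p) - f (x2, p)) \<le> K * norm (x1 - x2)"
      if "p \<in> ball pb r" "x1 \<in> ball xb r" "x2 \<in> ball xb r" for p x1 x2
      using f_lip[of x1 p x2 p] that by simp
  qed (rule r_pos)
  show "isCont (\<lambda>p. f (xb, p)) pb"
    unfolding isCont_def using r_pos by (intro tendsto_f tendsto_const tendsto_ident_at) auto
qed

text \<open>Two perturbations of the proximal problem: \<open>f\<close> is small relative to \<open>\<rho>\<close>, and returning from the modulus \<open>\<kappa> + \<rho>\<close>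
to \<open>\<kappa>\<close> by subtracting \<open>\<rho> x\<close> contracts with factor \<open>\<rho> / (\<kappa> + \<rho>)\<close>.\<close>

proposition local_solvability:
  assumes mono: "monotone_with \<kappa> \<delta>0" and \<kappa>: "0 < \<kappa>" "0 < \<delta>0"
  shows "locally_solvable (\<lambda>p x v. feasible x p \<and> (\<exists>\<mu>. multiplier x p v \<mu>)) pb vb xb"
proof -
  define w where "w = vb - f (xb, pb)"
  obtain \<mu> where \<mu>: "normal_multiplier xb pb \<mu> w" using base_solution by (auto simp: w_def)
  define M where "M = 2 * K * ((norm w + 1) * norm d / \<eta>)"
  have M: "0 \<le> M" using K_pos \<eta>_pos by (simp add: M_def)
  define \<rho> where "\<rho> = max (4 * K * (\<Sum>i\<in>UNIV. \<mu> $ i) + 1) (M + K + 1)"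
  have \<rho>: "4 * K * (\<Sum>i\<in>UNIV. \<mu> $ i) + 1 \<le> \<rho>" "M < \<rho>" "K < \<rho> - M" "0 < \<rho>"
    using M K_pos by (auto simp: \<rho>_def)
  \<comment> \<open>The Lipschitz constant \<open>K\<close> of \<open>f\<close> is below \<open>\<rho> - M\<close>.\<close>
  have solv1: "locally_solvable (\<lambda>p x b. proximal_solution \<rho> p x (b - f (x, p))) pb (vb + \<rho> *\<^sub>R xb) xb"
  proof (rule solvability_under_lipschitz_perturbation[where h = "\<lambda>p x. f (x, p)"])
    show "locally_solvable (proximal_solution \<rho>) pb (w + \<rho> *\<^sub>R xb) xb" by (rule proximal_solvability[OF \<mu> \<rho>(1)])
    show "1 / (\<rho> - M) * K < 1" "0 < 1 / (\<rho> - M)" using \<rho> by auto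
    show "vb + \<rho> *\<^sub>R xb = w + \<rho> *\<^sub>R xb + f (xb, pb)" by (simp add: w_def)
  qed (rule proximal_solution_lipschitz[OF M_def \<rho>(2)] f_perturbation_data K_pos)+
  \<comment> \<open>A solution for the datum \<open>b\<close> of the problem with the extra term \<open>\<rho> x\<close> is one for \<open>b - \<rho> x\<close> of the given problem,
     where strong monotonicity with modulus \<open>\<kappa>\<close> applies.\<close>
  have lip: "solutions_lipschitz (1 / (\<kappa> + \<rho>)) (\<lambda>p x b. proximal_solution \<rho> p x (b - f (x, p)))
      pb (vb + \<rho> *\<^sub>R xb) xb"
  proof -
    define \<epsilon> where "\<epsilon> = \<delta>0 / (1 + \<rho>)"
    have \<epsilon>: "0 < \<epsilon>" "\<epsilon> \<le> \<delta>0" "(1 + \<rho>) * \<epsilon> = \<delta>0" using \<kappa> \<rho> by (auto simp: \<epsilon>_def field_simps)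
    show ?thesis
      unfolding solutions_lipschitz_def
    proof (intro exI[of _ \<epsilon>] conjI ballI impI)
      fix p x1 x2 b1 b2
      assume p: "p \<in> ball pb \<epsilon>" and x: "x1 \<in> ball xb \<epsilon>" "x2 \<in> ball xb \<epsilon>"
        and b: "b1 \<in> ball (vb + \<rho> *\<^sub>R xb) \<epsilon>" "b2 \<in> ball (vb + \<rho> *\<^sub>R xb) \<epsilon>"
        and s: "proximal_solution \<rho> p x1 (b1 - f (x1, p))" "proximal_solution \<rho> p x2 (b2 - f (x2, p))"
      have v_in: "b - \<rho> *\<^sub>R x \<in> ball vb \<delta>0" if "x \<in> ball xb \<epsilon>" "b \<in> ball (vb + \<rho> *\<^sub>R xb) \<epsilon>" for x b
      proof -
        have "b - \<rho> *\<^sub>R x - vb = (b - (vb + \<rho> *\<^sub>R xb)) - \<rho> *\<^sub>R (x - xb)" by (simp add: algebra_simps)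
        then have "norm (b - \<rho> *\<^sub>R x - vb) \<le> norm (b - (vb + \<rho> *\<^sub>R xb)) + norm (\<rho> *\<^sub>R (x - xb))"
          by (simp only: norm_triangle_ineq4)
        also have "\<dots> < \<epsilon> + \<rho> * \<epsilon>"
          using that \<rho> by (intro add_strict_mono) (auto simp: dist_norm norm_minus_commute)
        finally show ?thesis using \<epsilon> by (simp add: dist_norm norm_minus_commute algebra_simps)
      qed
      obtain \<mu>1 \<mu>2 where \<mu>: "multiplier x1 p (b1 - \<rho> *\<^sub>R x1) \<mu>1" "multiplier x2 p (b2 - \<rho> *\<^sub>R x2) \<mu>2"
        and feas: "feasible x1 p" "feasible x2 p"
        using s by (auto simp: proximal_solution_def multiplier_def diff_diff_eq add.commute)
      have in_ball: "p \<in> ball pb \<delta>0" "x1 \<in> ball xb \<delta>0" "x2 \<in> ball xb \<delta>0" using p x \<epsilon>(2) by auto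
      define h where "h = x1 - x2"
      have "\<kappa> * (norm h)\<^sup>2 \<le> ((b1 - \<rho> *\<^sub>R x1) - (b2 - \<rho> *\<^sub>R x2)) \<bullet> h"
        unfolding h_def
        by (rule monotone_withD[OF mono _ _ _ _ _ \<mu>])
          (use in_ball x b feas v_in in \<open>auto simp: feasible_def\<close>)
      also have "\<dots> = (b1 - b2) \<bullet> h - \<rho> * (norm h)\<^sup>2"
        unfolding power2_norm_eq_inner h_def by (simp add: inner_diff_left algebra_simps)
      finally have "(\<kappa> + \<rho>) * (norm h)\<^sup>2 \<le> (b1 - b2) \<bullet> h" by (simp add: algebra_simps)
      then have "norm h \<le> norm (b1 - b2) / (\<kappa> + \<rho>)" using \<kappa> \<rho> by (intro norm_le_if_inner_le) auto
      then show "norm (x1 - x2) \<le> 1 / (\<kappa> + \<rho>) * norm (b1 - b2)" by (simp add: h_def)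
    qed (rule \<epsilon>)
  qed
  have "locally_solvable (\<lambda>p x v. proximal_solution \<rho> p x ((v - - (\<rho> *\<^sub>R x)) - f (x, p))) pb vb xb"
  proof (rule solvability_under_lipschitz_perturbation[where h = "\<lambda>p x. - (\<rho> *\<^sub>R x)" and L = \<rho>, OF solv1 lip])
    show "1 / (\<kappa> + \<rho>) * \<rho> < 1" "0 < 1 / (\<kappa> + \<rho>)" using \<rho> \<kappa> by auto
    show "\<exists>\<epsilon>>0. \<forall>p\<in>ball pb \<epsilon>. \<forall>x1\<in>ball xb \<epsilon>. \<forall>x2\<in>ball xb \<epsilon>. norm (- (\<rho> *\<^sub>R x1) - - (\<rho> *\<^sub>R x2)) \<le> \<rho> * norm (x1 - x2)"
    proof (intro exI[of _ 1] conjI ballI)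
      fix x1 x2 :: 'a
      have "- (\<rho> *\<^sub>R x1) - - (\<rho> *\<^sub>R x2) = \<rho> *\<^sub>R (x2 - x1)" by (simp add: algebra_simps)
      then show "norm (- (\<rho> *\<^sub>R x1) - - (\<rho> *\<^sub>R x2)) \<le> \<rho> * norm (x1 - x2)"
        using \<rho> by (simp add: norm_minus_commute)
    qed simp
  qed (use \<rho> in simp_all)
  then show ?thesis
    by (simp add: proximal_solution_def multiplier_def)
qed

definition lipschitz_on_family :: "'m set \<Rightarrow> real \<Rightarrow> real \<Rightarrow> bool" where
  "lipschitz_on_family J C \<delta> \<longleftrightarrow>
     (\<forall>p\<in>ball pb \<delta>. \<forall>q\<in>ball pb \<delta>. \<forall>v\<in>ball vb \<delta>. \<forall>x\<in>ball xb \<delta>. \<forall>y\<in>ball xb \<delta>. \<forall>\<mu> \<nu>.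
       multiplier x p v \<mu> \<longrightarrow> multiplier y q v \<nu> \<longrightarrow> (\<forall>i. i \<notin> J \<longrightarrow> \<mu> $ i = 0 \<and> \<nu> $ i = 0) \<longrightarrow>
       (\<forall>i\<in>J. \<phi> i (x, p) = 0 \<and> \<phi> i (y, q) = 0) \<longrightarrow> norm (x - y) \<le> C * norm (p - q))"

text \<open>Move \<open>x\<close> onto the zero set of the constraints in \<open>J\<close> for the parameter \<open>q\<close> and keep its multiplier. The new point \<open>z\<close>
and its datum \<open>v'\<close> differ from \<open>x\<close> and \<open>v\<close> by \<open>O(|p - q|)\<close>, and strong monotonicity at the
parameter \<open>q\<close> bounds the distance of \<open>z\<close> and \<open>y\<close> by that of \<open>v'\<close> and \<open>v\<close>.\<close>

lemma lipschitz_along_common_family: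
  assumes J: "family_independent (\<lambda>i. G i (xb, pb)) J" "\<And>i. i \<in> J \<Longrightarrow> \<phi> i (xb, pb) = 0"
    and mono: "monotone_with \<kappa> \<delta>0" and \<kappa>: "0 < \<kappa>" "0 < \<delta>0"
  shows "\<exists>C>0. \<forall>\<^sub>F \<delta> in at_right 0. lipschitz_on_family J C \<delta>"
proof -
  obtain c where c: "0 < c" and corr: "\<forall>\<^sub>F \<delta> in at_right 0. \<forall>x\<in>ball xb \<delta>. \<forall>p\<in>ball pb \<delta>.
    \<exists>x'. (\<forall>i\<in>J. \<phi> i (x', p) = 0) \<and> norm (x' - x) \<le> c * (\<Sum>i\<in>J. \<bar>\<phi> i (x, p)\<bar>)"
    using correction_to_active_manifold[OF J] by blast
  define c1 where "c1 = c * (real (card J) * K)"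
  have c1: "0 \<le> c1" using c K_pos by (simp add: c1_def)
  define T where "T = max 0 multiplier_radius"
  define c2 where "c2 = (1 + T) * (K * (c1 + 1))"
  have c2: "0 \<le> c2" using c1 K_pos by (simp add: c2_def T_def)
  define C where "C = c1 + c2 / \<kappa> + 1"
  have C: "0 < C" using c1 c2 \<kappa> by (simp add: C_def add_nonneg_pos)
  define \<delta>1 where "\<delta>1 = min r \<delta>0 / (1 + 2 * c1 + 2 * c2)"
  have den: "1 \<le> 1 + 2 * c1 + 2 * c2" using c1 c2 by simp
  have \<delta>1: "0 < \<delta>1" using r_pos \<kappa> den by (simp add: \<delta>1_def)
  have small: "\<forall>\<^sub>F \<delta> in at_right (0::real). 0 < \<delta> \<and> \<delta> < \<delta>1"
    using \<delta>1 by (intro eventually_at_rightI[of 0 \<delta>1]) auto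
  show ?thesis
  proof (intro exI[of _ C] conjI C)
    show "\<forall>\<^sub>F \<delta> in at_right 0. lipschitz_on_family J C \<delta>"
      using corr small
    proof eventually_elim
      case (elim \<delta>)
      show ?case
        unfolding lipschitz_on_family_def
      proof (intro ballI allI impI)
        fix p q v x y \<mu> \<nu>
        assume p: "p \<in> ball pb \<delta>" "q \<in> ball pb \<delta>" and v: "v \<in> ball vb \<delta>" and x: "x \<in> ball xb \<delta>" "y \<in> ball xb \<delta>"
          and m: "multiplier x p v \<mu>" "multiplier y q v \<nu>" and supp: "\<forall>i. i \<notin> J \<longrightarrow> \<mu> $ i = 0 \<and> \<nu> $ i = 0"
          and act: "\<forall>i\<in>J. \<phi> i (x, p) = 0 \<and> \<phi> i (y, q) = 0"
        have "\<delta>1 * (1 + 2 * c1 + 2 * c2) = min r \<delta>0" using den by (simp add: \<delta>1_def)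
        moreover have "\<delta> * (1 + 2 * c1 + 2 * c2) < \<delta>1 * (1 + 2 * c1 + 2 * c2)"
          using elim(2) den by (intro mult_strict_right_mono) auto
        ultimately have tot: "\<delta> + c1 * (2 * \<delta>) + c2 * (2 * \<delta>) < min r \<delta>0" by (simp add: algebra_simps)
        have nn: "0 \<le> c1 * (2 * \<delta>)" "0 \<le> c2 * (2 * \<delta>)" using c1 c2 elim(2) by auto
        have r': "\<delta> < r" "\<delta> < \<delta>0" using tot nn min.cobounded1[of r \<delta>0] min.cobounded2[of r \<delta>0] by linarith+
        define n where "n = norm (p - q)"
        have n: "0 \<le> n" "n \<le> 2 * \<delta>"
          using p dist_triangle2[of p q pb] by (auto simp: n_def dist_norm norm_minus_commute)
        obtain z where z: "\<forall>i\<in>J. \<phi> i (z, q) = 0" "norm (z - x) \<le> c * (\<Sum>i\<in>J. \<bar>\<phi> i (x, q)\<bar>)"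
          using elim(1) x p by blast
        have "(\<Sum>i\<in>J. \<bar>\<phi> i (x, q)\<bar>) \<le> (\<Sum>i\<in>J. K * n)"
        proof (rule sum_mono)
          fix i assume "i \<in> J"
          then have "\<bar>\<phi> i (x, q)\<bar> = \<bar>\<phi> i (x, p) - \<phi> i (x, q)\<bar>" using act by simp
          also have "\<dots> \<le> K * (norm (x - x) + norm (p - q))" using x p r' by (intro \<phi>_lip) auto
          finally show "\<bar>\<phi> i (x, q)\<bar> \<le> K * n" by (simp add: n_def)
        qed
        then have "c * (\<Sum>i\<in>J. \<bar>\<phi> i (x, q)\<bar>) \<le> c * (\<Sum>i\<in>J. K * n)" using c by (intro mult_left_mono) auto
        then have zx: "norm (z - x) \<le> c1 * n" using z(2) by (simp add: c1_def mult_ac)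
        also have "\<dots> \<le> c1 * (2 * \<delta>)" using c1 n by (intro mult_left_mono) auto
        finally have zx': "norm (z - x) \<le> c1 * (2 * \<delta>)" .
        have z_in: "z \<in> ball xb (min r \<delta>0)"
        proof -
          have "norm (z - xb) \<le> norm (z - x) + norm (x - xb)" using norm_triangle_ineq[of "z - x" "x - xb"] by simp
          moreover have "norm (x - xb) < \<delta>" using x by (simp add: dist_norm norm_minus_commute)
          ultimately have "norm (z - xb) < min r \<delta>0" using zx' tot nn by linarith
          then show ?thesis by (simp add: dist_norm norm_minus_commute)
        qed
        define v' where "v' = f (z, q) + (\<Sum>i\<in>UNIV. (\<mu> $ i) *\<^sub>R G i (z, q))"
        have mz: "multiplier z q v' \<mu>"
          unfolding multiplier_def normal_multiplier_def
          using multiplier_nonneg[OF m(1)] supp z(1) by (auto simp: v'_def)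
        have \<mu>T: "(\<Sum>i\<in>UNIV. \<mu> $ i) \<le> T"
          using multiplier_bound(1)[OF m(1)] x p v r' by (auto simp: T_def dist_norm norm_minus_commute)
        have lip_le: "K * (norm (z - x) + norm (q - p)) \<le> K * (c1 + 1) * n"
        proof -
          have "norm (z - x) + norm (q - p) \<le> (c1 + 1) * n" using zx by (simp add: n_def norm_minus_commute algebra_simps)
          then show ?thesis using K_pos by (simp add: mult.assoc)
        qed
        have "v' - v = (f (z, q) - f (x, p)) + (\<Sum>i\<in>UNIV. (\<mu> $ i) *\<^sub>R (G i (z, q) - G i (x, p)))"
          unfolding v'_def by (subst multiplier_sum[OF m(1)]) (simp add: scaleR_diff_right sum_subtractf)
        then have "norm (v' - v) \<le> norm (f (z, q) - f (x, p)) + norm (\<Sum>i\<in>UNIV. (\<mu> $ i) *\<^sub>R (G i (z, q) - G i (x, p)))"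
          by (simp add: norm_triangle_ineq)
        also have "\<dots> \<le> K * (c1 + 1) * n + T * (K * (c1 + 1) * n)"
        proof (rule add_mono)
          show "norm (f (z, q) - f (x, p)) \<le> K * (c1 + 1) * n"
            by (rule order_trans[OF f_lip lip_le]) (use z_in x p r' in auto)
          have "norm (\<Sum>i\<in>UNIV. (\<mu> $ i) *\<^sub>R (G i (z, q) - G i (x, p))) \<le> (\<Sum>i\<in>UNIV. norm ((\<mu> $ i) *\<^sub>R (G i (z, q) - G i (x, p))))"
            by (rule norm_sum)
          also have "\<dots> \<le> (\<Sum>i\<in>UNIV. \<mu> $ i * (K * (c1 + 1) * n))"
          proof (rule sum_mono)
            fix i
            have "norm (G i (z, q) - G i (x, p)) \<le> K * (c1 + 1) * n"
              by (rule order_trans[OF G_lip lip_le]) (use z_in x p r' in auto)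
            then show "norm ((\<mu> $ i) *\<^sub>R (G i (z, q) - G i (x, p))) \<le> \<mu> $ i * (K * (c1 + 1) * n)"
              using multiplier_nonneg[OF m(1), of i] by (simp add: mult_left_mono)
          qed
          also have "\<dots> = (\<Sum>i\<in>UNIV. \<mu> $ i) * (K * (c1 + 1) * n)" by (simp add: sum_distrib_right)
          also have "\<dots> \<le> T * (K * (c1 + 1) * n)" using \<mu>T K_pos c1 n by (intro mult_right_mono) auto
          finally show "norm (\<Sum>i\<in>UNIV. (\<mu> $ i) *\<^sub>R (G i (z, q) - G i (x, p))) \<le> T * (K * (c1 + 1) * n)" .
        qed
        also have "\<dots> = c2 * n" by (simp add: c2_def algebra_simps)
        finally have vv: "norm (v' - v) \<le> c2 * n" .
        also have "\<dots> \<le> c2 * (2 * \<delta>)" using c2 n by (intro mult_left_mono) auto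
        finally have "norm (v' - v) \<le> c2 * (2 * \<delta>)" .
        moreover have "norm (v' - vb) \<le> norm (v' - v) + norm (v - vb)"
          using norm_triangle_ineq[of "v' - v" "v - vb"] by simp
        moreover have "norm (v - vb) < \<delta>" using v by (simp add: dist_norm norm_minus_commute)
        ultimately have "norm (v' - vb) < \<delta>0" using tot nn min.cobounded2[of r \<delta>0] by linarith
        then have v'_in: "v' \<in> ball vb \<delta>0" by (simp add: dist_norm norm_minus_commute)
        have "\<kappa> * (norm (z - y))\<^sup>2 \<le> (v' - v) \<bullet> (z - y)"
        proof (rule monotone_withD[OF mono _ _ _ _ _ mz m(2)])
          show "\<phi> i (y, q) \<le> 0" if "0 < \<mu> $ i" for i using that supp act by (metis less_irrefl order_refl)
          show "\<phi> i (z, q) \<le> 0" if "0 < \<nu> $ i" for i using that supp z(1) by (metis less_irrefl order_refl)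
        qed (use p x v r' z_in v'_in in auto)
        then have "norm (z - y) \<le> norm (v' - v) / \<kappa>" by (rule norm_le_if_inner_le[OF \<kappa>(1)])
        also have "\<dots> \<le> c2 * n / \<kappa>" using vv \<kappa> by (intro divide_right_mono) auto
        finally have "norm (z - y) \<le> c2 / \<kappa> * n" by simp
        moreover have "norm (x - y) \<le> norm (z - x) + norm (z - y)"
          using norm_triangle_ineq4[of "z - y" "z - x"] by simp
        ultimately have "norm (x - y) \<le> c1 * n + c2 / \<kappa> * n + n" using zx n by linarith
        then show "norm (x - y) \<le> C * norm (p - q)" by (simp add: C_def n_def algebra_simps)
      qed
    qed
  qed
qed

end

section \<open>Sufficiency of the second-order condition\<close>

context parametric_variational
begin

text \<open>The hypothesis on ranks confines attention to families \<open>J\<close> that are independent at the base point. There are finitely many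
of them, and the Lipschitz estimate along each one holds with uniform constants near the base point.\<close>

theorem second_order_imp_fully_stable:
  assumes sosc: strong_second_order
    and rank: "\<And>x p J. near x p \<Longrightarrow> (\<And>i. i \<in> J \<Longrightarrow> \<phi> i (xb, pb) = 0) \<Longrightarrow>
      family_independent (\<lambda>i. G i (x, p)) J \<Longrightarrow> family_independent (\<lambda>i. G i (xb, pb)) J"
  shows "lipschitzian_fully_stable f \<phi> xb vb pb"
proof -
  obtain \<kappa> \<delta>0 where \<kappa>: "0 < \<kappa>" "0 < \<delta>0" and mono: "monotone_with \<kappa> \<delta>0"
    using strong_monotonicity[OF sosc] by blast
  define good where "good J \<longleftrightarrow> family_independent (\<lambda>i. G i (xb, pb)) J \<and> (\<forall>i\<in>J. \<phi> i (xb, pb) = 0)" for J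
  have "\<forall>J. \<exists>C. good J \<longrightarrow> 0 < C \<and> (\<forall>\<^sub>F \<delta> in at_right 0. lipschitz_on_family J C \<delta>)"
    using lipschitz_along_common_family[OF _ _ mono \<kappa>] unfolding good_def by blast
  then obtain Cf where Cf: "\<And>J. good J \<Longrightarrow> 0 < Cf J \<and> (\<forall>\<^sub>F \<delta> in at_right 0. lipschitz_on_family J (Cf J) \<delta>)" by metis
  define C where "C = (\<Sum>J\<in>UNIV. \<bar>Cf J\<bar>)"
  have C: "0 \<le> C" by (simp add: C_def sum_nonneg)
  have Cf_le: "Cf J \<le> C" for J
    unfolding C_def using member_le_sum[of J UNIV "\<lambda>J. \<bar>Cf J\<bar>"] by auto
  have "\<forall>\<^sub>F \<delta> in at_right 0. \<forall>J. good J \<longrightarrow> lipschitz_on_family J (Cf J) \<delta>"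
  proof (rule eventually_all_finite)
    fix J show "\<forall>\<^sub>F \<delta> in at_right 0. good J \<longrightarrow> lipschitz_on_family J (Cf J) \<delta>"
      using Cf[of J] by (cases "good J") auto
  qed
  moreover have "\<forall>\<^sub>F \<delta> in at_right (0::real). \<delta> < min r \<delta>0"
    using r_pos \<kappa> by (intro eventually_at_rightI[of 0 "min r \<delta>0"]) auto
  ultimately have "\<forall>\<^sub>F \<delta> in at_right 0. (\<forall>J. good J \<longrightarrow> lipschitz_on_family J (Cf J) \<delta>) \<and> \<delta> < min r \<delta>0"
    by (rule eventually_conj)
  then obtain \<delta>1 where \<delta>1: "0 < \<delta>1" "\<And>J. good J \<Longrightarrow> lipschitz_on_family J (Cf J) \<delta>1" "\<delta>1 < r" "\<delta>1 < \<delta>0"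
    by (rule eventually_at_right_witness) auto
  define \<epsilon> where "\<epsilon> = \<delta>1 / 2"
  have \<epsilon>: "0 < \<epsilon>" "\<epsilon> < \<delta>1" using \<delta>1 by (auto simp: \<epsilon>_def)
  obtain \<delta>2 where \<delta>2: "0 < \<delta>2" "\<And>p v. p \<in> ball pb \<delta>2 \<Longrightarrow> v \<in> ball vb \<delta>2 \<Longrightarrow>
      \<exists>x\<in>ball xb \<epsilon>. feasible x p \<and> (\<exists>\<mu>. multiplier x p v \<mu>)"
    using local_solvability[OF mono \<kappa>, unfolded locally_solvable_def, rule_format, OF \<epsilon>(1)] by blast
  define \<delta> where "\<delta> = min \<delta>1 \<delta>2"
  have \<delta>: "0 < \<delta>" "\<delta> \<le> \<delta>1" "\<delta> \<le> \<delta>2" using \<delta>1 \<delta>2 by (auto simp: \<delta>_def)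
  \<comment> \<open>Closedness of \<open>U\<close> keeps limits of solutions inside \<open>U\<close>, where they are unique.\<close>
  define U where "U = cball xb \<epsilon>"
  define V where "V = ball vb \<delta>"
  define Q where "Q = ball pb \<delta>"
  have U_sub: "x \<in> ball xb \<delta>1" "x \<in> ball xb r" "x \<in> ball xb \<delta>0" if "x \<in> U" for x
    using that \<epsilon> \<delta>1 by (auto simp: U_def)
  have V_sub: "v \<in> ball vb \<delta>1" "v \<in> ball vb \<delta>0" "v \<in> ball vb \<delta>2" if "v \<in> V" for v
    using that \<delta> \<delta>1 by (auto simp: V_def)
  have Q_sub: "p \<in> ball pb \<delta>1" "p \<in> ball pb \<delta>0" "p \<in> ball pb \<delta>2" "p \<in> ball pb r" if "p \<in> Q" for p
    using that \<delta> \<delta>1 by (auto simp: Q_def)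
  have near: "near x p" if "x \<in> U" "p \<in> Q" for x p using U_sub Q_sub that by blast
  have sol: "x \<in> solution_map f \<phi> v p \<longleftrightarrow> feasible x p \<and> (\<exists>\<mu>. multiplier x p v \<mu>)" if "x \<in> U" "p \<in> Q" for x p v
    by (rule solution_iff[OF near[OF that]])
  have strong: "\<kappa> * (norm (x1 - x2))\<^sup>2 \<le> (v1 - v2) \<bullet> (x1 - x2)"
    if s: "x1 \<in> U" "x2 \<in> U" "p \<in> Q" "v1 \<in> V" "v2 \<in> V" "x1 \<in> solution_map f \<phi> v1 p" "x2 \<in> solution_map f \<phi> v2 p"
    for x1 x2 p v1 v2
  proof -
    obtain \<mu>1 \<mu>2 where "multiplier x1 p v1 \<mu>1" "multiplier x2 p v2 \<mu>2" "feasible x1 p" "feasible x2 p"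
      using sol[OF s(1,3), of v1] sol[OF s(2,3), of v2] s(6,7) by blast
    then show ?thesis
      using U_sub(3)[OF s(1)] U_sub(3)[OF s(2)] Q_sub(2)[OF s(3)] V_sub(2)[OF s(4)] V_sub(2)[OF s(5)]
      by (intro monotone_withD[OF mono]) (auto simp: feasible_def)
  qed
  have unique: "x1 = x2"
    if "x1 \<in> U" "x2 \<in> U" "p \<in> Q" "v \<in> V" "x1 \<in> solution_map f \<phi> v p" "x2 \<in> solution_map f \<phi> v p" for x1 x2 p v
    using strong[OF that(1-3) that(4,4) that(5,6)] \<kappa> by (simp add: mult_le_0_iff)
  define \<theta> where "\<theta> = (\<lambda>(v, p). SOME x. x \<in> U \<and> x \<in> solution_map f \<phi> v p)"
  have \<theta>: "\<theta> (v, p) \<in> U" "\<theta> (v, p) \<in> solution_map f \<phi> v p" if vp: "v \<in> V" "p \<in> Q" for v p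
  proof -
    obtain x where "x \<in> ball xb \<epsilon>" "feasible x p \<and> (\<exists>\<mu>. multiplier x p v \<mu>)"
      using \<delta>2(2)[OF Q_sub(3)[OF vp(2)] V_sub(3)[OF vp(1)]] by blast
    then have "x \<in> U \<and> x \<in> solution_map f \<phi> v p" using sol[of x p v] vp by (auto simp: U_def)
    then show "\<theta> (v, p) \<in> U" "\<theta> (v, p) \<in> solution_map f \<phi> v p"
      unfolding \<theta>_def using someI[of "\<lambda>x. x \<in> U \<and> x \<in> solution_map f \<phi> v p"] by auto
  qed
  have p_lip: "norm (\<theta> (v, p) - \<theta> (v, q)) \<le> C * norm (p - q)" if v: "v \<in> V" and pq: "p \<in> Q" "q \<in> Q" for v p q
  proof -
    define \<gamma> where "\<gamma> t = p + t *\<^sub>R (q - p)" for t :: real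
    have \<gamma>: "\<gamma> t \<in> Q" if "t \<in> {0..1}" for t
    proof -
      have "(1 - t) *\<^sub>R p + t *\<^sub>R q \<in> Q" using that pq unfolding Q_def by (intro convexD) auto
      then show ?thesis by (simp add: \<gamma>_def algebra_simps)
    qed
    define g where "g t = \<theta> (v, \<gamma> t)" for t
    have gU: "g t \<in> U" and gS: "g t \<in> solution_map f \<phi> v (\<gamma> t)" if "t \<in> {0..1}" for t
      using \<theta>[OF v \<gamma>[OF that]] by (auto simp: g_def)
    \<comment> \<open>The parameters on the segment whose solution has a multiplier supported in \<open>J\<close>, with all of \<open>J\<close> active.\<close>
    define Piece where "Piece J = {t \<in> {0..1}. \<exists>\<mu>. multiplier (g t) (\<gamma> t) v \<mu> \<and> (\<forall>i. i \<notin> J \<longrightarrow> \<mu> $ i = 0) \<and>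
      (\<forall>i\<in>J. \<phi> i (g t, \<gamma> t) = 0)}" for J
    have "lipschitz_on (C * norm (p - q)) {0..1} g"
    proof (rule lipschitz_on_closed_Union[where I = "{J. good J}" and U = Piece])
      show "0 \<le> C * norm (p - q)" using C by simp
      show "finite {J. good J}" by simp
      show "lipschitz_on (C * norm (p - q)) (Piece J) g" if J: "J \<in> {J. good J}" for J
      proof (rule lipschitz_onI)
        fix s t assume s: "s \<in> Piece J" and t: "t \<in> Piece J"
        then have st: "s \<in> {0..1}" "t \<in> {0..1}" by (auto simp: Piece_def)
        obtain \<mu> where \<mu>: "multiplier (g s) (\<gamma> s) v \<mu>" "\<forall>i. i \<notin> J \<longrightarrow> \<mu> $ i = 0" "\<forall>i\<in>J. \<phi> i (g s, \<gamma> s) = 0"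
          using s by (auto simp: Piece_def)
        obtain \<nu> where \<nu>: "multiplier (g t) (\<gamma> t) v \<nu>" "\<forall>i. i \<notin> J \<longrightarrow> \<nu> $ i = 0" "\<forall>i\<in>J. \<phi> i (g t, \<gamma> t) = 0"
          using t by (auto simp: Piece_def)
        have "lipschitz_on_family J (Cf J) \<delta>1" using \<delta>1(2) J by simp
        then have "norm (g s - g t) \<le> Cf J * norm (\<gamma> s - \<gamma> t)"
          by (rule lipschitz_on_family_def[THEN iffD1, rule_format, OF _ Q_sub(1)[OF \<gamma>[OF st(1)]] Q_sub(1)[OF \<gamma>[OF st(2)]]
              V_sub(1)[OF v] U_sub(1)[OF gU[OF st(1)]] U_sub(1)[OF gU[OF st(2)]] \<mu>(1) \<nu>(1)])
            (use \<mu> \<nu> in auto)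
        also have "\<dots> \<le> C * norm (\<gamma> s - \<gamma> t)" using Cf_le by (intro mult_right_mono) auto
        also have "\<gamma> s - \<gamma> t = (s - t) *\<^sub>R (q - p)" by (simp add: \<gamma>_def algebra_simps)
        finally show "dist (g s) (g t) \<le> C * norm (p - q) * dist s t"
          by (simp add: dist_norm norm_minus_commute mult_ac)
      qed (use C in simp)
      show "closed (Piece J)" if J: "J \<in> {J. good J}" for J
        unfolding closed_sequential_limits
      proof (intro allI impI, elim conjE)
        fix T t assume T: "\<forall>k. T k \<in> Piece J" and lim: "T \<longlonglongrightarrow> t"
        have T01: "T k \<in> {0..1}" for k using T by (auto simp: Piece_def)
        have t01: "t \<in> {0..1}" using closed_sequentially[OF closed_atLeastAtMost T01 lim] .
        have "\<forall>k. \<exists>\<mu>. multiplier (g (T k)) (\<gamma> (T k)) v \<mu> \<and> (\<forall>i. i \<notin> J \<longrightarrow> \<mu> $ i = 0) \<and>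
            (\<forall>i\<in>J. \<phi> i (g (T k), \<gamma> (T k)) = 0)"
          using T unfolding Piece_def by blast
        then obtain M where M: "\<And>k. multiplier (g (T k)) (\<gamma> (T k)) v (M k)"
            "\<And>k i. i \<notin> J \<Longrightarrow> M k $ i = 0" "\<And>k i. i \<in> J \<Longrightarrow> \<phi> i (g (T k), \<gamma> (T k)) = 0"
          by metis
        have "bounded (range (\<lambda>k. g (T k)))"
          using gU T01 by (intro bounded_subset[OF bounded_cball[of xb \<epsilon>]]) (auto simp: U_def)
        then obtain y s where s: "strict_mono s" "((\<lambda>k. g (T k)) \<circ> s) \<longlonglongrightarrow> y"
          using bounded_imp_convergent_subsequence by blast
        define X where "X k = g (T (s k))" for k
        define P where "P k = \<gamma> (T (s k))" for k
        have X: "X \<longlonglongrightarrow> y" using s(2) by (simp add: X_def[abs_def] comp_def)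
        have "(\<lambda>k. T (s k)) \<longlonglongrightarrow> t" using LIMSEQ_subseq_LIMSEQ[OF lim s(1)] by (simp add: comp_def)
        then have P: "P \<longlonglongrightarrow> \<gamma> t" unfolding P_def[abs_def] \<gamma>_def by (intro tendsto_intros)
        have yU: "y \<in> U"
          unfolding U_def by (rule closed_sequentially[OF closed_cball _ X]) (use gU T01 in \<open>auto simp: X_def U_def\<close>)
        have nk: "near (X k) (P k)" for k
          unfolding X_def P_def by (rule near[OF gU[OF T01] \<gamma>[OF T01]])
        have ny: "near y (\<gamma> t)" by (rule near[OF yU \<gamma>[OF t01]])
        have m: "multiplier (X k) (P k) v (M (s k))" for k using M(1) by (simp add: X_def P_def)
        obtain \<mu> s' where \<mu>: "strict_mono (s'::nat \<Rightarrow> nat)" "((\<lambda>k. M (s k)) \<circ> s') \<longlonglongrightarrow> \<mu>" "multiplier y (\<gamma> t) v \<mu>"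
          by (rule multiplier_closed[of X P "\<lambda>_. v" "\<lambda>k. M (s k)" y "\<gamma> t" v]) (use m nk X P ny in auto)
        have \<phi>lim: "(\<lambda>k. \<phi> i (X k, P k)) \<longlonglongrightarrow> \<phi> i (y, \<gamma> t)" for i
          using ny by (intro tendsto_\<phi> X P) auto
        have "\<phi> i (X k, P k) \<le> 0" for i k
          using sol[OF gU[OF T01[of "s k"]] \<gamma>[OF T01[of "s k"]], of v] gS[OF T01[of "s k"]]
          by (simp add: X_def P_def feasible_def)
        then have "feasible y (\<gamma> t)"
          unfolding feasible_def by (intro allI LIMSEQ_le_const2[OF \<phi>lim]) auto
        then have "y \<in> solution_map f \<phi> v (\<gamma> t)" using sol[OF yU \<gamma>[OF t01]] \<mu>(3) by blast
        \<comment> \<open>Uniqueness identifies the limit, which shows continuity of the solution along the way.\<close>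
        then have y: "g t = y" using unique[OF gU[OF t01] yU \<gamma>[OF t01] v gS[OF t01]] by simp
        have "\<mu> $ i = 0" if "i \<notin> J" for i
        proof -
          have "(\<lambda>k. M (s (s' k)) $ i) \<longlonglongrightarrow> \<mu> $ i" using \<mu>(2) unfolding comp_def by (rule tendsto_vec_nth)
          then show ?thesis using M(2)[OF that] by (simp add: LIMSEQ_const_iff)
        qed
        moreover have "\<phi> i (y, \<gamma> t) = 0" if "i \<in> J" for i
          using \<phi>lim[of i] M(3)[OF that] by (simp add: X_def P_def LIMSEQ_const_iff)
        ultimately show "t \<in> Piece J" using t01 \<mu>(3) unfolding Piece_def y[symmetric] by blast
      qed
      show "{0..1} \<subseteq> (\<Union>J\<in>{J. good J}. Piece J)"
      proof
        fix t :: real assume t: "t \<in> {0..1}"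
        obtain a where a: "multiplier (g t) (\<gamma> t) v a" using sol[OF gU[OF t] \<gamma>[OF t]] gS[OF t] by blast
        have n: "near (g t) (\<gamma> t)" by (rule near[OF gU[OF t] \<gamma>[OF t]])
        obtain b where b: "\<And>i. 0 \<le> b $ i" "\<And>i. a $ i = 0 \<Longrightarrow> b $ i = 0"
          "(\<Sum>i\<in>UNIV. (b $ i) *\<^sub>R G i (g t, \<gamma> t)) = (\<Sum>i\<in>UNIV. (a $ i) *\<^sub>R G i (g t, \<gamma> t))"
          "family_independent (\<lambda>i. G i (g t, \<gamma> t)) {i. b $ i \<noteq> 0}"
          using conic_caratheodory[of a "\<lambda>i. G i (g t, \<gamma> t)"] multiplier_nonneg[OF a] by blast
        have comp: "b $ i * \<phi> i (g t, \<gamma> t) = 0" for i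
          using b(2)[of i] multiplier_complementary[OF a, of i] by auto
        have mb: "multiplier (g t) (\<gamma> t) v b"
          using a b(1,3) comp by (simp add: multiplier_def normal_multiplier_def)
        have act: "\<phi> i (xb, pb) = 0" if "i \<in> {i. b $ i \<noteq> 0}" for i
          using normal_multiplier_inactive[OF mb[unfolded multiplier_def] n] that by blast
        then have "good {i. b $ i \<noteq> 0}"
          unfolding good_def using rank[OF n act b(4)] by blast
        moreover have "t \<in> Piece {i. b $ i \<noteq> 0}"
          using t mb comp unfolding Piece_def by auto
        ultimately show "t \<in> (\<Union>J\<in>{J. good J}. Piece J)" by blast
      qed
    qed
    then have "dist (g 0) (g 1) \<le> C * norm (p - q) * dist (0::real) 1"
      by (rule lipschitz_onD) auto
    then show ?thesis by (simp add: g_def \<gamma>_def dist_norm)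
  qed
  define l where "l = 2 * \<kappa> * C + 1"
  have l: "0 < l" using C \<kappa> by (simp add: l_def add_nonneg_pos)
  have bound: "norm ((v1 - v2) - (2 * \<kappa>) *\<^sub>R (\<theta> (v1, p1) - \<theta> (v2, p2))) \<le> norm (v1 - v2) + l * norm (p1 - p2)"
    if "v1 \<in> V" "v2 \<in> V" "p1 \<in> Q" "p2 \<in> Q" for v1 v2 p1 p2
  proof -
    have "\<kappa> * (norm (\<theta> (v1, p1) - \<theta> (v2, p1)))\<^sup>2 \<le> (v1 - v2) \<bullet> (\<theta> (v1, p1) - \<theta> (v2, p1))"
      by (rule strong) (use \<theta> that in auto)
    then have 1: "norm ((v1 - v2) - (2 * \<kappa>) *\<^sub>R (\<theta> (v1, p1) - \<theta> (v2, p1))) \<le> norm (v1 - v2)"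
      using norm_diff_scaleR_le_iff[OF \<kappa>(1)] by blast
    have "norm ((2 * \<kappa>) *\<^sub>R (\<theta> (v2, p1) - \<theta> (v2, p2))) = 2 * \<kappa> * norm (\<theta> (v2, p1) - \<theta> (v2, p2))"
      using \<kappa> by simp
    also have "\<dots> \<le> 2 * \<kappa> * (C * norm (p1 - p2))" using p_lip that \<kappa> by (intro mult_left_mono) auto
    also have "\<dots> \<le> l * norm (p1 - p2)" by (simp add: l_def algebra_simps)
    finally have 2: "norm ((2 * \<kappa>) *\<^sub>R (\<theta> (v2, p1) - \<theta> (v2, p2))) \<le> l * norm (p1 - p2)" .
    have eq: "(v1 - v2) - (2 * \<kappa>) *\<^sub>R (\<theta> (v1, p1) - \<theta> (v2, p2)) =
      ((v1 - v2) - (2 * \<kappa>) *\<^sub>R (\<theta> (v1, p1) - \<theta> (v2, p1))) - (2 * \<kappa>) *\<^sub>R (\<theta> (v2, p1) - \<theta> (v2, p2))"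
      by (simp add: algebra_simps)
    show ?thesis
      unfolding eq by (rule order_trans[OF norm_triangle_ineq4 add_mono[OF 1 2]])
  qed
  have "xb \<in> solution_map f \<phi> vb pb"
    using solution_iff[OF near_base] base_solution base_feasible by (simp add: feasible_def multiplier_def)
  moreover have "vb \<in> interior V" "pb \<in> interior Q" "xb \<in> interior U"
    using \<delta> \<epsilon> by (auto simp: V_def Q_def U_def interior_open interior_cball)
  moreover have "\<theta> \<in> V \<times> Q \<rightarrow> U" using \<theta> by auto
  moreover have "{(v, p, x). v \<in> V \<and> p \<in> Q \<and> x = \<theta> (v, p)} =
      {(v, p, x). x \<in> solution_map f \<phi> v p} \<inter> (V \<times> Q \<times> U)"
    using \<theta> unique by fastforce
  ultimately show ?thesis
    unfolding lipschitzian_fully_stable_def using \<kappa>(1) l bound by blast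
qed

end

section \<open>Necessity of the second-order condition\<close>

context parametric_constraints
begin

text \<open>Follow the ray \<open>xb + s w\<close> and correct it onto the zero set of the constraints in \<open>J\<close>. As \<open>w\<close> is tangent to this set the
residual, and hence the correction, is \<open>O(s\<^sup>2)\<close>, which neither changes the tangent nor spoils the strict inequalities
obtained at first order for the other active constraints.\<close>

lemma feasible_arc:
  assumes J: "family_independent (\<lambda>i. G i (xb, pb)) J" "\<And>i. i \<in> J \<Longrightarrow> \<phi> i (xb, pb) = 0"
    and tangent: "\<And>i. i \<in> J \<Longrightarrow> G i (xb, pb) \<bullet> w = 0"
    and inward: "\<And>i. \<phi> i (xb, pb) = 0 \<Longrightarrow> i \<notin> J \<Longrightarrow> G i (xb, pb) \<bullet> w < 0"
  obtains X where "\<forall>\<^sub>F s in at_right (0::real). feasible (X s) pb \<and> (\<forall>i\<in>J. \<phi> i (X s, pb) = 0)"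
    "((\<lambda>s. (X s - xb) /\<^sub>R s) \<longlongrightarrow> w) (at_right 0)" "(X \<longlongrightarrow> xb) (at_right 0)"
proof -
  obtain c where c: "0 < c" and c_corr: "\<forall>\<^sub>F \<delta> in at_right 0. \<forall>x\<in>ball xb \<delta>. \<forall>p\<in>ball pb \<delta>.
    \<exists>x'. (\<forall>i\<in>J. \<phi> i (x', p) = 0) \<and> norm (x' - x) \<le> c * (\<Sum>i\<in>J. \<bar>\<phi> i (x, p)\<bar>)"
    using correction_to_active_manifold[OF J] by blast
  have "\<forall>\<^sub>F \<delta> in at_right 0. (\<forall>x\<in>ball xb \<delta>. \<forall>p\<in>ball pb \<delta>.
    \<exists>x'. (\<forall>i\<in>J. \<phi> i (x', p) = 0) \<and> norm (x' - x) \<le> c * (\<Sum>i\<in>J. \<bar>\<phi> i (x, p)\<bar>)) \<and> \<delta> \<le> r"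
    using c_corr eventually_ball_near by (rule eventually_conj)
  then obtain \<delta> where \<delta>: "0 < \<delta>" "\<delta> \<le> r" and corr: "\<And>x. x\<in>ball xb \<delta> \<Longrightarrow>
    \<exists>x'. (\<forall>i\<in>J. \<phi> i (x', pb) = 0) \<and> norm (x' - x) \<le> c * (\<Sum>i\<in>J. \<bar>\<phi> i (x, pb)\<bar>)"
    by (rule eventually_at_right_witness) auto
  define line where "line s = xb + s *\<^sub>R w" for s :: real
  define C where "C = c * (real (card J) * (K * (norm w)\<^sup>2))"
  define X where "X s = (SOME x. (\<forall>i\<in>J. \<phi> i (x, pb) = 0) \<and> norm (x - line s) \<le> c * (\<Sum>i\<in>J. \<bar>\<phi> i (line s, pb)\<bar>))" for s
  have line: "(line \<longlongrightarrow> xb) (at_right 0)"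
    unfolding line_def[abs_def] by (auto intro!: tendsto_eq_intros)
  have pos: "\<forall>\<^sub>F s in at_right (0::real). 0 < s" by (rule eventually_at_right_less)
  have line_in: "\<forall>\<^sub>F s in at_right 0. line s \<in> ball xb \<delta>"
    using \<delta> by (intro topological_tendstoD[OF line]) auto
  have X: "\<forall>\<^sub>F s in at_right 0. (\<forall>i\<in>J. \<phi> i (X s, pb) = 0) \<and> norm (X s - line s) \<le> C * s\<^sup>2"
    using line_in
  proof eventually_elim
    case (elim s)
    have Xs: "(\<forall>i\<in>J. \<phi> i (X s, pb) = 0) \<and> norm (X s - line s) \<le> c * (\<Sum>i\<in>J. \<bar>\<phi> i (line s, pb)\<bar>)"
      unfolding X_def by (rule someI_ex[OF corr[OF elim]])
    have "(\<Sum>i\<in>J. \<bar>\<phi> i (line s, pb)\<bar>) \<le> (\<Sum>i\<in>J. K * (norm w)\<^sup>2 * s\<^sup>2)"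
    proof (rule sum_mono)
      fix i assume i: "i \<in> J"
      have "\<bar>\<phi> i (line s, pb) - \<phi> i (xb, pb) - G i (xb, pb) \<bullet> (line s - xb)\<bar> \<le> K * (norm (line s - xb))\<^sup>2"
        using elim \<delta> r_pos by (intro first_order_expansion) auto
      then show "\<bar>\<phi> i (line s, pb)\<bar> \<le> K * (norm w)\<^sup>2 * s\<^sup>2"
        using J(2)[OF i] tangent[OF i] by (simp add: line_def power_mult_distrib mult_ac)
    qed
    then have "c * (\<Sum>i\<in>J. \<bar>\<phi> i (line s, pb)\<bar>) \<le> C * s\<^sup>2"
      using c by (simp add: C_def mult_ac mult_left_mono)
    then show ?case using Xs by auto
  qed
  have quot: "((\<lambda>s. (X s - xb) /\<^sub>R s) \<longlongrightarrow> w) (at_right 0)"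
  proof (rule LIM_zero_cancel, rule Lim_null_comparison)
    show "\<forall>\<^sub>F s in at_right 0. norm ((X s - xb) /\<^sub>R s - w) \<le> C * s"
      using X pos
    proof eventually_elim
      case (elim s)
      have "(X s - xb) /\<^sub>R s - w = (X s - line s) /\<^sub>R s" using elim by (simp add: line_def algebra_simps)
      then have "norm ((X s - xb) /\<^sub>R s - w) = norm (X s - line s) / s"
        using elim by (simp add: divide_inverse mult.commute)
      also have "\<dots> \<le> C * s\<^sup>2 / s" using elim by (intro divide_right_mono) auto
      finally show ?case using elim by (simp add: power2_eq_square)
    qed
    show "((\<lambda>s. C * s) \<longlongrightarrow> 0) (at_right 0)" by (auto intro!: tendsto_eq_intros)
  qed
  have X_lim: "(X \<longlongrightarrow> xb) (at_right 0)"
  proof -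
    have "((\<lambda>s. s *\<^sub>R ((X s - xb) /\<^sub>R s)) \<longlongrightarrow> 0 *\<^sub>R w) (at_right 0)"
      by (intro tendsto_intros quot)
    moreover have "\<forall>\<^sub>F s in at_right 0. s *\<^sub>R ((X s - xb) /\<^sub>R s) = X s - xb"
      using pos by eventually_elim simp
    ultimately have "((\<lambda>s. X s - xb) \<longlongrightarrow> 0) (at_right 0)"
      by (simp add: tendsto_cong)
    then show ?thesis by (rule LIM_zero_cancel)
  qed
  have X_near: "\<forall>\<^sub>F s in at_right 0. X s \<in> ball xb r"
    using r_pos by (intro topological_tendstoD[OF X_lim]) auto
  have "\<forall>\<^sub>F s in at_right 0. \<forall>i. \<phi> i (X s, pb) \<le> 0"
  proof (rule eventually_all_finite)
    fix i
    consider "i \<in> J" | "\<phi> i (xb, pb) < 0" | "\<phi> i (xb, pb) = 0" "i \<notin> J" using base_feasible[of i] by force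
    then show "\<forall>\<^sub>F s in at_right 0. \<phi> i (X s, pb) \<le> 0"
    proof cases
      case 1
      then show ?thesis using X by (auto elim!: eventually_mono)
    next
      case 2
      show ?thesis using X_near by eventually_elim (use inactive[OF 2] r_pos in \<open>auto intro: less_imp_le\<close>)
    next
      case 3
      have "((\<lambda>s. G i (xb, pb) \<bullet> ((X s - xb) /\<^sub>R s) + K * s * (norm ((X s - xb) /\<^sub>R s))\<^sup>2) \<longlongrightarrow>
          G i (xb, pb) \<bullet> w + K * 0 * (norm w)\<^sup>2) (at_right 0)"
        by (intro tendsto_intros quot)
      then have "\<forall>\<^sub>F s in at_right 0. G i (xb, pb) \<bullet> ((X s - xb) /\<^sub>R s) + K * s * (norm ((X s - xb) /\<^sub>R s))\<^sup>2 < 0"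
        by (rule order_tendstoD) (use inward[OF 3] in simp)
      then show ?thesis using pos X_near
      proof eventually_elim
        case (elim s)
        define h where "h = (X s - xb) /\<^sub>R s"
        have h: "X s - xb = s *\<^sub>R h" using elim by (simp add: h_def)
        have "\<phi> i (X s, pb) - G i (xb, pb) \<bullet> (X s - xb) \<le> K * (norm (X s - xb))\<^sup>2"
          using first_order_expansion[of xb "X s" pb i] elim r_pos 3 by simp
        then have "\<phi> i (X s, pb) \<le> s * (G i (xb, pb) \<bullet> h + K * s * (norm h)\<^sup>2)"
          unfolding h by (simp add: power_mult_distrib power2_eq_square algebra_simps)
        also have "\<dots> \<le> 0" using elim unfolding h_def by (simp add: mult_nonneg_nonpos less_imp_le)
        finally show ?case .
      qed
    qed
  qed
  then have "\<forall>\<^sub>F s in at_right 0. feasible (X s) pb \<and> (\<forall>i\<in>J. \<phi> i (X s, pb) = 0)"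
    using X by eventually_elim (auto simp: feasible_def)
  then show thesis using that quot X_lim by blast
qed

end

context parametric_variational
begin

text \<open>With equal multipliers no constraint values enter, and the difference of the Lagrangians is expanded directly.\<close>

lemma quadratic_upper_bound:
  assumes "0 < e"
  shows "\<forall>\<^sub>F \<delta> in at_right 0. \<forall>x1\<in>ball xb \<delta>. \<forall>x2\<in>ball xb \<delta>. \<forall>p\<in>ball pb \<delta>. \<forall>v1 v2 \<mu>.
    multiplier x1 p v1 \<mu> \<longrightarrow> multiplier x2 p v2 \<mu> \<longrightarrow>
    (v1 - v2) \<bullet> (x1 - x2) \<le> curvature \<mu> (x1 - x2) + e * (1 + (\<Sum>i\<in>UNIV. \<mu> $ i)) * (norm (x1 - x2))\<^sup>2"
proof -
  have "\<forall>\<^sub>F \<delta> in at_right 0. \<forall>i. \<forall>x\<in>ball xb \<delta>. \<forall>x'\<in>ball xb \<delta>. \<forall>p\<in>ball pb \<delta>.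
       norm (G i (x, p) - G i (x', p) - H i (x - x')) \<le> e * norm (x - x')"
    by (intro eventually_all_finite strict_partial_derivativeD[OF G_strict] assms)
  with strict_partial_derivativeD[OF f_strict assms] show ?thesis
  proof eventually_elim
    case (elim \<delta>)
    show ?case
    proof (intro ballI allI impI)
      fix x1 x2 p v1 v2 \<mu>
      assume x: "x1 \<in> ball xb \<delta>" "x2 \<in> ball xb \<delta>" "p \<in> ball pb \<delta>"
        and m: "multiplier x1 p v1 \<mu>" "multiplier x2 p v2 \<mu>"
      define h where "h = x1 - x2"
      have est: "(a - b) \<bullet> h \<le> h \<bullet> L h + e * (norm h)\<^sup>2"
        if "norm (a - b - L h) \<le> e * norm h" for a b and L :: "'a \<Rightarrow> 'a"
      proof -
        have "(a - b - L h) \<bullet> h \<le> norm (a - b - L h) * norm h" by (rule norm_cauchy_schwarz)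
        also have "\<dots> \<le> e * norm h * norm h" using that by (intro mult_right_mono) auto
        finally show ?thesis by (simp add: inner_diff_left inner_diff_right inner_commute power2_eq_square)
      qed
      have F: "(f (x1, p) - f (x2, p)) \<bullet> h \<le> h \<bullet> A h + e * (norm h)\<^sup>2"
        using elim(1) x by (intro est) (auto simp: h_def)
      have Gi: "\<mu> $ i * ((G i (x1, p) - G i (x2, p)) \<bullet> h) \<le> \<mu> $ i * (h \<bullet> H i h + e * (norm h)\<^sup>2)" for i
        using elim(2) x by (intro mult_left_mono est multiplier_nonneg[OF m(1)]) (auto simp: h_def)
      have "(v1 - v2) \<bullet> h = (f (x1, p) - f (x2, p)) \<bullet> h + (\<Sum>i\<in>UNIV. \<mu> $ i * ((G i (x1, p) - G i (x2, p)) \<bullet> h))"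
        unfolding multiplier_sum[OF m(1)] multiplier_sum[OF m(2)]
        by (simp add: inner_diff_left inner_add_left inner_sum_left sum_subtractf right_diff_distrib)
      also have "\<dots> \<le> (h \<bullet> A h + e * (norm h)\<^sup>2) + (\<Sum>i\<in>UNIV. \<mu> $ i * (h \<bullet> H i h + e * (norm h)\<^sup>2))"
        using F Gi by (intro add_mono sum_mono) auto
      also have "(\<Sum>i\<in>UNIV. \<mu> $ i * (h \<bullet> H i h + e * (norm h)\<^sup>2)) =
          (\<Sum>i\<in>UNIV. \<mu> $ i * (h \<bullet> H i h)) + (\<Sum>i\<in>UNIV. \<mu> $ i) * (e * (norm h)\<^sup>2)"
        by (simp add: distrib_left sum.distrib sum_distrib_right)
      finally show "(v1 - v2) \<bullet> (x1 - x2) \<le> curvature \<mu> (x1 - x2)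
          + e * (1 + (\<Sum>i\<in>UNIV. \<mu> $ i)) * (norm (x1 - x2))\<^sup>2"
        unfolding curvature_def
        unfolding h_def[symmetric] by (simp add: algebra_simps)
    qed
  qed
qed

theorem fully_stable_imp_second_order:
  assumes stable: "lipschitzian_fully_stable f \<phi> xb vb pb"
    and licq: "family_independent (\<lambda>i. G i (xb, pb)) {i. \<phi> i (xb, pb) = 0}"
  shows strong_second_order
  unfolding strong_second_order_def
proof (intro allI impI, elim conjE)
  fix \<mu> u assume \<mu>: "multiplier xb pb vb \<mu>" and u: "u \<noteq> 0" and orth: "\<forall>i. 0 < \<mu> $ i \<longrightarrow> G i (xb, pb) \<bullet> u = 0"
  obtain V Q U \<kappa> l \<theta> where V: "vb \<in> interior V" and Q: "pb \<in> interior Q" and U: "xb \<in> interior U"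
    and \<kappa>: "0 < \<kappa>"
    and graph: "{(v, p, x). v \<in> V \<and> p \<in> Q \<and> x = \<theta> (v, p)} = {(v, p, x). x \<in> solution_map f \<phi> v p} \<inter> (V \<times> Q \<times> U)"
    and bound: "\<forall>v1\<in>V. \<forall>v2\<in>V. \<forall>p1\<in>Q. \<forall>p2\<in>Q.
      norm ((v1 - v2) - (2 * \<kappa>) *\<^sub>R (\<theta> (v1, p1) - \<theta> (v2, p2))) \<le> norm (v1 - v2) + l * norm (p1 - p2)"
    using stable unfolding lipschitzian_fully_stable_def by blast
  have pQ: "pb \<in> Q" using Q interior_subset by blast
  have mono: "\<kappa> * (norm (x1 - x2))\<^sup>2 \<le> (v1 - v2) \<bullet> (x1 - x2)"
    if s: "v1 \<in> V" "v2 \<in> V" "x1 \<in> U" "x2 \<in> U" "x1 \<in> solution_map f \<phi> v1 pb" "x2 \<in> solution_map f \<phi> v2 pb"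
    for x1 x2 v1 v2
  proof -
    have "(v1, pb, x1) \<in> {(v, p, x). v \<in> V \<and> p \<in> Q \<and> x = \<theta> (v, p)}"
      "(v2, pb, x2) \<in> {(v, p, x). v \<in> V \<and> p \<in> Q \<and> x = \<theta> (v, p)}"
      unfolding graph using s pQ by auto
    then have \<theta>: "\<theta> (v1, pb) = x1" "\<theta> (v2, pb) = x2" by auto
    have "norm ((v1 - v2) - (2 * \<kappa>) *\<^sub>R (\<theta> (v1, pb) - \<theta> (v2, pb))) \<le> norm (v1 - v2) + l * norm (pb - pb)"
      using bound s(1,2) pQ by blast
    then have "norm ((v1 - v2) - (2 * \<kappa>) *\<^sub>R (x1 - x2)) \<le> norm (v1 - v2)" unfolding \<theta> by simp
    then show ?thesis using norm_diff_scaleR_le_iff[OF \<kappa>] by blast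
  qed
  define I where "I = {i. \<phi> i (xb, pb) = 0}"
  define J where "J = {i. 0 < \<mu> $ i}"
  have JI: "J \<subseteq> I" using multiplier_complementary[OF \<mu>] by (force simp: J_def I_def)
  have Jind: "family_independent (\<lambda>i. G i (xb, pb)) J"
    using family_independent_mono[OF licq] JI by (simp add: I_def)
  have \<mu>0: "\<mu> $ i = 0" if "i \<notin> J" for i using that multiplier_nonneg[OF \<mu>, of i] by (simp add: J_def)
  obtain e where e: "\<And>i j. i \<in> I \<Longrightarrow> j \<in> I \<Longrightarrow> G i (xb, pb) \<bullet> e j = (if i = j then 1 else 0)"
    using family_independent_dual[OF licq] unfolding I_def by blast
  \<comment> \<open>Both \<open>w\<close> and \<open>w + u\<close> point strictly into the constraints without positive multiplier.\<close>
  define w where "w = (\<Sum>j\<in>I - J. (- \<bar>G j (xb, pb) \<bullet> u\<bar> - 1) *\<^sub>R e j)"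
  have Gw: "G i (xb, pb) \<bullet> w = (if i \<in> J then 0 else - \<bar>G i (xb, pb) \<bullet> u\<bar> - 1)" if i: "i \<in> I" for i
  proof -
    have "G i (xb, pb) \<bullet> w = (\<Sum>j\<in>I - J. if i = j then - \<bar>G j (xb, pb) \<bullet> u\<bar> - 1 else 0)"
      unfolding w_def inner_sum_right using e i by (intro sum.cong) auto
    then show ?thesis using i by simp
  qed
  have tangent: "G i (xb, pb) \<bullet> w = 0" "G i (xb, pb) \<bullet> (w + u) = 0" if "i \<in> J" for i
    using Gw[of i] that JI orth by (auto simp: J_def inner_add_right)
  have inward: "G i (xb, pb) \<bullet> w < 0" "G i (xb, pb) \<bullet> (w + u) < 0" if "\<phi> i (xb, pb) = 0" "i \<notin> J" for i
    using Gw[of i] that by (auto simp: I_def inner_add_right)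
  have J0: "\<phi> i (xb, pb) = 0" if "i \<in> J" for i using that JI by (auto simp: I_def)
  obtain Y where Y: "\<forall>\<^sub>F s in at_right (0::real). feasible (Y s) pb \<and> (\<forall>i\<in>J. \<phi> i (Y s, pb) = 0)"
    "((\<lambda>s. (Y s - xb) /\<^sub>R s) \<longlongrightarrow> w) (at_right 0)" "(Y \<longlongrightarrow> xb) (at_right 0)"
    by (rule feasible_arc[OF Jind J0 tangent(1) inward(1)])
  obtain X where X: "\<forall>\<^sub>F s in at_right (0::real). feasible (X s) pb \<and> (\<forall>i\<in>J. \<phi> i (X s, pb) = 0)"
    "((\<lambda>s. (X s - xb) /\<^sub>R s) \<longlongrightarrow> w + u) (at_right 0)" "(X \<longlongrightarrow> xb) (at_right 0)"
    by (rule feasible_arc[OF Jind J0 tangent(2) inward(2)])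
  define val where "val x = f (x, pb) + (\<Sum>i\<in>UNIV. (\<mu> $ i) *\<^sub>R G i (x, pb))" for x
  have val_mult: "multiplier x pb (val x) \<mu>" if "\<forall>i\<in>J. \<phi> i (x, pb) = 0" for x
    unfolding multiplier_def normal_multiplier_def
    using multiplier_nonneg[OF \<mu>] \<mu>0 that by (auto simp: val_def)
  have good: "\<forall>\<^sub>F s in at_right 0. Z s \<in> solution_map f \<phi> (val (Z s)) pb \<and> multiplier (Z s) pb (val (Z s)) \<mu> \<and>
      val (Z s) \<in> V \<and> Z s \<in> U"
    if Z: "\<forall>\<^sub>F s in at_right (0::real). feasible (Z s) pb \<and> (\<forall>i\<in>J. \<phi> i (Z s, pb) = 0)"
      and Z_lim: "(Z \<longlongrightarrow> xb) (at_right 0)" for Z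
  proof -
    have "\<forall>\<^sub>F s in at_right 0. Z s \<in> ball xb r" using r_pos by (intro topological_tendstoD[OF Z_lim]) auto
    then have ev: "\<forall>\<^sub>F s in at_right 0. near (Z s) pb" using r_pos by simp
    have "((\<lambda>s. val (Z s)) \<longlongrightarrow> val xb) (at_right 0)"
      unfolding val_def using r_pos by (intro tendsto_intros tendsto_f tendsto_G Z_lim) auto
    moreover have "val xb = vb" using multiplier_sum[OF \<mu>] by (simp add: val_def)
    ultimately have "((\<lambda>s. val (Z s)) \<longlongrightarrow> vb) (at_right 0)" by simp
    then have "\<forall>\<^sub>F s in at_right 0. val (Z s) \<in> interior V" using V by (intro topological_tendstoD) auto
    moreover have "\<forall>\<^sub>F s in at_right 0. Z s \<in> interior U" using U by (intro topological_tendstoD[OF Z_lim]) auto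
    ultimately show ?thesis using Z ev
    proof eventually_elim
      case (elim s)
      then show ?case
        using val_mult[of "Z s"] solution_iff[of "Z s" pb] interior_subset by blast
    qed
  qed
  define t where "t = 1 + (\<Sum>i\<in>UNIV. \<mu> $ i)"
  have t: "0 < t" using multiplier_nonneg[OF \<mu>] by (auto simp: t_def intro!: add_pos_nonneg sum_nonneg)
  \<comment> \<open>The error of the expansion then uses up only half of the modulus \<open>\<kappa>\<close>.\<close>
  define \<epsilon> where "\<epsilon> = \<kappa> / (2 * t)"
  have \<epsilon>: "0 < \<epsilon>" "\<epsilon> * t = \<kappa> / 2" using \<kappa> t by (auto simp: \<epsilon>_def)
  define D where "D s = (X s - Y s) /\<^sub>R s" for s
  have D: "(D \<longlongrightarrow> u) (at_right 0)"
    using tendsto_diff[OF X(2) Y(2)] by (simp add: D_def[abs_def] scaleR_right_diff_distrib)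
  have "\<kappa> / 2 * (norm u)\<^sup>2 \<le> curvature \<mu> u"
  proof (rule tendsto_le[OF trivial_limit_at_right_real])
    show "((\<lambda>s. \<kappa> / 2 * (norm (D s))\<^sup>2) \<longlongrightarrow> \<kappa> / 2 * (norm u)\<^sup>2) (at_right 0)"
      by (intro tendsto_intros D)
    show "((\<lambda>s. curvature \<mu> (D s)) \<longlongrightarrow> curvature \<mu> u) (at_right 0)"
      by (intro tendsto_curvature tendsto_const D)
    show "\<forall>\<^sub>F s in at_right 0. \<kappa> / 2 * (norm (D s))\<^sup>2 \<le> curvature \<mu> (D s)"
      using good[OF X(1,3)] good[OF Y(1,3)] eventually_at_right_less
        eventually_along_balls[OF quadratic_upper_bound[OF \<epsilon>(1)] X(3) Y(3) tendsto_const]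
    proof eventually_elim
      case (elim s)
      have h: "X s - Y s = s *\<^sub>R D s" using elim(3) by (simp add: D_def)
      have "\<kappa> * (norm (X s - Y s))\<^sup>2 \<le> (val (X s) - val (Y s)) \<bullet> (X s - Y s)"
        using elim(1,2) by (intro mono) auto
      also have "\<dots> \<le> curvature \<mu> (X s - Y s) + \<epsilon> * t * (norm (X s - Y s))\<^sup>2"
        unfolding t_def using elim(1,2) by (intro elim(4)[rule_format]) auto
      finally have "s\<^sup>2 * (\<kappa> / 2 * (norm (D s))\<^sup>2) \<le> s\<^sup>2 * curvature \<mu> (D s)"
        unfolding h curvature_scaleR \<epsilon>(2) by (simp add: power_mult_distrib algebra_simps)
      then show ?case using elim(3) by simp
    qed
  qed
  moreover have "0 < \<kappa> / 2 * (norm u)\<^sup>2" using \<kappa> u by simp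
  ultimately show "0 < curvature \<mu> u" by linarith
qed

end

section \<open>The variational condition with smooth data\<close>

text \<open>Choose one radius and one Lipschitz constant that serve all constraints and \<open>f\<close>, shrink the radius below a prescribed
\<open>R\<close>, and identify the second-order condition with its form in terms of \<open>curvature\<close>.\<close>

theorem parametric_variational_instance:
  fixes f :: "(real^'n) \<times> (real^'d) \<Rightarrow> real^'n"
    and \<phi> :: "'m::finite \<Rightarrow> (real^'n) \<times> (real^'d) \<Rightarrow> real"
    and xb vb :: "real^'n" and pb :: "real^'d"
  assumes sol: "xb \<in> solution_map f \<phi> vb pb"
    and phi_C2: "\<And>i. C2_smooth_around (\<phi> i) (xb, pb)"
    and f_diff: "\<forall>\<^sub>F (x, p) in nhds (xb, pb). (\<lambda>y. f (y, p)) differentiable (at x)"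
    and f_jac_cont: "isCont (jacobian_x f) (xb, pb)"
    and f_lip: "\<exists>U0 P0 L0. xb \<in> interior U0 \<and> pb \<in> interior P0 \<and> L0 > 0 \<and>
        (\<forall>x\<in>U0. \<forall>p1\<in>P0. \<forall>p2\<in>P0. norm (f (x, p1) - f (x, p2)) \<le> L0 * norm (p1 - p2))"
    and mfcq: "partial_MFCQ \<phi> (xb, pb)" and R: "0 < R"
  obtains H r K d \<eta> where "r \<le> R"
    "parametric_variational \<phi> (\<lambda>i. grad_x (\<phi> i)) H xb pb r K d \<eta> f ((*v) (jacobian_x f (xb, pb))) vb"
    "GSSOSC f \<phi> (xb, pb) vb \<longleftrightarrow>
      parametric_variational.strong_second_order \<phi> (\<lambda>i. grad_x (\<phi> i)) H xb pb f ((*v) (jacobian_x f (xb, pb))) vb"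
proof -
  define good where "good i r K H \<longleftrightarrow> 0 < r \<and> 0 < K \<and> linear H \<and>
    (\<forall>x\<in>ball xb r. \<forall>p\<in>ball pb r. GDERIV (\<lambda>y. \<phi> i (y, p)) x :> grad_x (\<phi> i) (x, p)) \<and>
    lipschitz_near K r (\<phi> i) xb pb \<and> lipschitz_near K r (grad_x (\<phi> i)) xb pb \<and>
    strict_partial_derivative (grad_x (\<phi> i)) H xb pb" for i r K H
  have "\<exists>r K H. good i r K H" for i
    by (rule C2_smooth_around_gradient[OF phi_C2[of i]]) (unfold good_def, blast)
  then obtain rf Kf H where good: "\<And>i. good i (rf i) (Kf i) (H i)" by metis
  have H_lin: "linear (H i)" for i using good by (simp add: good_def)
  define K0 where "K0 = (\<Sum>i\<in>UNIV. Kf i)"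
  have Kf: "0 < Kf i" "Kf i \<le> K0" for i
  proof -
    show "0 < Kf i" for i using good by (simp add: good_def)
    then show "Kf i \<le> K0" unfolding K0_def by (intro member_le_sum) (auto intro: less_imp_le)
  qed
  define r0 where "r0 = Min (range rf)"
  have r0: "0 < r0" "\<And>i. r0 \<le> rf i" using good by (auto simp: r0_def good_def)
  have gd: "GDERIV (\<lambda>y. \<phi> i (y, p)) x :> grad_x (\<phi> i) (x, p)" if "x \<in> ball xb r0" "p \<in> ball pb r0" for i x p
    using good[of i] that r0(2)[of i] by (auto simp: good_def)
  have lip: "lipschitz_near K0 r0 (\<phi> i) xb pb" "lipschitz_near K0 r0 (grad_x (\<phi> i)) xb pb" for i
    using good[of i] lipschitz_near_mono[OF _ r0(2)[of i] Kf(2)[of i]] by (auto simp: good_def)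
  have strict: "strict_partial_derivative (grad_x (\<phi> i)) (H i) xb pb" for i
    using good[of i] by (simp add: good_def)
  have \<phi>_cont: "isCont (\<phi> i) (xb, pb)" and g_cont: "isCont (grad_x (\<phi> i)) (xb, pb)" for i
    using tendsto_if_lipschitz_near[OF lip(1) tendsto_fst[OF tendsto_ident_at] tendsto_snd[OF tendsto_ident_at]]
      tendsto_if_lipschitz_near[OF lip(2) tendsto_fst[OF tendsto_ident_at] tendsto_snd[OF tendsto_ident_at]] r0(1)
    by (auto simp: isCont_def)
  define A where "A = jacobian_x f (xb, pb)"
  have A_lin: "linear ((*v) A)" by simp
  have f_strict: "strict_partial_derivative f ((*v) A) xb pb"
    unfolding A_def by (rule jacobian_strict[OF f_diff f_jac_cont])
  obtain U0 P0 L0 where UP: "xb \<in> interior U0" "pb \<in> interior P0" "0 < L0"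
    and L0: "\<And>x p1 p2. x \<in> U0 \<Longrightarrow> p1 \<in> P0 \<Longrightarrow> p2 \<in> P0 \<Longrightarrow> norm (f (x, p1) - f (x, p2)) \<le> L0 * norm (p1 - p2)"
    using f_lip by blast
  obtain r1 where r1: "0 < r1" "ball xb r1 \<subseteq> U0" using UP(1) by (auto simp: mem_interior)
  obtain r2 where r2: "0 < r2" "ball pb r2 \<subseteq> P0" using UP(2) by (auto simp: mem_interior)
  obtain r3 where r3: "0 < r3" and f1: "\<And>x x' p. x\<in>ball xb r3 \<Longrightarrow> x'\<in>ball xb r3 \<Longrightarrow> p\<in>ball pb r3 \<Longrightarrow>
       norm (f (x, p) - f (x', p) - A *v (x - x')) \<le> norm (x - x')"
    using strict_partial_derivativeD[OF f_strict zero_less_one] by (rule eventually_at_right_witness) simp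
  obtain B where B: "0 < B" "\<And>h. norm (A *v h) \<le> B * norm h"
    using linear_bounded_pos[OF A_lin] by blast
  define K where "K = K0 + (1 + B) + L0"
  have K0: "0 \<le> K0" unfolding K0_def using Kf(1) by (intro sum_nonneg) (auto intro: less_imp_le)
  have K: "0 < K" "K0 \<le> K" "1 + B \<le> K" "L0 \<le> K" using K0 B UP(3) by (auto simp: K_def)
  obtain d where d: "\<And>i. \<phi> i (xb, pb) = 0 \<Longrightarrow> grad_x (\<phi> i) (xb, pb) \<bullet> d < 0"
    using mfcq by (auto simp: partial_MFCQ_def active_set_def)
  have xb_feas: "\<phi> i (xb, pb) \<le> 0" for i
    using sol by (auto simp: solution_map_def limiting_normal_cone_def feasible_set_def split: if_splits)
  have "\<exists>\<eta>>0. \<forall>i. \<phi> i (xb, pb) = 0 \<longrightarrow> grad_x (\<phi> i) (xb, pb) \<bullet> d < - \<eta>"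
  proof -
    have "\<forall>\<^sub>F \<eta> in at_right 0. \<forall>i. \<phi> i (xb, pb) = 0 \<longrightarrow> grad_x (\<phi> i) (xb, pb) \<bullet> d < - \<eta>"
    proof (rule eventually_all_finite)
      fix i show "\<forall>\<^sub>F \<eta> in at_right 0. \<phi> i (xb, pb) = 0 \<longrightarrow> grad_x (\<phi> i) (xb, pb) \<bullet> d < - \<eta>"
      proof (cases "\<phi> i (xb, pb) = 0")
        case True
        then show ?thesis using d[OF True] by (intro eventually_at_rightI[of 0 "- (grad_x (\<phi> i) (xb, pb) \<bullet> d)"]) auto
      qed simp
    qed
    then show ?thesis by (rule eventually_at_right_witness) blast
  qed
  then obtain \<eta> where \<eta>: "0 < \<eta>" "\<And>i. \<phi> i (xb, pb) = 0 \<Longrightarrow> grad_x (\<phi> i) (xb, pb) \<bullet> d < - \<eta>" by blast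
  have "\<exists>\<rho>>0. \<forall>x\<in>ball xb \<rho>. \<forall>p\<in>ball pb \<rho>. (\<phi> i (xb, pb) = 0 \<longrightarrow> grad_x (\<phi> i) (x, p) \<bullet> d \<le> - \<eta>) \<and>
      (\<phi> i (xb, pb) < 0 \<longrightarrow> \<phi> i (x, p) < 0)" for i
  proof (cases "\<phi> i (xb, pb) = 0")
    case True
    have "isCont (\<lambda>z. grad_x (\<phi> i) z \<bullet> d) (xb, pb)" by (intro continuous_intros g_cont)
    then obtain \<rho> where "0 < \<rho>" "\<And>x p. x \<in> ball xb \<rho> \<Longrightarrow> p \<in> ball pb \<rho> \<Longrightarrow> grad_x (\<phi> i) (x, p) \<bullet> d \<in> {..<- \<eta>}"
      using isCont_pair_ball[of xb pb _ "{..<- \<eta>}"] \<eta>(2)[OF True] by (metis (lifting) lessThan_iff open_lessThan)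
    then show ?thesis using True by (intro exI[of _ \<rho>]) (auto intro: less_imp_le)
  next
    case False
    then have "\<phi> i (xb, pb) < 0" using xb_feas[of i] by simp
    then obtain \<rho> where "0 < \<rho>" "\<And>x p. x \<in> ball xb \<rho> \<Longrightarrow> p \<in> ball pb \<rho> \<Longrightarrow> \<phi> i (x, p) \<in> {..<0}"
      using isCont_pair_ball[OF \<phi>_cont, of "{..<0}"] by auto
    then show ?thesis using False by (intro exI[of _ \<rho>]) auto
  qed
  then obtain \<rho>f where \<rho>f: "\<And>i. 0 < \<rho>f i" and \<rho>f': "\<And>i x p. x \<in> ball xb (\<rho>f i) \<Longrightarrow> p \<in> ball pb (\<rho>f i) \<Longrightarrow>
     (\<phi> i (xb, pb) = 0 \<longrightarrow> grad_x (\<phi> i) (x, p) \<bullet> d \<le> - \<eta>) \<and> (\<phi> i (xb, pb) < 0 \<longrightarrow> \<phi> i (x, p) < 0)"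
    by metis
  define r4 where "r4 = Min (range \<rho>f)"
  have r4: "0 < r4" "\<And>i. r4 \<le> \<rho>f i" using \<rho>f by (auto simp: r4_def)
  define r where "r = min (min (min r0 r1) (min r2 r3)) (min r4 R)"
  have r: "0 < r" "r \<le> r0" "r \<le> r1" "r \<le> r2" "r \<le> r3" "r \<le> r4" "r \<le> R"
    using r0 r1 r2 r3 r4 R by (auto simp: r_def)
  have constraints: "parametric_constraints \<phi> (\<lambda>i. grad_x (\<phi> i)) H xb pb r K d \<eta>"
  proof (rule parametric_constraints.intro)
    show "0 < r" "0 < K" "0 < \<eta>" by fact+
    show "linear (H i)" "\<phi> i (xb, pb) \<le> 0" for i by (rule H_lin, rule xb_feas)
    show "lipschitz_near K r (\<phi> i) xb pb" "lipschitz_near K r (grad_x (\<phi> i)) xb pb" for i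
      by (rule lipschitz_near_mono[OF lip(1) r(2) K(2)], rule lipschitz_near_mono[OF lip(2) r(2) K(2)])
    fix i x p assume xp: "x \<in> ball xb r" "p \<in> ball pb r"
    show "GDERIV (\<lambda>y. \<phi> i (y, p)) x :> grad_x (\<phi> i) (x, p)"
      using xp r(2) by (intro gd) auto
    have "x \<in> ball xb (\<rho>f i)" "p \<in> ball pb (\<rho>f i)" using xp r(6) r4(2)[of i] by auto
    note \<rho>f'[OF this]
    then show "\<phi> i (xb, pb) = 0 \<Longrightarrow> grad_x (\<phi> i) (x, p) \<bullet> d \<le> - \<eta>"
      "\<phi> i (xb, pb) < 0 \<Longrightarrow> \<phi> i (x, p) < 0" by blast+
  qed (rule strict)
  interpret parametric_constraints \<phi> "\<lambda>i. grad_x (\<phi> i)" H xb pb r K d \<eta> by (rule constraints)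
  have pv: "parametric_variational \<phi> (\<lambda>i. grad_x (\<phi> i)) H xb pb r K d \<eta> f ((*v) A) vb"
  proof (rule parametric_variational.intro[OF constraints parametric_variational_axioms.intro])
    have "norm (f (x, p) - f (x', p')) \<le> K * (norm (x - x') + norm (p - p'))"
      if "x \<in> ball xb r" "p \<in> ball pb r" "x' \<in> ball xb r" "p' \<in> ball pb r" for x p x' p'
    proof -
      have "norm (f (x, p) - f (x', p)) \<le> norm (f (x, p) - f (x', p) - A *v (x - x')) + norm (A *v (x - x'))"
        using norm_triangle_ineq[of "f (x, p) - f (x', p) - A *v (x - x')" "A *v (x - x')"] by simp
      also have "\<dots> \<le> norm (x - x') + B * norm (x - x')"
        using that r(5) by (intro add_mono f1 B(2)) auto
      also have "\<dots> \<le> K * norm (x - x')"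
        using mult_right_mono[OF K(3), of "norm (x - x')"] by (simp add: distrib_right)
      finally have 1: "norm (f (x, p) - f (x', p)) \<le> K * norm (x - x')" .
      have "x' \<in> U0" "p \<in> P0" "p' \<in> P0" using that r(3,4) r1(2) r2(2) by auto
      then have "norm (f (x', p) - f (x', p')) \<le> L0 * norm (p - p')" by (rule L0)
      also have "\<dots> \<le> K * norm (p - p')" using K(4) by (intro mult_right_mono) auto
      finally have 2: "norm (f (x', p) - f (x', p')) \<le> K * norm (p - p')" .
      have "norm (f (x, p) - f (x', p')) \<le> norm (f (x, p) - f (x', p)) + norm (f (x', p) - f (x', p'))"
        using norm_triangle_ineq[of "f (x, p) - f (x', p)" "f (x', p) - f (x', p')"] by simp
      then show ?thesis using 1 2 by (simp add: distrib_left)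
    qed
    then show "lipschitz_near K r f xb pb" by (auto simp: lipschitz_near_def)
    show "\<exists>\<mu>. normal_multiplier xb pb \<mu> (vb - f (xb, pb))"
    proof -
      have "vb - f (xb, pb) \<in> limiting_normal_cone (feasible_set \<phi> pb) xb"
        using sol by (auto simp: solution_map_def)
      then show ?thesis using limiting_normal_cone_iff[OF near_base] by blast
    qed
  qed (rule A_lin f_strict)+
  interpret parametric_variational \<phi> "\<lambda>i. grad_x (\<phi> i)" H xb pb r K d \<eta> f "(*v) A" vb by (rule pv)
  have mult: "\<mu> \<in> multipliers f \<phi> (xb, pb) vb \<longleftrightarrow> multiplier xb pb vb \<mu>" for \<mu>
  proof -
    have "\<mu> \<bullet> (\<chi> i. \<phi> i (xb, pb)) = 0 \<longleftrightarrow> (\<forall>i. \<mu> $ i * \<phi> i (xb, pb) = 0)" if nn: "\<forall>i. 0 \<le> \<mu> $ i"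
    proof -
      have "\<mu> \<bullet> (\<chi> i. \<phi> i (xb, pb)) = 0 \<longleftrightarrow> (\<Sum>i\<in>UNIV. - (\<mu> $ i * \<phi> i (xb, pb))) = 0"
        by (simp add: inner_vec_def sum_negf)
      also have "\<dots> \<longleftrightarrow> (\<forall>i\<in>UNIV. - (\<mu> $ i * \<phi> i (xb, pb)) = 0)"
        using nn xb_feas by (intro sum_nonneg_eq_0_iff) (auto simp: mult_nonneg_nonpos)
      finally show ?thesis by simp
    qed
    moreover have "vb = Lagr f \<phi> \<mu> (xb, pb) \<longleftrightarrow> vb - f (xb, pb) = (\<Sum>i\<in>UNIV. (\<mu> $ i) *\<^sub>R grad_x (\<phi> i) (xb, pb))"
      by (auto simp: Lagr_def algebra_simps)
    ultimately show ?thesis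
      unfolding multipliers_def multiplier_def normal_multiplier_def by auto
  qed
  have jac: "jacobian_x (Lagr f \<phi> \<mu>) (xb, pb) *v u = A *v u + (\<Sum>i\<in>UNIV. (\<mu> $ i) *\<^sub>R H i u)" for \<mu> u
  proof -
    note f' = strict_partial_derivative_imp_has_derivative[OF f_strict A_lin]
    note g' = strict_partial_derivative_imp_has_derivative[OF strict H_lin]
    have L': "((\<lambda>y. Lagr f \<phi> \<mu> (y, pb)) has_derivative (\<lambda>h. A *v h + (\<Sum>i\<in>UNIV. (\<mu> $ i) *\<^sub>R H i h))) (at xb)"
      unfolding Lagr_def by (intro has_derivative_add has_derivative_sum has_derivative_scaleR_right f' g')
    then have "(\<lambda>y. Lagr f \<phi> \<mu> (y, pb)) differentiable (at xb)" unfolding differentiable_def by blast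
    then have "((\<lambda>y. Lagr f \<phi> \<mu> (y, pb)) has_derivative (\<lambda>h. jacobian_x (Lagr f \<phi> \<mu>) (xb, pb) *v h)) (at xb)"
      unfolding jacobian_works by (simp add: jacobian_x_def)
    from has_derivative_unique[OF this L'] show ?thesis by (rule fun_cong)
  qed
  have "GSSOSC f \<phi> (xb, pb) vb \<longleftrightarrow> strong_second_order"
  proof -
    have strong: "i \<in> strongly_active_set \<phi> (xb, pb) \<mu> \<longleftrightarrow> 0 < \<mu> $ i" if "multiplier xb pb vb \<mu>" for i \<mu>
      using multiplier_complementary[OF that, of i] by (auto simp: strongly_active_set_def active_set_def)
    have quad: "u \<bullet> (jacobian_x (Lagr f \<phi> \<mu>) (xb, pb) *v u) = curvature \<mu> u" for u \<mu>
      unfolding jac curvature_def by (simp add: inner_add_right inner_sum_right)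
    show ?thesis
      unfolding GSSOSC_def strong_second_order_def quad Ball_def mult by (auto simp: strong)
  qed
  then show thesis using that[OF r(7) pv[unfolded A_def]] by (simp add: A_def)
qed

lemma partial_LICQ_iff: "partial_LICQ \<phi> z \<longleftrightarrow> family_independent (\<lambda>i. grad_x (\<phi> i) z) {i. \<phi> i z = 0}"
  by (simp add: partial_LICQ_def family_independent_def active_set_def)

text \<open>Minus the sum of a system dual to the active gradients has inner product \<open>-1\<close> with each of them.\<close>

lemma partial_LICQ_imp_partial_MFCQ:
  fixes \<phi> :: "'m::finite \<Rightarrow> 'a::euclidean_space \<times> 'b \<Rightarrow> real"
  assumes "partial_LICQ \<phi> z"
  shows "partial_MFCQ \<phi> z"
proof -
  let ?I = "{i. \<phi> i z = 0}"
  obtain e where e: "\<And>i j. i \<in> ?I \<Longrightarrow> j \<in> ?I \<Longrightarrow> grad_x (\<phi> i) z \<bullet> e j = (if i = j then 1 else 0)"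
    using family_independent_dual assms unfolding partial_LICQ_iff by blast
  have "grad_x (\<phi> i) z \<bullet> (\<Sum>j\<in>?I. - e j) = - 1" if i: "i \<in> ?I" for i
  proof -
    have "grad_x (\<phi> i) z \<bullet> (\<Sum>j\<in>?I. - e j) = (\<Sum>j\<in>?I. if i = j then - 1 else 0)"
      unfolding inner_sum_right using e i by (intro sum.cong) auto
    then show ?thesis using i by simp
  qed
  then show ?thesis unfolding partial_MFCQ_def active_set_def by (metis neg_less_0_iff_less zero_less_one)
qed

theorem corollary6p5:
  fixes f :: "(real^'n) \<times> (real^'d) \<Rightarrow> real^'n"
    and \<phi> :: "'m::finite \<Rightarrow> (real^'n) \<times> (real^'d) \<Rightarrow> real"
    and xb vb :: "real^'n" and pb :: "real^'d"
  assumes sol: "xb \<in> solution_map f \<phi> vb pb"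
    and phi_C2: "\<And>i. C2_smooth_around (\<phi> i) (xb, pb)"
    and f_diff: "\<forall>\<^sub>F (x, p) in nhds (xb, pb). (\<lambda>y. f (y, p)) differentiable (at x)"
    and f_jac_cont: "isCont (jacobian_x f) (xb, pb)"
    and f_lip: "\<exists>U0 P0 L0. xb \<in> interior U0 \<and> pb \<in> interior P0 \<and> L0 > 0 \<and>
        (\<forall>x\<in>U0. \<forall>p1\<in>P0. \<forall>p2\<in>P0. norm (f (x, p1) - f (x, p2)) \<le> L0 * norm (p1 - p2))"
  shows "(partial_MFCQ \<phi> (xb, pb) \<and> partial_CRCQ \<phi> (xb, pb) \<longrightarrow>
            GSSOSC f \<phi> (xb, pb) vb \<longrightarrow> lipschitzian_fully_stable f \<phi> xb vb pb) \<and>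
         (partial_LICQ \<phi> (xb, pb) \<longrightarrow>
            (GSSOSC f \<phi> (xb, pb) vb \<longleftrightarrow> lipschitzian_fully_stable f \<phi> xb vb pb))"
proof (intro conjI impI)
  assume cq: "partial_MFCQ \<phi> (xb, pb) \<and> partial_CRCQ \<phi> (xb, pb)" and sosc: "GSSOSC f \<phi> (xb, pb) vb"
  obtain W where W: "(xb, pb) \<in> interior W" and rank: "\<forall>J\<subseteq>active_set \<phi> (xb, pb). \<forall>w\<in>W. \<forall>w'\<in>W.
      dim ((\<lambda>i. grad_x (\<phi> i) w) ` J) = dim ((\<lambda>i. grad_x (\<phi> i) w') ` J)"
    using conjunct2[OF cq] unfolding partial_CRCQ_def by (elim exE conjE) (rule that)
  obtain R where R: "0 < R" "\<And>x p. x \<in> ball xb R \<Longrightarrow> p \<in> ball pb R \<Longrightarrow> (x, p) \<in> interior W"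
    using isCont_pair_ball[where g = "\<lambda>z. z" and xb = xb and pb = pb and S = "interior W"] W by auto
  obtain H r K d \<eta> where rR: "r \<le> R" and
    pv: "parametric_variational \<phi> (\<lambda>i. grad_x (\<phi> i)) H xb pb r K d \<eta> f ((*v) (jacobian_x f (xb, pb))) vb"
    and so: "GSSOSC f \<phi> (xb, pb) vb \<longleftrightarrow>
      parametric_variational.strong_second_order \<phi> (\<lambda>i. grad_x (\<phi> i)) H xb pb f ((*v) (jacobian_x f (xb, pb))) vb"
    by (rule parametric_variational_instance[OF sol phi_C2 f_diff f_jac_cont f_lip conjunct1[OF cq] R(1)])
  interpret parametric_variational \<phi> "\<lambda>i. grad_x (\<phi> i)" H xb pb r K d \<eta> f "(*v) (jacobian_x f (xb, pb))" vb
    by (rule pv)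
  show "lipschitzian_fully_stable f \<phi> xb vb pb"
  proof (rule second_order_imp_fully_stable)
    show strong_second_order using so sosc by blast
    fix x p J
    assume n: "near x p" and J: "\<And>i. i \<in> J \<Longrightarrow> \<phi> i (xb, pb) = 0"
      and ind: "family_independent (\<lambda>i. grad_x (\<phi> i) (x, p)) J"
    have "(x, p) \<in> W" using R(2)[of x p] n rR interior_subset by fastforce
    moreover have "(xb, pb) \<in> W" using W interior_subset by blast
    moreover have "J \<subseteq> active_set \<phi> (xb, pb)" using J by (auto simp: active_set_def)
    ultimately have "dim ((\<lambda>i. grad_x (\<phi> i) (x, p)) ` J) = dim ((\<lambda>i. grad_x (\<phi> i) (xb, pb)) ` J)"
      using rank by metis
    then show "family_independent (\<lambda>i. grad_x (\<phi> i) (xb, pb)) J"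
      by (rule family_independent_if_same_rank[OF ind])
  qed
next
  assume licq: "partial_LICQ \<phi> (xb, pb)"
  obtain H r K d \<eta> where
    pv: "parametric_variational \<phi> (\<lambda>i. grad_x (\<phi> i)) H xb pb r K d \<eta> f ((*v) (jacobian_x f (xb, pb))) vb"
    and so: "GSSOSC f \<phi> (xb, pb) vb \<longleftrightarrow>
      parametric_variational.strong_second_order \<phi> (\<lambda>i. grad_x (\<phi> i)) H xb pb f ((*v) (jacobian_x f (xb, pb))) vb"
    by (rule parametric_variational_instance[OF sol phi_C2 f_diff f_jac_cont f_lip
        partial_LICQ_imp_partial_MFCQ[OF licq] zero_less_one])
  interpret parametric_variational \<phi> "\<lambda>i. grad_x (\<phi> i)" H xb pb r K d \<eta> f "(*v) (jacobian_x f (xb, pb))" vb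
    by (rule pv)
  have ind: "family_independent (\<lambda>i. grad_x (\<phi> i) (xb, pb)) {i. \<phi> i (xb, pb) = 0}"
    using licq by (simp add: partial_LICQ_iff)
  show "GSSOSC f \<phi> (xb, pb) vb \<longleftrightarrow> lipschitzian_fully_stable f \<phi> xb vb pb"
  proof
    assume "GSSOSC f \<phi> (xb, pb) vb"
    then have strong_second_order using so by blast
    then show "lipschitzian_fully_stable f \<phi> xb vb pb"
      by (rule second_order_imp_fully_stable) (use family_independent_mono[OF ind] in blast)
  next
    assume "lipschitzian_fully_stable f \<phi> xb vb pb"
    then show "GSSOSC f \<phi> (xb, pb) vb" using fully_stable_imp_second_order ind so by blast
  qed
qed

end
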